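(* There exists an absolute constant $C>0$ such that every $(n,d,\lambda)$-graph with $d/\lambda \ge C(\log n)^{1/3}$ contains a Hamilton cycle.
   Context: An $(n,d,\lambda)$-graph is an $n$-vertex $d$-regular graph whose second largest eigenvalue in absolute value (of its adjacency matrix) is at most $\lambda$. A Hamilton cycle is a cycle passing through all vertices of the graph. *)

theory Defs
  imports "Jordan_Normal_Form.Char_Poly" "HOL-Computational_Algebra.Polynomial"
begin

definition simple_graph :: "nat \<Rightarrow> (nat \<Rightarrow> nat \<Rightarrow> bool) \<Rightarrow> bool" where
  "simple_graph n E \<longleftrightarrow> (\<forall>i j. E i j \<longrightarrow> i < n \<and> j < n) \<and>
      (\<forall>i j. E i j \<longrightarrow> E j i) \<and> (\<forall>i. \<not> E i i)"

definition regular_graph :: "nat \<Rightarrow> (nat \<Rightarrow> nat \<Rightarrow> bool) \<Rightarrow> nat \<Rightarrow> bool" where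
  "regular_graph n E d \<longleftrightarrow> (\<forall>i<n. card {j. j < n \<and> E i j} = d)"

definition adj_matrix :: "nat \<Rightarrow> (nat \<Rightarrow> nat \<Rightarrow> bool) \<Rightarrow> real mat" where
  "adj_matrix n E = mat n n (\<lambda>(i,j). if E i j then 1 else 0)"

(* multiset of eigenvalues (with multiplicity) of the adjacency matrix:
   roots of its characteristic polynomial; for a real symmetric matrix all
   n eigenvalues are real *)
definition adj_eigenvalues :: "nat \<Rightarrow> (nat \<Rightarrow> nat \<Rightarrow> bool) \<Rightarrow> real multiset" where
  "adj_eigenvalues n E = proots (char_poly (adj_matrix n E))"

(* (n,d,lambda)-graph: n-vertex d-regular simple graph whose eigenvalues other
   than (one copy of) the top eigenvalue d all have absolute value <= lambda,
   i.e. max(|lambda_2|, |lambda_n|) <= lambda *)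
definition ndl_graph :: "nat \<Rightarrow> nat \<Rightarrow> real \<Rightarrow> (nat \<Rightarrow> nat \<Rightarrow> bool) \<Rightarrow> bool" where
  "ndl_graph n d lam E \<longleftrightarrow> simple_graph n E \<and> regular_graph n E d \<and>
     (\<forall>\<mu> \<in># adj_eigenvalues n E - {# real d #}. \<bar>\<mu>\<bar> \<le> lam)"

definition hamiltonian :: "nat \<Rightarrow> (nat \<Rightarrow> nat \<Rightarrow> bool) \<Rightarrow> bool" where
  "hamiltonian n E \<longleftrightarrow> n \<ge> 3 \<and> (\<exists>vs. distinct vs \<and> set vs = {0..<n} \<and>
      (\<forall>i<n. E (vs ! i) (vs ! ((i + 1) mod n))))"

end

(* The spectral gap gives the edge distribution e(X,Z) = d|X||Z|/n up to lam sqrt(|X||Z|). By the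
   local lemma the vertex set is coloured with about 2 (log n)^(1/12) colours so that every vertex keeps
   its share of neighbours in every colour; then small sets expand into every colour class. One class
   is reserved as a room in which disjoint connecting paths are embedded one after another by the
   Friedman-Pippenger argument. Inside the room there is a hub path made of many switches, each of
   which carries a spare path (a wire), such that a switch can exchange the tails of the hub and of
   its wire. Every other class is covered by one path through the room; two such paths form a linker:
   by rotating both of them simultaneously, all their vertices can be distributed over disjoint
   paths between any prescribed sets of ends and starts. What is left of the room is covered by at most
   about n/(log n)^(1/3) paths, linkers halve their number until they fit onto the wires,
   and one more linker closes everything into cycles that all pass through the hub or a wire. Toggling
   suitable switches merges these cycles into a Hamilton cycle. *)
theory Submission
  imports Defs "Jordan_Normal_Form.Spectral_Radius" "HOL-Analysis.Convex" "HOL-Library.FuncSet"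
    "HOL-Combinatorics.Orbits" "HOL-Real_Asymp.Real_Asymp"
begin

section \<open>Edge distribution from the spectral gap\<close>

text \<open>The obstacle is that expansion never says which end is joined to which start: a linker
  returns an arbitrary bijection. Between disjoint sets of paths any bijection is harmless, so the
  pool can be halved blindly; only the last linker closes cycles, and one toggle composes their
  successor permutation with a transposition, which merges two cycles. A linker can grow because a
  rotation moves one free end and only permutes the others among the paths: old links survive while
  a new pair of ends runs through \<mu> positions on either side. The room is the scarce resource. A
  connection between two given vertices costs about log n vertices, but only about log(\<mu>/q) if q
  candidates are on offer at each side, so merging is cheap until few paths remain. With x = (log
  n)^(1/12) a switch costs about x^24 vertices, so about n/x^28 switches are made, while \<mu> is
  about n/x^4; about x linkers bring the pool from \<mu> down to the number of wires since 2^x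
  outgrows every power of x. The total of order n/x^2 fits into one colour class of order
  n/x.\<close>

lemma symmetric_eigenvalue_real:
  fixes D :: "real mat"
  assumes D: "D \<in> carrier_mat n n" and sym: "\<And>i j. i < n \<Longrightarrow> j < n \<Longrightarrow> D $$ (i, j) = D $$ (j, i)"
    and ev: "eigenvalue (map_mat complex_of_real D) k"
  obtains r where "k = complex_of_real r" "eigenvalue D r"
proof -
  let ?C = "map_mat complex_of_real D"
  obtain v where v: "v \<in> carrier_vec n" "v \<noteq> 0\<^sub>v n" "?C *\<^sub>v v = k \<cdot>\<^sub>v v"
    using ev D unfolding eigenvalue_def eigenvector_def by auto
  define N where "N = (\<Sum>i<n. v $ i * cnj (v $ i))"
  have row: "(\<Sum>j<n. complex_of_real (D $$ (i, j)) * v $ j) = k * v $ i" if "i < n" for i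
  proof -
    have "(?C *\<^sub>v v) $ i = (\<Sum>j<n. complex_of_real (D $$ (i, j)) * v $ j)"
      using D v(1) that by (simp add: scalar_prod_def lessThan_atLeast0)
    then show ?thesis using v(1,3) that by simp
  qed
  \<comment> \<open>\<open>F\<close> is the Hermitian form of \<open>D\<close> at \<open>v\<close>:
    the eigenvector equation gives \<open>k * N\<close>, and symmetry of \<open>D\<close> makes it
    its own conjugate. As \<open>N\<close> is a positive real, \<open>k\<close> is real.\<close>
  define F where "F = (\<Sum>i<n. \<Sum>j<n. cnj (v $ i) * (complex_of_real (D $$ (i, j)) * v $ j))"
  have F: "F = k * N"
  proof -
    have "F = (\<Sum>i<n. cnj (v $ i) * (k * v $ i))"
      unfolding F_def sum_distrib_left[symmetric] using row by simp
    then show ?thesis by (simp add: N_def sum_distrib_left mult_ac)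
  qed
  have "cnj F = (\<Sum>i<n. \<Sum>j<n. v $ i * (complex_of_real (D $$ (i, j)) * cnj (v $ j)))"
    by (simp add: F_def)
  also have "\<dots> = (\<Sum>j<n. \<Sum>i<n. v $ i * (complex_of_real (D $$ (i, j)) * cnj (v $ j)))"
    by (rule sum.swap)
  also have "\<dots> = F" unfolding F_def using sym by (intro sum.cong) (auto simp: mult_ac)
  finally have "cnj F = F" .
  moreover have "cnj N = N" by (simp add: N_def mult.commute)
  ultimately have *: "cnj k * N = k * N" unfolding F by simp
  have Nr: "N = complex_of_real (\<Sum>i<n. (norm (v $ i))\<^sup>2)"
    unfolding N_def of_real_sum by (intro sum.cong) (simp_all add: complex_norm_square[symmetric] del: of_real_power)
  obtain i where i: "i < n" "v $ i \<noteq> 0" using v(1,2) by force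
  have "0 < (\<Sum>i<n. (norm (v $ i))\<^sup>2)" by (rule sum_pos2[of _ i]) (use i in auto)
  then have "N \<noteq> 0" unfolding Nr by (simp only: of_real_eq_0_iff)
  then have "cnj k = k" using * by simp
  then obtain r where r: "k = complex_of_real r" by (metis Reals_cases Reals_cnj_iff)
  have C: "?C \<in> carrier_mat n n" using D by simp
  have "poly (char_poly ?C) k = 0" using ev eigenvalue_root_char_poly[OF C] by blast
  then have "poly (char_poly D) r = 0"
    unfolding of_real_hom.char_poly_hom[OF D] r by simp
  then show ?thesis using that r eigenvalue_root_char_poly[OF D] by blast
qed

lemma pow_mat_mult_vec_sum:
  fixes M :: "real mat"
  assumes M: "M \<in> carrier_mat n n" and i: "i < n"
  shows "((\<lambda>y i. \<Sum>j<n. M $$ (i, j) * y j) ^^ k) x i = (if k = 0 then x i else \<Sum>j<n. (M ^\<^sub>m k) $$ (i, j) * x j)"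
proof -
  define f where "f = (\<lambda>y i. \<Sum>j<n. M $$ (i, j) * y j)"
  have "(f ^^ Suc k) x i = (\<Sum>j<n. (M ^\<^sub>m Suc k) $$ (i, j) * x j)" for k
  proof (induction k arbitrary: x)
    case 0
    have "1\<^sub>m (dim_row M) * M = M" using M by auto
    then show ?case by (simp add: f_def)
  next
    case (Suc k)
    have "(f ^^ Suc (Suc k)) x i = (f ^^ Suc k) (f x) i" by (simp add: funpow_swap1)
    also have "\<dots> = (\<Sum>j<n. (M ^\<^sub>m Suc k) $$ (i, j) * f x j)" by (rule Suc.IH)
    also have "\<dots> = (\<Sum>j<n. \<Sum>l<n. (M ^\<^sub>m Suc k) $$ (i, j) * M $$ (j, l) * x l)"
      by (simp add: f_def sum_distrib_left mult.assoc)
    also have "\<dots> = (\<Sum>l<n. \<Sum>j<n. (M ^\<^sub>m Suc k) $$ (i, j) * M $$ (j, l) * x l)" by (rule sum.swap)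
    also have "\<dots> = (\<Sum>l<n. (M ^\<^sub>m Suc (Suc k)) $$ (i, l) * x l)"
    proof (rule sum.cong[OF refl])
      fix l assume l: "l \<in> {..<n}"
      have "(M ^\<^sub>m Suc k * M) $$ (i, l) = (\<Sum>j<n. (M ^\<^sub>m Suc k) $$ (i, j) * M $$ (j, l))"
        using M i l pow_carrier_mat[OF M, of "Suc k"]
        by (simp add: scalar_prod_def lessThan_atLeast0 del: pow_mat.simps)
      then show "(\<Sum>j<n. (M ^\<^sub>m Suc k) $$ (i, j) * M $$ (j, l) * x l) = (M ^\<^sub>m Suc (Suc k)) $$ (i, l) * x l"
        by (simp add: sum_distrib_right)
    qed
    finally show ?case .
  qed
  then show ?thesis by (cases k) (simp_all add: f_def del: pow_mat.simps)
qed

text \<open>The squared norms of the iterates are log-convex, so an expanding first step would force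
  exponential growth; but the powers of a matrix of spectral radius below 1 are bounded.\<close>

lemma symmetric_contraction:
  fixes M :: "real mat"
  assumes M: "M \<in> carrier_mat n n" and sym: "\<And>i j. i < n \<Longrightarrow> j < n \<Longrightarrow> M $$ (i, j) = M $$ (j, i)"
    and ev: "\<And>r. eigenvalue M r \<Longrightarrow> \<bar>r\<bar> < 1"
  shows "(\<Sum>i<n. (\<Sum>j<n. M $$ (i, j) * x j)\<^sup>2) \<le> (\<Sum>i<n. (x i)\<^sup>2)"
proof (cases "n = 0")
  case False
  let ?C = "map_mat complex_of_real M"
  have C: "?C \<in> carrier_mat n n" using M by simp
  define f where "f = (\<lambda>y i. \<Sum>j<n. M $$ (i, j) * y j :: real)"
  define u where "u = (\<lambda>k. (f ^^ k) x)"
  define a where "a = (\<lambda>k. \<Sum>i<n. (u k i)\<^sup>2)"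
  have u_Suc: "u (Suc k) = f (u k)" for k by (simp add: u_def)
  have self_adj: "(\<Sum>i<n. f y i * z i) = (\<Sum>i<n. y i * f z i)" for y z :: "nat \<Rightarrow> real"
  proof -
    have "(\<Sum>i<n. f y i * z i) = (\<Sum>i<n. \<Sum>j<n. M $$ (i, j) * y j * z i)" by (simp add: f_def sum_distrib_right)
    also have "\<dots> = (\<Sum>j<n. \<Sum>i<n. M $$ (i, j) * y j * z i)" by (rule sum.swap)
    also have "\<dots> = (\<Sum>j<n. \<Sum>i<n. y j * (M $$ (j, i) * z i))" using sym by (intro sum.cong) auto
    finally show ?thesis by (simp add: f_def sum_distrib_left)
  qed
  \<comment> \<open>Self-adjointness rewrites the middle squared norm as the inner product of
    \<open>u k\<close> and \<open>u (Suc (Suc k))\<close>; Cauchy-Schwarz then gives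
    log-convexity.\<close>
  have lc: "(a (Suc k))\<^sup>2 \<le> a k * a (Suc (Suc k))" for k
  proof -
    have "a (Suc k) = (\<Sum>i<n. u k i * u (Suc (Suc k)) i)"
      using self_adj[of "u k" "u (Suc k)"] by (simp add: a_def u_Suc power2_eq_square)
    then show ?thesis using Cauchy_Schwarz_ineq_sum[of "u k" "u (Suc (Suc k))" "{..<n}"] by (simp add: a_def)
  qed
  have "spectral_radius ?C < 1"
  proof -
    have "spectral_radius ?C \<in> norm ` spectrum ?C" using spectral_radius_mem_max(1)[OF C] False by simp
    then obtain k where k: "eigenvalue ?C k" "spectral_radius ?C = norm k" by (auto simp: spectrum_def)
    obtain r where "k = complex_of_real r" "eigenvalue M r" using symmetric_eigenvalue_real[OF M sym k(1)] .
    then show ?thesis using ev k(2) by simp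
  qed
  from spectral_radius_jnf_norm_bound_less_1_upper_triangular[OF C this]
  obtain c where c: "\<And>k. norm_bound (?C ^\<^sub>m k) c" by blast
  have cM: "\<bar>(M ^\<^sub>m k) $$ (i, j)\<bar> \<le> c" if "i < n" "j < n" for k i j
  proof -
    have "?C ^\<^sub>m k = map_mat complex_of_real (M ^\<^sub>m k)" by (rule of_real_hom.mat_hom_pow[OF M, symmetric])
    then have "norm_bound (map_mat complex_of_real (M ^\<^sub>m k)) c" using c[of k] by simp
    then have "norm (complex_of_real ((M ^\<^sub>m k) $$ (i, j))) \<le> c"
      using that M pow_carrier_mat[OF M, of k] unfolding norm_bound_def by auto
    then show ?thesis by simp
  qed
  define B where "B = (\<Sum>j<n. c * \<bar>x j\<bar>)"
  have ub: "\<bar>u (Suc k) i\<bar> \<le> B" if i: "i < n" for k i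
  proof -
    have "u (Suc k) i = (\<Sum>j<n. (M ^\<^sub>m Suc k) $$ (i, j) * x j)"
      using pow_mat_mult_vec_sum[OF M i, of "Suc k" x] unfolding u_def f_def by (simp del: pow_mat.simps funpow.simps)
    also have "\<bar>\<dots>\<bar> \<le> (\<Sum>j<n. \<bar>(M ^\<^sub>m Suc k) $$ (i, j) * x j\<bar>)" by (rule sum_abs)
    also have "\<dots> \<le> B" unfolding B_def abs_mult
      by (intro sum_mono mult_right_mono) (use cM i in \<open>auto simp del: pow_mat.simps\<close>)
    finally show ?thesis .
  qed
  have ab: "a (Suc k) \<le> n * B\<^sup>2" for k
  proof -
    have "a (Suc k) \<le> (\<Sum>i<n. B\<^sup>2)" unfolding a_def
      by (intro sum_mono) (use ub in \<open>auto simp: power2_le_iff_abs_le\<close>, meson abs_ge_self abs_ge_zero order_trans power2_le_iff_abs_le ub)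
    then show ?thesis by simp
  qed
  have a0: "0 \<le> a k" for k unfolding a_def by (intro sum_nonneg) simp
  have "a 1 \<le> a 0"
  proof (rule ccontr)
    assume "\<not> a 1 \<le> a 0"
    then have gt: "a 1 > a 0" by simp
    have pos: "0 < a 0"
    proof (rule ccontr)
      assume "\<not> 0 < a 0"
      then have "a 0 = 0" using a0[of 0] by simp
      then have "(a (Suc 0))\<^sup>2 \<le> 0" using lc[of 0] by simp
      then show False using gt \<open>a 0 = 0\<close> by simp
    qed
    define r where "r = a 1 / a 0"
    have r1: "1 < r" using gt pos by (simp add: r_def)
    have grow: "0 < a k \<and> r * a k \<le> a (Suc k)" for k
    proof (induction k)
      case 0
      then show ?case using pos by (simp add: r_def)
    next
      case (Suc k)
      then have "0 < r * a k" using r1 by simp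
      then have p: "0 < a (Suc k)" using Suc by linarith
      have "r * a k * a (Suc k) \<le> (a (Suc k))\<^sup>2" using Suc p by (simp add: power2_eq_square mult_right_mono)
      also have "\<dots> \<le> a k * a (Suc (Suc k))" by (rule lc)
      finally have "a k * (r * a (Suc k)) \<le> a k * a (Suc (Suc k))" by (simp add: mult_ac)
      then show ?case using Suc p by simp
    qed
    have "r ^ k * a 0 \<le> a k" for k
    proof (induction k)
      case (Suc k)
      have "r * (r ^ k * a 0) \<le> r * a k" using Suc r1 by (intro mult_left_mono) auto
      then show ?case using grow[of k] by (simp add: mult.assoc)
    qed simp
    then have "r ^ Suc k * a 0 \<le> n * B\<^sup>2" for k using ab[of k] order_trans by blast
    then have "r ^ Suc k \<le> n * B\<^sup>2 / a 0" for k using pos by (simp add: pos_le_divide_eq)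
    moreover obtain k where "n * B\<^sup>2 / a 0 < r ^ k" using real_arch_pow[OF r1] by blast
    moreover have "r ^ k \<le> r ^ Suc k" using r1 by (intro power_increasing) auto
    ultimately show False by (meson less_le_trans not_less)
  qed
  then show ?thesis by (simp add: a_def u_def f_def)
qed simp

text \<open>The contraction lemma needs spectral radius strictly below 1, so \<open>M\<close> is
  divided by some \<open>t\<close> > \<open>lam\<close>, and \<open>t\<close> tends to
  \<open>lam\<close> at the end.\<close>

lemma symmetric_operator_bound:
  fixes M :: "real mat"
  assumes M: "M \<in> carrier_mat n n" and sym: "\<And>i j. i < n \<Longrightarrow> j < n \<Longrightarrow> M $$ (i, j) = M $$ (j, i)"
    and ev: "\<And>r. eigenvalue M r \<Longrightarrow> \<bar>r\<bar> \<le> lam" and lam: "0 \<le> lam"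
  shows "(\<Sum>i<n. (\<Sum>j<n. M $$ (i, j) * x j)\<^sup>2) \<le> lam\<^sup>2 * (\<Sum>i<n. (x i)\<^sup>2)"
proof -
  define a0 where "a0 = (\<Sum>i<n. (x i)\<^sup>2)"
  have bound: "(\<Sum>i<n. (\<Sum>j<n. M $$ (i, j) * x j)\<^sup>2) \<le> t\<^sup>2 * a0" if t: "t > lam" for t
  proof -
    have t0: "0 < t" using t lam by simp
    define D where "D = (1 / t) \<cdot>\<^sub>m M"
    have D: "D \<in> carrier_mat n n" using M by (simp add: D_def)
    have Dij: "D $$ (i, j) = M $$ (i, j) / t" if "i < n" "j < n" for i j using M that by (simp add: D_def)
    have evD: "\<bar>r\<bar> < 1" if evr: "eigenvalue D r" for r
    proof -
      obtain v where v: "v \<in> carrier_vec n" "v \<noteq> 0\<^sub>v n" "D *\<^sub>v v = r \<cdot>\<^sub>v v"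
        using evr D unfolding eigenvalue_def eigenvector_def by auto
      have "D *\<^sub>v v = (1 / t) \<cdot>\<^sub>v (M *\<^sub>v v)" unfolding D_def using M v(1) by (intro eq_vecI) auto
      then have "t \<cdot>\<^sub>v ((1 / t) \<cdot>\<^sub>v (M *\<^sub>v v)) = t \<cdot>\<^sub>v (r \<cdot>\<^sub>v v)" using v(3) by simp
      then have "M *\<^sub>v v = (t * r) \<cdot>\<^sub>v v" using t0 M v(1) by (auto simp: smult_smult_assoc)
      then have "eigenvalue M (t * r)" using v M unfolding eigenvalue_def eigenvector_def by auto
      then have "\<bar>t * r\<bar> \<le> lam" by (rule ev)
      then have "t * \<bar>r\<bar> \<le> lam" using t0 by (simp add: abs_mult)
      then have "t * \<bar>r\<bar> < t * 1" using t by linarith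
      then show ?thesis using t0 mult_less_cancel_left_pos by blast
    qed
    have "(\<Sum>i<n. (\<Sum>j<n. D $$ (i, j) * x j)\<^sup>2) \<le> a0"
      unfolding a0_def by (rule symmetric_contraction[OF D _ evD]) (use Dij sym in auto)
    moreover have "(\<Sum>i<n. (\<Sum>j<n. M $$ (i, j) * x j)\<^sup>2) = t\<^sup>2 * (\<Sum>i<n. (\<Sum>j<n. D $$ (i, j) * x j)\<^sup>2)"
      unfolding sum_distrib_left power_mult_distrib[symmetric]
      using Dij t0 by (intro sum.cong arg_cong[where f = "\<lambda>x. x\<^sup>2"]) (auto intro!: sum.cong)
    ultimately show ?thesis by (simp add: mult_left_mono)
  qed
  have "(\<lambda>m. (lam + 1 / real (Suc m))\<^sup>2 * a0) \<longlonglongrightarrow> (lam + 0)\<^sup>2 * a0"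
    by (intro tendsto_intros LIMSEQ_Suc[OF lim_1_over_n])
  then show ?thesis unfolding a0_def[symmetric]
    by (intro LIMSEQ_le_const[of _ "lam\<^sup>2 * a0"]) (auto intro!: exI[of _ 0] bound)
qed

text \<open>With \<open>J\<close> the all-ones matrix and \<open>B = A - (d/n) J\<close> we have \<open>B J = 0\<close>, so
  \<open>(x - B) (x - (d/n) J) = x (x - A)\<close>; this compares the eigenvalues of \<open>A\<close> and \<open>B\<close> with multiplicity.\<close>

lemma deflated_char_poly:
  fixes A B C :: "real mat"
  assumes A: "A \<in> carrier_mat n n" and B: "B \<in> carrier_mat n n" and C: "C \<in> carrier_mat n n"
    and BC: "B * C = 0\<^sub>m n n" and sum: "A = B + C"
  shows "char_poly B * char_poly C = [:0, 1:] ^ n * char_poly A"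
proof (rule poly_eq_poly_eq_iff[THEN iffD1], rule ext)
  fix x
  have cm: "- char_matrix M x = x \<cdot>\<^sub>m 1\<^sub>m n - M" if "M \<in> carrier_mat n n" for M :: "real mat"
    using that unfolding char_matrix_def by (intro eq_matI) auto
  let ?I = "x \<cdot>\<^sub>m 1\<^sub>m n :: real mat"
  have I: "?I \<in> carrier_mat n n" by simp
  have "(?I - B) * (?I - C) = (?I - B) * ?I - (?I - B) * C"
    by (rule mult_minus_distrib_mat) (use B C in auto)
  also have "(?I - B) * ?I = x \<cdot>\<^sub>m (?I - B)" 
    using mult_smult_distrib[of "?I - B" n n "1\<^sub>m n" n x] minus_carrier_mat[OF B, of ?I]
      right_mult_one_mat[OF minus_carrier_mat[OF B, of ?I]] by simp
  also have "(?I - B) * C = ?I * C - B * C" by (rule minus_mult_distrib_mat) (use B C in auto)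
  also have "\<dots> = x \<cdot>\<^sub>m C" using C unfolding BC by (intro eq_matI) auto
  also have "x \<cdot>\<^sub>m (?I - B) - x \<cdot>\<^sub>m C = x \<cdot>\<^sub>m (?I - A)"
    using B C unfolding sum by (intro eq_matI) (auto simp: algebra_simps)
  finally have "det (?I - B) * det (?I - C) = x ^ n * det (?I - A)"
    
    using det_mult[OF minus_carrier_mat[OF B, of ?I] minus_carrier_mat[OF C, of ?I]] A by (simp add: det_smult)
  then show "poly (char_poly B * char_poly C) x = poly ([:0, 1:] ^ n * char_poly A) x"
    
    using char_poly_matrix[OF A] char_poly_matrix[OF B] char_poly_matrix[OF C] cm[OF A] cm[OF B] cm[OF C]
    by (simp add: poly_power)
qed

text \<open>With \<open>B\<close> the adjacency matrix minus \<open>d / n\<close> in every entry,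
  the deviation is the bilinear form of \<open>B\<close> on the indicator vectors of
  \<open>X\<close> and \<open>Z\<close>; Cauchy-Schwarz and the operator bound finish.
  \<open>lam\<close> is kept apart from \<open>lam0\<close> so that any nonnegative upper bound,
  such as \<open>d / K\<close>, can be inserted.\<close>

theorem expander_mixing:
  assumes ndl: "ndl_graph n d lam0 E" and lam: "lam0 \<le> lam" "0 \<le> lam"
    and X: "X \<subseteq> {..<n}" and Z: "Z \<subseteq> {..<n}"
  shows "\<bar>real (card {(x, z) \<in> X \<times> Z. E x z}) - real d * card X * card Z / n\<bar> \<le> lam * sqrt (card X * card Z)"
proof (cases "n = 0")
  case True
  then have "X = {}" "Z = {}" using X Z by auto
  then show ?thesis by simp
next
  case False
  then have n: "0 < real n" by simp
  have sg: "simple_graph n E" and rg: "regular_graph n E d"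
    and ev: "\<And>r. r \<in># adj_eigenvalues n E - {# real d #} \<Longrightarrow> \<bar>r\<bar> \<le> lam0"
    using ndl by (auto simp: ndl_graph_def)
  have E_sym: "E i j = E j i" for i j using sg by (auto simp: simple_graph_def)
  define A where "A = adj_matrix n E"
  define C where "C = mat n n (\<lambda>(i, j). real d / n)"
  define B where "B = A - C"
  have car: "A \<in> carrier_mat n n" "B \<in> carrier_mat n n" "C \<in> carrier_mat n n"
    by (auto simp: A_def B_def C_def adj_matrix_def)
  have ent: "A $$ (i, j) = (if E i j then 1 else 0)" "C $$ (i, j) = real d / n"
    "B $$ (i, j) = (if E i j then 1 else 0) - real d / n" if "i < n" "j < n" for i j
    using that by (auto simp: A_def B_def C_def adj_matrix_def)
  have deg: "(\<Sum>j<n. if E i j then 1 else 0) = real d" if "i < n" for i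
  proof -
    have "(\<Sum>j<n. if E i j then 1 else 0) = real (card ({..<n} \<inter> {j. E i j}))"
      by (simp add: sum.If_cases)
    moreover have "{..<n} \<inter> {j. E i j} = {j. j < n \<and> E i j}" by auto
    ultimately show ?thesis using rg that by (simp add: regular_graph_def)
  qed
  have rowB: "(\<Sum>j<n. B $$ (i, j)) = 0" if "i < n" for i
    using deg[OF that] that n by (simp add: ent sum_subtractf)
  have BC: "B * C = 0\<^sub>m n n"
  proof (rule eq_matI)
    fix i j assume ij: "i < dim_row (0\<^sub>m n n :: real mat)" "j < dim_col (0\<^sub>m n n :: real mat)"
    have "(B * C) $$ (i, j) = (\<Sum>l<n. B $$ (i, l) * (real d / n))"
      using car ij by (simp add: scalar_prod_def lessThan_atLeast0 ent)
    also have "\<dots> = 0" unfolding sum_distrib_right[symmetric] using rowB ij by simp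
    finally show "(B * C) $$ (i, j) = 0\<^sub>m n n $$ (i, j)" using ij by simp
  qed (use car in auto)
  have "A = B + C" using car unfolding B_def by (intro eq_matI) auto
  note cp = deflated_char_poly[OF car(1,2,3) BC this]
  have ne: "char_poly M \<noteq> 0" if "M \<in> carrier_mat n n" for M :: "real mat"
    using degree_monic_char_poly[OF that] by auto
  have evB: "\<bar>r\<bar> \<le> lam" if r: "eigenvalue B r" for r
  proof (cases "r = 0")
    case False
    have oX: "order r ([:0, 1:] ^ n) = 0" using False by (intro order_0I) (simp add: poly_power)
    have "order r (char_poly B) + order r (char_poly C) = order r ([:0, 1:] ^ n) + order r (char_poly A)"
      using arg_cong[OF cp, of "order r"] ne car by (simp add: order_mult)
    then have oA: "order r (char_poly A) = order r (char_poly B) + order r (char_poly C)" using oX by simp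
    have oB: "1 \<le> order r (char_poly B)"
      using r eigenvalue_root_char_poly[OF car(2)] order_root[of "char_poly B" r] ne[OF car(2)] by auto
    \<comment> \<open>At \<open>r = d\<close> the constant matrix \<open>C\<close> supplies one
      root, so the multiplicity in \<open>A\<close> exceeds that in \<open>B\<close>; this pays for
      the copy of \<open>d\<close> that the definition of an (n,d,\<lambda>)-graph removes.\<close>
    have "1 \<le> order r (char_poly C)" if "r = real d"
    proof -
      have "C *\<^sub>v vec n (\<lambda>_. 1) = real d \<cdot>\<^sub>v vec n (\<lambda>_. 1)"
        using n by (intro eq_vecI) (auto simp: C_def scalar_prod_def)
      moreover have "vec n (\<lambda>_. 1) \<noteq> (0\<^sub>v n :: real vec)" using n by (auto simp: vec_eq_iff)
      ultimately have "eigenvalue C (real d)"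
        using car(3) unfolding eigenvalue_def eigenvector_def by (intro exI[of _ "vec n (\<lambda>_. 1)"]) auto
      then show ?thesis
        using that eigenvalue_root_char_poly[OF car(3)] order_root[of "char_poly C" r] ne[OF car(3)] by auto
    qed
    then have "0 < count (adj_eigenvalues n E - {# real d #}) r"
      using oA oB ne[OF car(1)] by (auto simp: adj_eigenvalues_def A_def[symmetric])
    then have "r \<in># adj_eigenvalues n E - {# real d #}" by (rule count_greater_zero_iff[THEN iffD1])
    then have "\<bar>r\<bar> \<le> lam0" by (rule ev)
    then show ?thesis using lam by simp
  qed (use lam in simp)
  define x where "x = (\<lambda>i. if i \<in> X then 1 else 0 :: real)"
  define z where "z = (\<lambda>i. if i \<in> Z then 1 else 0 :: real)"
  have fin: "finite X" "finite Z" using X Z finite_subset by blast+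
  have XI: "{..<n} \<inter> X = X" "{..<n} \<inter> Z = Z" using X Z by auto
  have sx: "(\<Sum>i<n. x i) = card X" "(\<Sum>i<n. z i) = card Z"
    unfolding x_def z_def by (simp_all add: sum.If_cases XI)
  have sq: "(x i)\<^sup>2 = x i" "(z i)\<^sup>2 = z i" for i by (simp_all add: x_def z_def)
  have sx2: "(\<Sum>i<n. (x i)\<^sup>2) = card X" "(\<Sum>i<n. (z i)\<^sup>2) = card Z"
    using sx by (simp_all add: sq)
  define y where "y = (\<lambda>i. \<Sum>j<n. B $$ (i, j) * z j)"
  have ybound: "(\<Sum>i<n. (y i)\<^sup>2) \<le> lam\<^sup>2 * card Z"
    unfolding y_def sx2(2)[symmetric]
    by (rule symmetric_operator_bound[OF car(2) _ evB lam(2)]) (use E_sym in \<open>auto simp: ent\<close>)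
  have "(\<Sum>i<n. x i * y i) = (\<Sum>i<n. \<Sum>j<n. x i * (if E i j then 1 else 0) * z j - real d / n * (x i * z j))"
    unfolding y_def sum_distrib_left by (intro sum.cong) (auto simp: ent algebra_simps)
  also have "\<dots> = (\<Sum>i<n. \<Sum>j<n. x i * (if E i j then 1 else 0) * z j) - real d / n * (card X * card Z)"
    unfolding sum_subtractf sum_distrib_left[symmetric] sum_distrib_right[symmetric] sx by simp
  also have "(\<Sum>i<n. \<Sum>j<n. x i * (if E i j then 1 else 0) * z j) = card {(x, z) \<in> X \<times> Z. E x z}"
  proof -
    have "(\<Sum>i<n. \<Sum>j<n. x i * (if E i j then 1 else 0) * z j) = (\<Sum>i\<in>X. \<Sum>j\<in>Z. if E i j then 1 else 0)"
      unfolding x_def z_def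
      by (intro sum.mono_neutral_cong_right) (use X Z in \<open>auto intro!: sum.mono_neutral_cong_right\<close>)
    also have "\<dots> = (\<Sum>q\<in>X \<times> Z. if E (fst q) (snd q) then 1 else 0)"
      by (simp add: sum.cartesian_product case_prod_beta)
    also have "\<dots> = card (X \<times> Z \<inter> {q. E (fst q) (snd q)})"
      using fin by (simp add: sum.If_cases)
    also have "X \<times> Z \<inter> {q. E (fst q) (snd q)} = {(x, z) \<in> X \<times> Z. E x z}" by auto
    finally show ?thesis .
  qed
  finally have main: "(\<Sum>i<n. x i * y i) = card {(x, z) \<in> X \<times> Z. E x z} - real d * card X * card Z / n"
    by (simp add: mult.assoc)
  have "(\<Sum>i<n. x i * y i)\<^sup>2 \<le> card X * (lam\<^sup>2 * card Z)"
    using Cauchy_Schwarz_ineq_sum[of x y "{..<n}"] ybound unfolding sx2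
    by (meson mult_left_mono of_nat_0_le_iff order_trans)
  also have "\<dots> = (lam * sqrt (card X * card Z))\<^sup>2" by (simp add: power_mult_distrib)
  finally show ?thesis unfolding main using lam(2) by (simp add: abs_le_square_iff[symmetric] abs_mult)
qed

section \<open>Balanced colourings by the local lemma\<close>

definition mix :: "'a set \<Rightarrow> ('a \<Rightarrow> 'b) \<Rightarrow> ('a \<Rightarrow> 'b) \<Rightarrow> 'a \<Rightarrow> 'b" where
  "mix S f g = (\<lambda>x. if x \<in> S then f x else g x)"

text \<open>Independence of events on disjoint coordinates, in counting form: exchanging the
  \<open>S\<close>-coordinates is an involution.\<close>

lemma card_independent:
  fixes V :: "'a set" and F :: "'a \<Rightarrow> 'b set"
  defines "O' \<equiv> PiE V F"
  assumes "A \<subseteq> O'" "B \<subseteq> O'"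
    and A: "\<And>f g. f \<in> O' \<Longrightarrow> g \<in> O' \<Longrightarrow> (\<And>x. x \<in> S \<Longrightarrow> f x = g x) \<Longrightarrow> f \<in> A \<Longrightarrow> g \<in> A"
    and B: "\<And>f g. f \<in> O' \<Longrightarrow> g \<in> O' \<Longrightarrow> (\<And>x. x \<notin> S \<Longrightarrow> f x = g x) \<Longrightarrow> f \<in> B \<Longrightarrow> g \<in> B"
  shows "card (A \<inter> B) * card O' = card A * card B"
proof -
  have mixO: "mix S f g \<in> O'" if "f \<in> O'" "g \<in> O'" for f g
    using that by (auto simp: O'_def mix_def PiE_iff extensional_def)
  define h where "h = (\<lambda>(f :: 'a \<Rightarrow> 'b, g). (mix S f g, mix S g f))"
  have hh: "h (h fg) = fg" for fg by (cases fg) (auto simp: h_def mix_def)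
  have mA: "mix S f g \<in> A" if "f \<in> A" "g \<in> O'" for f g
    by (rule A[of f]) (use that assms(2) mixO in \<open>auto simp: mix_def\<close>)
  have mB: "mix S f g \<in> B" if "f \<in> O'" "g \<in> B" for f g
    by (rule B[of g]) (use that assms(3) mixO in \<open>auto simp: mix_def\<close>)
  have "bij_betw h ((A \<inter> B) \<times> O') (A \<times> B)"
  proof (rule bij_betwI[where g = h])
    show "h \<in> (A \<inter> B) \<times> O' \<rightarrow> A \<times> B" using mA mB by (auto simp: h_def)
    show "h \<in> A \<times> B \<rightarrow> (A \<inter> B) \<times> O'"
    proof
      fix fg assume "fg \<in> A \<times> B"
      then obtain f g where fg: "fg = (f, g)" "f \<in> A" "g \<in> B" by blast
      then have O': "f \<in> O'" "g \<in> O'" using assms(2,3) by auto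
      show "h fg \<in> (A \<inter> B) \<times> O'" using mA[OF fg(2) O'(2)] mB[OF O'(1) fg(3)] mixO[OF O'(2,1)] fg(1)
        by (simp add: h_def)
    qed
  qed (simp_all add: hh)
  then have "card ((A \<inter> B) \<times> O') = card (A \<times> B)" by (rule bij_betw_same_card)
  then show ?thesis by (simp add: card_cartesian_product)
qed

text \<open>The induction bounds, for every set \<open>T\<close> of events, the share of
  \<open>A v\<close> among the functions avoiding all of \<open>T\<close> by \<open>2 * p\<close>.
  Probabilities appear as cardinalities cleared of denominators, and two events count as dependent
  when their coordinate sets \<open>S\<close> meet.\<close>

theorem symmetric_local_lemma:
  fixes V :: "'v set" and I :: "'a set" and F :: "'a \<Rightarrow> 'b set" and A :: "'v \<Rightarrow> ('a \<Rightarrow> 'b) set" and p :: real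
  defines "O' \<equiv> PiE I F"
  assumes fin: "finite V" "finite O'" "O' \<noteq> {}"
    and A: "\<And>v. v \<in> V \<Longrightarrow> A v \<subseteq> O'"
    and dep: "\<And>v f g. v \<in> V \<Longrightarrow> f \<in> O' \<Longrightarrow> g \<in> O' \<Longrightarrow> (\<And>x. x \<in> S v \<Longrightarrow> f x = g x) \<Longrightarrow> f \<in> A v \<Longrightarrow> g \<in> A v"
    and prob: "\<And>v. v \<in> V \<Longrightarrow> card (A v) \<le> p * card O'"
    and D: "\<And>v. v \<in> V \<Longrightarrow> card {u \<in> V. S u \<inter> S v \<noteq> {}} \<le> D"
    and small: "4 * p * real D \<le> 1" "4 * p \<le> 1" and p0: "0 \<le> p"
  shows "\<exists>f\<in>O'. \<forall>v\<in>V. f \<notin> A v"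
proof -
  define G where "G = (\<lambda>T. {f \<in> O'. \<forall>v\<in>T. f \<notin> A v})"
  have finG: "finite (G T)" for T using fin(2) by (simp add: G_def)
  have Ocard: "0 < card O'" using fin by (simp add: card_gt_0_iff)
  have step: "real (card (A v \<inter> G T)) \<le> 2 * p * card (G T)" if "v \<in> V" "T \<subseteq> V" for v T
    using that
  proof (induction "card T" arbitrary: v T rule: less_induct)
    case less
    have finT: "finite T" using less.prems(2) fin(1) by (rule finite_subset)
    define T1 where "T1 = {u \<in> T. S u \<inter> S v \<noteq> {}}"
    define T2 where "T2 = T - T1"
    have cT1: "card T1 \<le> D"
    proof -
      have "T1 \<subseteq> {u \<in> V. S u \<inter> S v \<noteq> {}}" using less.prems(2) by (auto simp: T1_def)
      then have "card T1 \<le> card {u \<in> V. S u \<inter> S v \<noteq> {}}" using fin(1) by (intro card_mono) auto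
      then show ?thesis using D[OF less.prems(1)] by linarith
    qed
    have T2: "T2 \<subseteq> V" "S u \<inter> S v = {}" if "u \<in> T2" for u
      using that less.prems(2) by (auto simp: T2_def T1_def)
    have indep: "card (A v \<inter> G T2) * card O' = card (A v) * card (G T2)"
      unfolding O'_def
    proof (rule card_independent[where S = "S v"], unfold O'_def[symmetric])
      show "A v \<subseteq> O'" by (rule A[OF less.prems(1)])
      show "G T2 \<subseteq> O'" by (auto simp: G_def)
      show "g \<in> A v" if "f \<in> O'" "g \<in> O'" "\<And>x. x \<in> S v \<Longrightarrow> f x = g x" "f \<in> A v" for f g
        by (rule dep[OF less.prems(1) that])
      show "g \<in> G T2" if fg: "f \<in> O'" "g \<in> O'" "\<And>x. x \<notin> S v \<Longrightarrow> f x = g x" "f \<in> G T2" for f g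
      proof -
        have "g \<notin> A u" if u: "u \<in> T2" for u
        proof
          assume g: "g \<in> A u"
          have "u \<in> V" using T2(1)[OF u] u by blast
          have "f \<in> A u"
          proof (rule dep[OF \<open>u \<in> V\<close> fg(2,1) _ g])
            fix x assume "x \<in> S u"
            then have "x \<notin> S v" using T2(2)[OF u] by blast
            then show "g x = f x" using fg(3) by simp
          qed
          then show False using fg(4) u by (simp add: G_def)
        qed
        then show ?thesis using fg(2) by (simp add: G_def)
      qed
    qed
    have "real (card (A v \<inter> G T2)) * card O' = card (A v) * real (card (G T2))"
      using indep by (metis of_nat_mult)
    also have "\<dots> \<le> p * card O' * card (G T2)" using prob[OF less.prems(1)] by (rule mult_right_mono) simp
    finally have "real (card (A v \<inter> G T2)) * card O' \<le> (p * card (G T2)) * card O'" by (simp add: mult_ac)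
    then have b1: "real (card (A v \<inter> G T2)) \<le> p * card (G T2)" using Ocard by simp
    \<comment> \<open>At most \<open>D\<close> events of \<open>T\<close> share coordinates with
      \<open>v\<close>, and by induction each removes at most a share \<open>2 * p\<close> of
      \<open>G T2\<close>; since \<open>4 * p * D \<le> 1\<close>, at least half of
      \<open>G T2\<close> survives in \<open>G T\<close>.\<close>
    have b2: "card (G T2) \<le> 2 * real (card (G T))"
    proof (cases "T1 = {}")
      case True
      then show ?thesis by (simp add: T2_def)
    next
      case False
      then have "T2 \<subset> T" by (auto simp: T2_def T1_def)
      then have lt: "card T2 < card T" using finT by (rule psubset_card_mono[rotated])
      have "G T2 \<subseteq> G T \<union> (\<Union>u\<in>T1. A u \<inter> G T2)" by (auto simp: G_def T2_def)
      then have "card (G T2) \<le> card (G T \<union> (\<Union>u\<in>T1. A u \<inter> G T2))"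
        using finG finT by (intro card_mono) (auto simp: T1_def)
      also have "\<dots> \<le> card (G T) + card (\<Union>u\<in>T1. A u \<inter> G T2)" by (rule card_Un_le)
      also have "card (\<Union>u\<in>T1. A u \<inter> G T2) \<le> (\<Sum>u\<in>T1. card (A u \<inter> G T2))"
        by (rule card_UN_le) (use finT in \<open>simp add: T1_def\<close>)
      finally have "real (card (G T2)) \<le> card (G T) + (\<Sum>u\<in>T1. real (card (A u \<inter> G T2)))"
        by (simp flip: of_nat_sum of_nat_add)
      also have "(\<Sum>u\<in>T1. real (card (A u \<inter> G T2))) \<le> (\<Sum>u\<in>T1. 2 * p * card (G T2))"
      proof (rule sum_mono)
        fix u assume "u \<in> T1"
        then have "u \<in> V" using less.prems(2) by (auto simp: T1_def)
        moreover have "T2 \<subseteq> V" using less.prems(2) by (auto simp: T2_def)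
        ultimately show "real (card (A u \<inter> G T2)) \<le> 2 * p * card (G T2)" by (rule less.hyps[OF lt])
      qed
      also have "\<dots> = (2 * p * card T1) * card (G T2)" by simp
      also have "\<dots> \<le> (1 / 2) * card (G T2)"
      proof (rule mult_right_mono)
        have "p * real (card T1) \<le> p * D" using cT1 p0 by (intro mult_left_mono) auto
        then show "2 * p * card T1 \<le> 1 / 2" using small(1) by linarith
      qed simp
      finally show ?thesis by simp
    qed
    have "card (A v \<inter> G T) \<le> card (A v \<inter> G T2)"
      using finG by (intro card_mono) (auto simp: G_def T2_def)
    then have "real (card (A v \<inter> G T)) \<le> p * card (G T2)" using b1 by linarith
    also have "\<dots> \<le> p * (2 * real (card (G T)))" using b2 p0 by (rule mult_left_mono)
    finally show ?case by simp
  qed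
  have "0 < card (G T)" if "T \<subseteq> V" for T
    using finite_subset[OF that fin(1)] that
  proof (induction T rule: finite_induct)
    case empty
    then show ?case using Ocard by (simp add: G_def)
  next
    case (insert v T)
    have G: "G (insert v T) = G T - A v \<inter> G T" by (auto simp: G_def)
    have "card (G (insert v T)) = card (G T) - card (A v \<inter> G T)"
      unfolding G by (rule card_Diff_subset) (use finG in auto)
    moreover have "real (card (A v \<inter> G T)) \<le> 2 * p * card (G T)" using step insert.prems by blast
    moreover have "2 * p * card (G T) \<le> (1 / 2) * card (G T)" using small(2) by (intro mult_right_mono) auto
    moreover have "0 < card (G T)" using insert by blast
    ultimately show ?case by linarith
  qed
  then have "G V \<noteq> {}" by (metis card.empty order_refl less_numeral_extra(3))
  then show ?thesis by (auto simp: G_def)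
qed

text \<open>An exponential-moment estimate. A colouring gets a factor 1/2 for every vertex of
  \<open>N\<close> coloured \<open>c\<close>; the weights multiply over the vertices, so their mean
  is (1 - 1/(2M))^d, at most exp(-d/(2M)), whereas a colouring with fewer than d/(4M) such vertices
  weighs at least exp(-d/(4M)) because 1/2 > 1/e. The threshold is a quarter of the expectation
  d/M.\<close>

lemma card_few_of_one_colour:
  fixes M :: nat
  assumes V: "finite V" and N: "N \<subseteq> V" "card N = d" and c: "c < M"
  shows "real (card {f \<in> PiE V (\<lambda>_. {..<M}). real (card {x \<in> N. f x = c}) < d / (4 * M)})
    \<le> exp (- d / (4 * M)) * card (PiE V (\<lambda>_. {..<M}))"
proof -
  let ?O = "PiE V (\<lambda>_. {..<M})"
  let ?B = "{f \<in> ?O. real (card {x \<in> N. f x = c}) < d / (4 * M)}"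
  have M0: "0 < real M" using c by simp
  have finN: "finite N" using N(1) V by (rule finite_subset)
  have finO: "finite ?O" using V by (intro finite_PiE) auto
  define w where "w = (\<lambda>x i. if x \<in> N \<and> i = c then 1 / 2 else 1 :: real)"
  have weight: "(\<Prod>x\<in>V. w x (f x)) = (1 / 2) ^ card {x \<in> N. f x = c}" for f
  proof -
    have "(\<Prod>x\<in>V. w x (f x)) = (\<Prod>x\<in>V \<inter> {x. x \<in> N \<and> f x = c}. 1 / 2)"
      unfolding w_def using V by (simp add: prod.If_cases)
    also have "V \<inter> {x. x \<in> N \<and> f x = c} = {x \<in> N. f x = c}" using N(1) by blast
    finally show ?thesis by simp
  qed
  have fac: "(\<Sum>i<M. w x i) = (if x \<in> N then M - 1 / 2 else M)" for x
  proof -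
    have "(\<Sum>i<M. w x i) = (\<Sum>i<M. 1 - (if x \<in> N \<and> i = c then 1 / 2 else 0))" by (intro sum.cong) (auto simp: w_def)
    also have "\<dots> = M - (\<Sum>i<M. if x \<in> N \<and> i = c then 1 / 2 else 0)" by (simp add: sum_subtractf)
    also have "(\<Sum>i<M. if x \<in> N \<and> i = c then 1 / 2 else 0) = (if x \<in> N then 1 / 2 else 0 :: real)"
      using c by simp
    finally show ?thesis by simp
  qed
  have "exp (- (d / (4 * M))) * card ?B = (\<Sum>f\<in>?B. exp (- (d / (4 * M))))" by simp
  also have "\<dots> \<le> (\<Sum>f\<in>?B. (1 / 2) ^ card {x \<in> N. f x = c})"
  proof (rule sum_mono)
    fix f assume "f \<in> ?B"
    then have le: "real (card {x \<in> N. f x = c}) \<le> d / (4 * M)" by simp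
    have "exp (- (d / (4 * M))) \<le> exp (- real (card {x \<in> N. f x = c}))" using le by simp
    also have "\<dots> = exp (- 1) ^ card {x \<in> N. f x = c}" by (simp add: exp_of_nat_mult[symmetric])
    also have "\<dots> \<le> (1 / 2) ^ card {x \<in> N. f x = c}"
    proof (rule power_mono)
      have "2 \<le> exp (1::real)" using exp_ge_add_one_self[of 1] by simp
      then show "exp (- 1) \<le> 1 / (2::real)" by (simp add: exp_minus field_simps)
    qed simp
    finally show "exp (- (d / (4 * M))) \<le> (1 / 2) ^ card {x \<in> N. f x = c}" .
  qed
  also have "\<dots> \<le> (\<Sum>f\<in>?O. (1 / 2) ^ card {x \<in> N. f x = c})" by (rule sum_mono2[OF finO]) auto
  also have "\<dots> = (\<Sum>f\<in>?O. \<Prod>x\<in>V. w x (f x))" by (simp add: weight)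
  also have "\<dots> = (\<Prod>x\<in>V. \<Sum>i<M. w x i)" using V by (subst prod_sum_PiE) auto
  also have "\<dots> = (\<Prod>x\<in>V. M * (if x \<in> N then 1 - 1 / (2 * M) else 1))"
    using M0 by (intro prod.cong) (auto simp: fac field_simps)
  also have "\<dots> = M ^ card V * (1 - 1 / (2 * M)) ^ card (V \<inter> N)"
    using V by (simp add: prod.distrib prod.If_cases Int_def)
  also have "V \<inter> N = N" using N(1) by blast
  also have "M ^ card V = card ?O" using V by (simp add: card_PiE)
  finally have 1: "exp (- (d / (4 * M))) * card ?B \<le> card ?O * (1 - 1 / (2 * M)) ^ d" using N(2) by simp
  have "(1 - 1 / (2 * M)) ^ d \<le> exp (- (1 / (2 * M))) ^ d"
    using M0 exp_ge_add_one_self[of "- (1 / (2 * M))"] c by (intro power_mono) (auto simp: field_simps)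
  also have "\<dots> = exp (- (d / (2 * M)))" by (simp add: exp_of_nat_mult[symmetric])
  finally have "exp (- (d / (4 * M))) * card ?B \<le> card ?O * exp (- (d / (2 * M)))"
    using 1 by (meson mult_left_mono of_nat_0_le_iff order_trans)
  also have "exp (- (d / (2 * M))) = exp (- (d / (4 * M))) * exp (- (d / (4 * M)))"
    by (simp add: exp_add[symmetric] field_simps)
  finally have "exp (- (d / (4 * M))) * card ?B \<le> exp (- (d / (4 * M))) * (exp (- (d / (4 * M))) * card ?O)"
    by (simp add: mult_ac)
  then show ?thesis by simp
qed

text \<open>The local lemma enters because \<open>d\<close> is only known to be at least of order
  (ln n)^(2/3), too small for a union bound over all vertices. Neighbourhoods of \<open>u\<close>
  and \<open>v\<close> meet only if \<open>u\<close> is a neighbour of a neighbour of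
  \<open>v\<close>, so at most d^2 events share coordinates with a given one and the condition on
  \<open>d\<close> is free of the number of vertices.\<close>

theorem balanced_colouring:
  fixes M d :: nat and N :: "'a \<Rightarrow> 'a set"
  assumes V: "finite V" and N: "\<And>v. v \<in> V \<Longrightarrow> N v \<subseteq> V \<and> card (N v) = d"
    and sym: "\<And>u v. u \<in> V \<Longrightarrow> v \<in> V \<Longrightarrow> u \<in> N v \<longleftrightarrow> v \<in> N u"
    and M: "0 < M" and small: "4 * (M * exp (- d / (4 * M))) * (real d)\<^sup>2 \<le> 1"
  obtains f where "\<And>v. v \<in> V \<Longrightarrow> f v < M"
    "\<And>v c. v \<in> V \<Longrightarrow> c < M \<Longrightarrow> d / (4 * M) \<le> card {x \<in> N v. f x = c}"
proof (cases "d = 0")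
  case True
  then show ?thesis using that[of "\<lambda>_. 0"] M by simp
next
  case False
  let ?O = "PiE V (\<lambda>_. {..<M})"
  have finO: "finite ?O" using V by (intro finite_PiE) auto
  have neO: "?O \<noteq> {}" using M by (auto simp: PiE_eq_empty_iff)
  define B where "B = (\<lambda>v c. {f \<in> ?O. real (card {x \<in> N v. f x = c}) < d / (4 * M)})"
  define A where "A = (\<lambda>v. \<Union>c<M. B v c)"
  define p where "p = M * exp (- d / (4 * M))"
  have finN: "finite (N v)" if "v \<in> V" for v using N[OF that] V finite_subset by blast
  have "\<exists>f\<in>?O. \<forall>v\<in>V. f \<notin> A v"
  proof (rule symmetric_local_lemma[where S = N and p = p and D = "d\<^sup>2"])
    show "A v \<subseteq> ?O" if "v \<in> V" for v by (auto simp: A_def B_def)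
    show "g \<in> A v" if "v \<in> V" "f \<in> ?O" "g \<in> ?O" "\<And>x. x \<in> N v \<Longrightarrow> f x = g x" "f \<in> A v" for v f g
    proof -
      have "{x \<in> N v. f x = c} = {x \<in> N v. g x = c}" for c using that(4) by auto
      then show ?thesis using that(3,5) by (auto simp: A_def B_def)
    qed
    show "card (A v) \<le> p * card ?O" if v: "v \<in> V" for v
    proof -
      have "card (A v) \<le> (\<Sum>c<M. card (B v c))" unfolding A_def by (rule card_UN_le) simp
      then have "real (card (A v)) \<le> (\<Sum>c<M. real (card (B v c)))" by (simp flip: of_nat_sum)
      also have "\<dots> \<le> (\<Sum>c<M. exp (- d / (4 * M)) * card ?O)"
        by (intro sum_mono) (use card_few_of_one_colour[OF V] N[OF v] in \<open>auto simp: B_def\<close>)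
      finally show ?thesis by (simp add: p_def mult.assoc)
    qed
    show "card {u \<in> V. N u \<inter> N v \<noteq> {}} \<le> d\<^sup>2" if v: "v \<in> V" for v
    proof -
      have "{u \<in> V. N u \<inter> N v \<noteq> {}} \<subseteq> (\<Union>x\<in>N v. N x)"
      proof
        fix u assume "u \<in> {u \<in> V. N u \<inter> N v \<noteq> {}}"
        then obtain x where x: "u \<in> V" "x \<in> N u" "x \<in> N v" by blast
        then have "x \<in> V" using N[OF v] by blast
        then show "u \<in> (\<Union>x\<in>N v. N x)" using x sym by blast
      qed
      moreover have fin: "finite (\<Union>x\<in>N v. N x)" using finN N v by (meson finite_UN_I subsetD)
      ultimately have "card {u \<in> V. N u \<inter> N v \<noteq> {}} \<le> card (\<Union>x\<in>N v. N x)" by (intro card_mono) auto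
      also have "\<dots> \<le> (\<Sum>x\<in>N v. card (N x))" by (rule card_UN_le[OF finN[OF v]])
      also have "\<dots> = (\<Sum>x\<in>N v. d)" using N v by (intro sum.cong) auto
      finally show ?thesis using N[OF v] by (simp add: power2_eq_square)
    qed
    show "4 * p * real (d\<^sup>2) \<le> 1" using small by (simp add: p_def)
    have p0: "0 \<le> p" by (simp add: p_def)
    then show "0 \<le> p" .
    have "1 \<le> (real d)\<^sup>2" using False by simp
    then have "4 * p * 1 \<le> 4 * p * (real d)\<^sup>2" using p0 by (intro mult_left_mono) auto
    then show "4 * p \<le> 1" using small by (simp add: p_def)
  qed (use V finO neO in auto)
  then obtain f where f: "f \<in> ?O" "\<And>v. v \<in> V \<Longrightarrow> f \<notin> A v" by blast
  show ?thesis
  proof (rule that[of f])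
    show "f v < M" if "v \<in> V" for v using f(1) that by auto
    show "d / (4 * M) \<le> card {x \<in> N v. f x = c}" if "v \<in> V" "c < M" for v c
      using f(1) f(2)[OF that(1)] that(2) by (auto simp: A_def B_def not_less)
  qed
qed

section \<open>Rotations of path systems\<close>

definition consec :: "'a list \<Rightarrow> 'a \<Rightarrow> 'a \<Rightarrow> bool" where
  "consec xs x y \<longleftrightarrow> (x, y) \<in> set (zip xs (tl xs))"

lemma consec_Nil [simp]: "\<not> consec [] x y"
  by (simp add: consec_def)

lemma consec_Cons: "consec (a # xs) x y \<longleftrightarrow> (xs \<noteq> [] \<and> x = a \<and> y = hd xs) \<or> consec xs x y"
  by (cases xs) (auto simp: consec_def)

lemma consec_append:
  "consec (xs @ ys) x y \<longleftrightarrow>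
     consec xs x y \<or> consec ys x y \<or> (xs \<noteq> [] \<and> ys \<noteq> [] \<and> x = last xs \<and> y = hd ys)"
  by (induction xs) (auto simp: consec_Cons)

lemma consec_rev: "consec (rev xs) x y \<longleftrightarrow> consec xs y x"
  by (induction xs) (auto simp: consec_append consec_Cons last_rev)

lemma consec_in_set: "consec xs x y \<Longrightarrow> x \<in> set xs \<and> y \<in> set xs"
  by (induction xs) (auto simp: consec_Cons)

lemma consec_pred_unique: "distinct xs \<Longrightarrow> consec xs y z \<Longrightarrow> consec xs y' z \<Longrightarrow> y = y'"
proof (induction xs)
  case (Cons a xs)
  show ?case
  proof (cases "xs \<noteq> [] \<and> z = hd xs")
    case True
    then obtain ys where xs: "xs = z # ys" by (metis list.collapse)
    have "\<not> consec xs w z" for w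
      using Cons.prems(1) consec_in_set[of ys w z] unfolding xs by (auto simp: consec_Cons)
    then show ?thesis using Cons.prems by (auto simp: consec_Cons)
  next
    case False
    then show ?thesis using Cons by (auto simp: consec_Cons)
  qed
qed simp

lemma consec_succ_unique: "distinct xs \<Longrightarrow> consec xs z y \<Longrightarrow> consec xs z y' \<Longrightarrow> y = y'"
  using consec_pred_unique[of "rev xs"] by (simp add: consec_rev)

lemma card_image_relation_le:
  assumes "finite S" "\<And>z y y'. R z y \<Longrightarrow> R z y' \<Longrightarrow> y = y'"
  shows "finite {y. \<exists>z\<in>S. R z y} \<and> card {y. \<exists>z\<in>S. R z y} \<le> card S"
proof -
  have "{y. \<exists>z\<in>S. R z y} \<subseteq> (\<lambda>z. SOME y. R z y) ` S"
  proof
    fix y assume "y \<in> {y. \<exists>z\<in>S. R z y}"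
    then obtain z where z: "z \<in> S" "R z y" by auto
    have "R z (SOME y. R z y)" using z(2) by (rule someI)
    then show "y \<in> (\<lambda>z. SOME y. R z y) ` S" using z assms(2) by blast
  qed
  with assms(1) show ?thesis
    by (meson card_image_le card_mono finite_imageI finite_subset le_trans)
qed

locale fin_graph =
  fixes V :: "'a set" and E :: "'a \<Rightarrow> 'a \<Rightarrow> bool"
  assumes finite_V: "finite V"
    and E_in_V: "E x y \<Longrightarrow> x \<in> V \<and> y \<in> V"
    and E_sym: "E x y \<Longrightarrow> E y x"
    and E_irrefl: "\<not> E x x"
begin

definition nb :: "'a set \<Rightarrow> 'a set" where
  "nb U = {y. \<exists>x\<in>U. E x y}"

definition is_path :: "'a list \<Rightarrow> bool" where
  "is_path xs \<longleftrightarrow> xs \<noteq> [] \<and> distinct xs \<and> successively E xs"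

text \<open>A family of disjoint paths, the path \<open>P s\<close> starting at the stub \<open>s \<in> S\<close>, which together
  cover the stubs and \<open>X\<close>.\<close>

definition fam :: "'a set \<Rightarrow> ('a \<Rightarrow> 'a list) \<Rightarrow> 'a set \<Rightarrow> bool" where
  "fam S P X \<longleftrightarrow> finite S \<and> S \<inter> X = {} \<and> (\<forall>s\<in>S. is_path (P s) \<and> hd (P s) = s) \<and>
     (\<forall>s\<in>S. \<forall>t\<in>S. s \<noteq> t \<longrightarrow> set (P s) \<inter> set (P t) = {}) \<and> (\<Union>s\<in>S. set (P s)) = S \<union> X"

lemma finite_nb: "finite (nb U)"
  by (rule finite_subset[OF _ finite_V]) (auto simp: nb_def dest: E_in_V)

lemma nb_subset_V: "nb U \<subseteq> V"
  by (auto simp: nb_def dest: E_in_V)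

lemma is_path_singleton [simp]: "is_path [x]"
  by (simp add: is_path_def)

lemma is_path_append:
  "xs \<noteq> [] \<Longrightarrow> ys \<noteq> [] \<Longrightarrow> is_path (xs @ ys) \<longleftrightarrow>
     is_path xs \<and> is_path ys \<and> set xs \<inter> set ys = {} \<and> E (last xs) (hd ys)"
  by (auto simp: is_path_def successively_append_iff)

lemma is_path_rev: "is_path (rev xs) \<longleftrightarrow> is_path xs"
proof -
  have "successively (\<lambda>x y. E y x) xs \<longleftrightarrow> successively E xs"
    by (metis E_sym successively_mono)
  then show ?thesis by (simp add: is_path_def successively_rev)
qed

text \<open>\<open>m\<close> names the path whose end is free to move. \<open>own\<close> is Posa's
  rotation on that path; \<open>other\<close> cuts another path in front of \<open>y\<close> and
  hands its tail to the path of \<open>m\<close>, after which the path of \<open>s\<close> is the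
  one with the free end. In both rules the free end moves to a vertex that was next to
  \<open>y\<close> on its path.\<close>

inductive rot :: "'a set \<Rightarrow> 'a set \<Rightarrow> ('a \<Rightarrow> 'a list) \<Rightarrow> 'a \<Rightarrow> ('a \<Rightarrow> 'a list) \<Rightarrow> 'a \<Rightarrow> bool"
  for S X P0 m0
where
  start: "rot S X P0 m0 P0 m0"
| other: "\<lbrakk>rot S X P0 m0 P m; s \<in> S; s \<noteq> m; P s = A @ y # B; y \<in> X; E (last (P m)) y\<rbrakk>
    \<Longrightarrow> rot S X P0 m0 (P(m := P m @ y # B, s := A)) s"
| own: "\<lbrakk>rot S X P0 m0 P m; P m = A @ y # B; B \<noteq> []; y \<in> X; E (last (P m)) y\<rbrakk>
    \<Longrightarrow> rot S X P0 m0 (P(m := A @ y # rev B)) m"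

definition unbroken :: "'a set \<Rightarrow> ('a \<Rightarrow> 'a list) \<Rightarrow> 'a \<Rightarrow> 'a \<Rightarrow> bool" where
  "unbroken S P x y \<longleftrightarrow> (\<exists>s\<in>S. consec (P s) x y \<or> consec (P s) y x)"

lemma fam_other:
  assumes f: "fam S P X" and mS: "m \<in> S" and sS: "s \<in> S" and sm: "s \<noteq> m"
    and Ps: "P s = A @ y # B" and yX: "y \<in> X" and e: "E (last (P m)) y"
  shows "fam S (P(m := P m @ y # B, s := A)) X" and "A \<noteq> []"
proof -
  have ps: "is_path (P s)" "hd (P s) = s" and pm: "is_path (P m)" "hd (P m) = m"
    using f sS mS by (auto simp: fam_def)
  have disj: "set (P s) \<inter> set (P m) = {}" using f sS mS sm unfolding fam_def by blast
  show A: "A \<noteq> []"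
  proof
    assume "A = []"
    then have "y = s" using ps Ps by simp
    then show False using f sS yX by (auto simp: fam_def)
  qed
  have pA: "is_path A" "is_path (y # B)" "set A \<inter> set (y # B) = {}"
    using ps(1) A unfolding Ps by (auto simp: is_path_append)
  have pm': "is_path (P m @ y # B)"
    using pm(1) pA(2) disj e Ps by (subst is_path_append) (auto simp: is_path_def)
  have hA: "hd A = s" using ps(2) Ps A by simp
  let ?P = "P(m := P m @ y # B, s := A)"
  have set_eq: "set (P m) \<union> set (P s) = set (?P m) \<union> set (?P s)" using sm Ps by auto
  have un: "(\<Union>t\<in>S. set (?P t)) = (\<Union>t\<in>S. set (P t))"
  proof -
    have "(\<Union>t\<in>S. set (Q t)) = (set (Q m) \<union> set (Q s)) \<union> (\<Union>t\<in>S-{m,s}. set (Q t))" for Q :: "'a \<Rightarrow> 'a list"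
      using mS sS by auto
    from this[of ?P] this[of P] set_eq show ?thesis by simp
  qed
  have dis: "set (?P t) \<inter> set (?P u) = {}" if "t \<in> S" "u \<in> S" "t \<noteq> u" for t u
  proof -
    have D: "set (P a) \<inter> set (P b) = {}" if "a \<in> S" "b \<in> S" "a \<noteq> b" for a b
      using f that unfolding fam_def by blast
    have Pm: "set (?P m) = set (P m) \<union> set (y # B)" using sm by simp
    have Psub: "set (?P t) \<subseteq> set (P t)" if "t \<noteq> m" for t using that Ps by auto
    have Pss: "set (?P s) = set A" by simp
    have X: "set (?P m) \<inter> set (?P w) = {}" if w: "w \<in> S" "w \<noteq> m" for w
    proof (cases "w = s")
      case True
      have "set A \<inter> set (P m) = {}" using disj Ps by auto
      then show ?thesis unfolding True Pm Pss using pA(3) by blast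
    next
      case False
      have "set (y # B) \<subseteq> set (P s)" unfolding Ps by auto
      then show ?thesis unfolding Pm using D[of m w] D[of s w] w False mS sS Psub[of w] by blast
    qed
    show ?thesis
    proof (cases "t = m \<or> u = m")
      case False
      then show ?thesis using D[OF that] Psub[of t] Psub[of u] by blast
    next
      case True
      then show ?thesis using X[of t] X[of u] that by (metis Int_commute)
    qed
  qed
  show "fam S ?P X"
    unfolding fam_def
  proof (intro conjI)
    show "\<forall>t\<in>S. is_path (?P t) \<and> hd (?P t) = t"
      using f pm' pm(2) pA(1) hA sm pm(1) by (auto simp: fam_def is_path_def)
    show "\<forall>t\<in>S. \<forall>u\<in>S. t \<noteq> u \<longrightarrow> set (?P t) \<inter> set (?P u) = {}" using dis by blast
  qed (use f un in \<open>auto simp: fam_def\<close>)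
qed

lemma fam_own:
  assumes f: "fam S P X" and mS: "m \<in> S"
    and Pm: "P m = A @ y # B" and B: "B \<noteq> []" and yX: "y \<in> X" and e: "E (last (P m)) y"
  shows "fam S (P(m := A @ y # rev B)) X"
proof -
  have pm: "is_path (P m)" "hd (P m) = m" using f mS by (auto simp: fam_def)
  have A: "A \<noteq> []"
  proof
    assume "A = []"
    then have "y = m" using pm Pm by simp
    then show False using f mS yX by (auto simp: fam_def)
  qed
  have "is_path ((A @ [y]) @ B)" using pm Pm by simp
  then have 1: "is_path (A @ [y])" "is_path B" "set (A @ [y]) \<inter> set B = {}"
    using is_path_append[of "A @ [y]" B] B by auto
  have "E y (last B)" using e Pm B E_sym by simp
  then have "is_path ((A @ [y]) @ rev B)"
    using 1 B is_path_append[of "A @ [y]" "rev B"] by (simp add: is_path_rev hd_rev)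
  then have p: "is_path (A @ y # rev B)" by simp
  let ?P = "P(m := A @ y # rev B)"
  have sets: "set (?P t) = set (P t)" for t using Pm by simp
  have "hd (A @ y # rev B) = m" using A pm Pm by simp
  then have "\<forall>t\<in>S. is_path (?P t) \<and> hd (?P t) = t" using f p by (auto simp: fam_def)
  then show ?thesis using f unfolding fam_def sets by blast
qed

text \<open>The ends of all paths but that of \<open>m\<close> only change owners: \<open>g\<close>
  names the initial path to which each of them belonged. In \<open>linked_step\<close> this
  preserves the links made earlier.\<close>

lemma rot_invariant:
  assumes "rot S X P0 m0 P m" and f0: "fam S P0 X" and m0: "m0 \<in> S"
  shows "fam S P X \<and> m \<in> S \<and>
    (\<exists>g. bij_betw g (S - {m}) (S - {m0}) \<and> (\<forall>s\<in>S-{m}. last (P s) = last (P0 (g s))))"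
  using assms(1)
proof induction
  case start
  then show ?case using f0 m0 by (auto intro!: exI[of _ id])
next
  case (other P m s A y B)
  then obtain g where f: "fam S P X" and m: "m \<in> S" and g: "bij_betw g (S - {m}) (S - {m0})"
    and gl: "\<And>t. t \<in> S - {m} \<Longrightarrow> last (P t) = last (P0 (g t))" by blast
  have f': "fam S (P(m := P m @ y # B, s := A)) X" "A \<noteq> []"
    using fam_other[OF f m other(2-6)] by auto
  \<comment> \<open>The path of \<open>m\<close> now ends where that of \<open>s\<close> did, so
    \<open>m\<close> takes over the label of \<open>s\<close>.\<close>
  let ?h = "\<lambda>t. if t = m then s else t"
  have b1: "bij_betw ?h (S - {s}) (S - {m})"
    using m \<open>s \<in> S\<close> \<open>s \<noteq> m\<close> by (auto simp: bij_betw_def inj_on_def image_def)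
  have "bij_betw (g \<circ> ?h) (S - {s}) (S - {m0})" using b1 g by (rule bij_betw_trans)
  moreover have "last ((P(m := P m @ y # B, s := A)) t) = last (P0 ((g \<circ> ?h) t))"
    if "t \<in> S - {s}" for t
    using that gl[of s] gl[of t] other(2,3,4) by auto
  ultimately show ?case using f' \<open>s \<in> S\<close> by blast
next
  case (own P m A y B)
  then have "fam S (P(m := A @ y # rev B)) X" using fam_own[of S P X m A y B] by blast
  moreover have "\<forall>s\<in>S-{m}. last ((P(m := A @ y # rev B)) s) = last (P s)" by simp
  ultimately show ?case using own.IH by metis
qed

lemma fam_consec_pred:
  assumes "fam S P X" "s \<in> S" "t \<in> S" "consec (P s) y z" "consec (P t) y' z"
  shows "y = y'"
proof -
  have "s = t"
  proof (rule ccontr)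
    assume "s \<noteq> t"
    then have "set (P s) \<inter> set (P t) = {}" using assms(1-3) unfolding fam_def by blast
    then show False using consec_in_set[OF assms(4)] consec_in_set[OF assms(5)] by blast
  qed
  then show ?thesis using assms consec_pred_unique[of "P s"] by (auto simp: fam_def is_path_def)
qed

lemma fam_consec_succ:
  assumes "fam S P X" "s \<in> S" "t \<in> S" "consec (P s) z y" "consec (P t) z y'"
  shows "y = y'"
proof -
  have "s = t"
  proof (rule ccontr)
    assume "s \<noteq> t"
    then have "set (P s) \<inter> set (P t) = {}" using assms(1-3) unfolding fam_def by blast
    then show False using consec_in_set[OF assms(4)] consec_in_set[OF assms(5)] by blast
  qed
  then show ?thesis using assms consec_succ_unique[of "P s"] by (auto simp: fam_def is_path_def)
qed

text \<open>Posa's argument: an edge of the initial paths is only ever broken next to an endpoint.\<close>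

lemma rot_unbroken:
  assumes "rot S X P0 m0 P m" and f0: "fam S P0 X" and m0: "m0 \<in> S"
    and T: "T = {last (P m) |P m. rot S X P0 m0 P m}"
    and w: "w \<notin> T" "\<And>z. unbroken S P0 w z \<Longrightarrow> z \<notin> T"
  shows "unbroken S P w z \<longleftrightarrow> unbroken S P0 w z"
  using assms(1)
proof (induction arbitrary: z)
  case start
  then show ?case by simp
next
  case (other P m s A y B)
  let ?P = "P(m := P m @ y # B, s := A)"
  have f: "fam S P X" and m: "m \<in> S" using rot_invariant[OF other(1) f0 m0] by auto
  have A: "A \<noteq> []" using fam_other(2)[OF f m other(2-6)] .
  have Pm: "P m \<noteq> []" using f m by (auto simp: fam_def is_path_def)
  have r: "rot S X P0 m0 ?P s" using other.hyps by (rule rot.other)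
  have xT: "last (P m) \<in> T" using other(1) T by blast
  have eT: "last A \<in> T"
  proof -
    have "last (?P s) \<in> T" unfolding T using r by blast
    then show ?thesis by simp
  qed
  have "unbroken S P y (last A)"
    unfolding unbroken_def using other(2,4) A by (intro bexI[of _ s]) (auto simp: consec_append)
  then have wy: "w \<noteq> y" using other.IH w eT by auto
  have eq: "unbroken S ?P w z \<longleftrightarrow> unbroken S P w z"
  proof -
    have *: "(\<exists>t\<in>S. Q t) \<longleftrightarrow> Q m \<or> Q s \<or> (\<exists>t\<in>S-{m,s}. Q t)" for Q
      using m other(2) by blast
    have ne: "w \<noteq> y" "w \<noteq> last (P m)" "w \<noteq> last A" using wy w(1) xT eT by auto
    have "(consec (P m @ y # B) w z \<or> consec (P m @ y # B) z w) \<or> (consec A w z \<or> consec A z w)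
      \<longleftrightarrow> (consec (P m) w z \<or> consec (P m) z w) \<or> (consec (A @ y # B) w z \<or> consec (A @ y # B) z w)"
      unfolding consec_append using ne A Pm by simp blast
    then have "(consec (?P m) w z \<or> consec (?P m) z w) \<or> (consec (?P s) w z \<or> consec (?P s) z w)
      \<longleftrightarrow> (consec (P m) w z \<or> consec (P m) z w) \<or> (consec (P s) w z \<or> consec (P s) z w)"
      using other(3,4) by simp
    then show ?thesis unfolding unbroken_def * by auto
  qed
  show ?case unfolding eq by (rule other.IH)
next
  case (own P m A y B)
  let ?P = "P(m := A @ y # rev B)"
  have f: "fam S P X" and m: "m \<in> S" using rot_invariant[OF own(1) f0 m0] by auto
  have r: "rot S X P0 m0 ?P m" using own.hyps by (rule rot.own)
  have xT: "last B \<in> T"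
  proof -
    have "last (P m) \<in> T" unfolding T using own(1) by blast
    then show ?thesis using own(2,3) by simp
  qed
  have eT: "hd B \<in> T"
  proof -
    have "last (?P m) \<in> T" unfolding T using r by blast
    then show ?thesis using own(3) by (simp add: last_rev)
  qed
  have "unbroken S P y (hd B)"
    unfolding unbroken_def using own(2,3) m by (intro bexI[of _ m]) (auto simp: consec_append consec_Cons)
  then have wy: "w \<noteq> y" using own.IH w eT by auto
  have eq: "unbroken S ?P w z \<longleftrightarrow> unbroken S P w z"
  proof -
    have *: "(\<exists>t\<in>S. Q t) \<longleftrightarrow> Q m \<or> (\<exists>t\<in>S-{m}. Q t)" for Q
      using m by blast
    have ne: "w \<noteq> y" "w \<noteq> last B" "w \<noteq> hd B" using wy w(1) xT eT by auto
    have "(consec (?P m) w z \<or> consec (?P m) z w) \<longleftrightarrow> (consec (P m) w z \<or> consec (P m) z w)"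
      unfolding own(2) fun_upd_same consec_append consec_Cons consec_rev using ne own(3)
      by (simp add: hd_rev) blast
    then show ?thesis unfolding unbroken_def * by auto
  qed
  show ?case unfolding eq by (rule own.IH)
qed

text \<open>\<open>T\<close> collects all positions of the free end. If \<open>y\<close> in
  \<open>X\<close> is adjacent to a member of \<open>T\<close>, rotating at \<open>y\<close> puts
  the free end on a path-neighbour of \<open>y\<close>. Unless \<open>y\<close> is in
  \<open>T\<close> or next to \<open>T\<close> on the initial paths, that neighbour is still an
  initial one and so cannot be in \<open>T\<close>, a contradiction. Hence \<open>y\<close> lies in
  \<open>T\<close> or precedes or follows a member of it, which explains the factor 3.\<close>

theorem rotation:
  assumes f0: "fam S P0 X" and m0: "m0 \<in> S"
  obtains T where "last (P0 m0) \<in> T" "T \<subseteq> S \<union> X" "card (nb T \<inter> X) \<le> 3 * card T"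
    "\<And>t. t \<in> T \<Longrightarrow> \<exists>P m g. fam S P X \<and> m \<in> S \<and> last (P m) = t \<and>
       bij_betw g (S - {m}) (S - {m0}) \<and> (\<forall>s\<in>S-{m}. last (P s) = last (P0 (g s)))"
proof -
  define T where T: "T = {last (P m) |P m. rot S X P0 m0 P m}"
  have TX: "T \<subseteq> S \<union> X"
  proof
    fix t assume "t \<in> T"
    then obtain P m where r: "rot S X P0 m0 P m" "t = last (P m)" by (auto simp: T)
    then have "fam S P X" "m \<in> S" using rot_invariant[OF r(1) f0 m0] by auto
    then show "t \<in> S \<union> X" unfolding fam_def r(2) is_path_def by (metis UN_I last_in_set)
  qed
  have "finite (S \<union> X)"
  proof -
    have "(\<Union>s\<in>S. set (P0 s)) = S \<union> X" "finite S" using f0 by (auto simp: fam_def)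
    then show ?thesis by (metis List.finite_set finite_UN)
  qed
  then have finT: "finite T" using TX finite_subset by blast
  define L where "L = {y. \<exists>z\<in>T. \<exists>s\<in>S. consec (P0 s) y z}"
  define R where "R = {y. \<exists>z\<in>T. \<exists>s\<in>S. consec (P0 s) z y}"
  have L: "finite L \<and> card L \<le> card T" unfolding L_def
    by (rule card_image_relation_le[OF finT]) (use fam_consec_pred[OF f0] in blast)
  have R: "finite R \<and> card R \<le> card T" unfolding R_def
    by (rule card_image_relation_le[OF finT]) (use fam_consec_succ[OF f0] in blast)
  have sub: "nb T \<inter> X \<subseteq> T \<union> L \<union> R"
  proof
    fix y assume "y \<in> nb T \<inter> X"
    then obtain x where x: "x \<in> T" "E x y" "y \<in> X" by (auto simp: nb_def)
    then obtain P m where r: "rot S X P0 m0 P m" "x = last (P m)" by (auto simp: T)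
    have f: "fam S P X" and m: "m \<in> S" using rot_invariant[OF r(1) f0 m0] by auto
    show "y \<in> T \<union> L \<union> R"
    proof (rule ccontr)
      assume ny: "y \<notin> T \<union> L \<union> R"
      then have nz: "\<And>z. unbroken S P0 y z \<Longrightarrow> z \<notin> T"
        by (auto simp: unbroken_def L_def R_def)
      have eq: "unbroken S P y z \<longleftrightarrow> unbroken S P0 y z" for z
        using rot_unbroken[OF r(1) f0 m0 T _ nz] ny by auto
      have "y \<in> (\<Union>s\<in>S. set (P s))" using f x(3) by (auto simp: fam_def)
      then obtain s where s: "s \<in> S" "y \<in> set (P s)" by auto
      then obtain A B where AB: "P s = A @ y # B" by (metis split_list)
      show False
      proof (cases "s = m")
        case True
        have B: "B \<noteq> []" using AB r(2) x(2) E_irrefl True by auto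
        have "rot S X P0 m0 (P(m := A @ y # rev B)) m"
          using r x AB True B by (intro rot.own) auto
        then have "hd B \<in> T"
          unfolding T using B by (auto simp: last_rev intro!: exI[of _ "P(m := A @ y # rev B)"] exI[of _ m])
        moreover have "unbroken S P y (hd B)"
          unfolding unbroken_def using AB B s by (intro bexI[of _ s]) (auto simp: consec_append consec_Cons)
        ultimately show False using eq nz by blast
      next
        case False
        have A: "A \<noteq> []" using fam_other(2)[OF f m s(1) False AB x(3)] r x by simp
        have "rot S X P0 m0 (P(m := P m @ y # B, s := A)) s"
          using r x AB False s by (intro rot.other) auto
        then have "last A \<in> T"
          unfolding T by (auto intro!: exI[of _ "P(m := P m @ y # B, s := A)"] exI[of _ s])
        moreover have "unbroken S P y (last A)"
          unfolding unbroken_def using AB A s by (intro bexI[of _ s]) (auto simp: consec_append)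
        ultimately show False using eq nz by blast
      qed
    qed
  qed
  have "card (nb T \<inter> X) \<le> card (T \<union> L \<union> R)"
    by (rule card_mono[OF _ sub]) (use finT L R in auto)
  also have "\<dots> \<le> 3 * card T"
    using card_Un_le[of "T \<union> L" R] card_Un_le[of T L] L R by linarith
  finally have c: "card (nb T \<inter> X) \<le> 3 * card T" .
  have "last (P0 m0) \<in> T" unfolding T using rot.start by blast
  moreover have "\<exists>P m g. fam S P X \<and> m \<in> S \<and> last (P m) = t \<and>
       bij_betw g (S - {m}) (S - {m0}) \<and> (\<forall>s\<in>S-{m}. last (P s) = last (P0 (g s)))" if "t \<in> T" for t
    using that rot_invariant[OF _ f0 m0] unfolding T by blast
  ultimately show ?thesis using that TX c by blast
qed

end

section \<open>Linkers\<close>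

locale joined_graph = fin_graph +
  fixes \<mu> :: nat
  assumes \<mu>_pos: "\<mu> \<ge> 1"
    and joined: "\<lbrakk>A \<subseteq> V; B \<subseteq> V; \<mu> \<le> card A; \<mu> \<le> card B\<rbrakk> \<Longrightarrow> \<exists>a\<in>A. \<exists>b\<in>B. E a b"
begin

text \<open>Factor 5 contradicts the bound \<open>3 * card T\<close> of \<open>rotation\<close> even
  when one more vertex is lost, as in \<open>almost_spanning_path\<close>. It is also the capacity
  of a fresh vertex in \<open>FP\<close>, so that what remains of the room expands on
  itself.\<close>

definition expands_on :: "'a set \<Rightarrow> 'a set \<Rightarrow> bool" where
  "expands_on A X \<longleftrightarrow> (\<forall>U\<subseteq>A. card U \<le> 2 * \<mu> \<longrightarrow> 5 * card U \<le> card (nb U \<inter> X))"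

lemma famD:
  assumes f: "fam S P X" and s: "s \<in> S"
  shows "is_path (P s)" "hd (P s) = s" "P s = s # tl (P s)" "set (tl (P s)) = set (P s) \<inter> X"
proof -
  show p: "is_path (P s)" and h: "hd (P s) = s" using f s by (auto simp: fam_def)
  then show 1: "P s = s # tl (P s)" by (metis is_path_def list.collapse)
  have "x \<in> X" if x: "x \<in> set (P s)" "x \<noteq> s" for x
  proof (rule ccontr)
    assume "x \<notin> X"
    moreover have "x \<in> S \<union> X" using f s x(1) by (auto simp: fam_def)
    ultimately have xS: "x \<in> S" by simp
    then have "is_path (P x)" "hd (P x) = x" using f by (auto simp: fam_def)
    then have "x \<in> set (P x)" by (metis hd_in_set is_path_def)
    moreover have "set (P s) \<inter> set (P x) = {}" using f s xS x(2) unfolding fam_def by blast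
    ultimately show False using x(1) by blast
  qed
  moreover have "s \<notin> X" using f s by (auto simp: fam_def)
  moreover have "s \<notin> set (tl (P s))" using p 1 by (metis distinct.simps(2) is_path_def)
  moreover have "set (P s) = insert s (set (tl (P s)))" using 1 by (metis list.simps(15))
  ultimately show "set (tl (P s)) = set (P s) \<inter> X" by auto
qed

lemma fam_disjoint:
  "fam S P X \<Longrightarrow> s \<in> S \<Longrightarrow> t \<in> S \<Longrightarrow> s \<noteq> t \<Longrightarrow> set (P s) \<inter> set (P t) = {}"
  by (simp add: fam_def)

text \<open>A set of free ends of size at most \<open>2 * \<mu>\<close> would expand by 5 into
  \<open>X\<close>, against the bound of \<open>rotation\<close>.\<close>

lemma large_rotation:
  assumes f0: "fam S P0 X" and m0: "m0 \<in> S" and A: "S \<union> X \<subseteq> A" "A \<subseteq> V" and ex: "expands_on A X"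
  obtains T where "\<mu> \<le> card T" "T \<subseteq> S \<union> X"
    "\<And>t. t \<in> T \<Longrightarrow> \<exists>P m g. fam S P X \<and> m \<in> S \<and> last (P m) = t \<and>
       bij_betw g (S - {m}) (S - {m0}) \<and> (\<forall>s\<in>S-{m}. last (P s) = last (P0 (g s)))"
proof -
  obtain T where T: "last (P0 m0) \<in> T" "T \<subseteq> S \<union> X" "card (nb T \<inter> X) \<le> 3 * card T"
    "\<And>t. t \<in> T \<Longrightarrow> \<exists>P m g. fam S P X \<and> m \<in> S \<and> last (P m) = t \<and>
       bij_betw g (S - {m}) (S - {m0}) \<and> (\<forall>s\<in>S-{m}. last (P s) = last (P0 (g s)))"
    using rotation[OF f0 m0] by blast
  have "finite T" using T(2) A finite_V by (meson finite_subset)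
  then have "card T > 0" using T(1) by (auto simp: card_gt_0_iff)
  moreover have "5 * card T \<le> card (nb T \<inter> X)" if "card T \<le> 2 * \<mu>"
    using ex T(2) A that unfolding expands_on_def by blast
  ultimately have "\<mu> \<le> card T" using T(3) by linarith
  then show ?thesis using that T by blast
qed

text \<open>On a longest path no end reachable by rotations has a neighbour in \<open>X\<close> off
  the path, since the rotated path could be extended. Expansion then makes the set of these ends
  larger than \<open>\<mu>\<close>, and \<open>\<mu>\<close> missed vertices would receive an edge
  from it.\<close>

lemma almost_spanning_path:
  assumes X: "X \<subseteq> V" "X \<noteq> {}" and ex: "expands_on X X"
  obtains xs where "is_path xs" "set xs \<subseteq> X" "card (X - set xs) < \<mu>"
proof -
  have finX: "finite X" using X finite_V finite_subset by blast
  define L where "L = (\<lambda>k. \<exists>xs. is_path xs \<and> set xs \<subseteq> X \<and> length xs = k)"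
  obtain x0 where "x0 \<in> X" using X by blast
  then have L1: "L 1" unfolding L_def by (intro exI[of _ "[x0]"]) auto
  have Lb: "k \<le> card X" if k: "L k" for k
  proof -
    obtain xs where xs: "is_path xs" "set xs \<subseteq> X" "length xs = k" using k by (auto simp: L_def)
    then have "k = card (set xs)" by (simp add: is_path_def distinct_card)
    then show ?thesis using xs(2) finX by (simp add: card_mono)
  qed
  obtain k where k: "L k" "\<And>j. L j \<Longrightarrow> j \<le> k"
    using GreatestI_nat[of L, OF L1 Lb] Greatest_le_nat[of L, OF _ Lb] by blast
  then obtain xs where xs: "is_path xs" "set xs \<subseteq> X" "length xs = k" by (auto simp: L_def)
  define a where "a = hd xs"
  define X' where "X' = set xs - {a}"
  have axs: "a \<in> set xs" using xs(1) by (simp add: a_def is_path_def)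
  have f: "fam {a} (\<lambda>_. xs) X'" using xs(1) axs by (auto simp: fam_def X'_def a_def)
  obtain T where T: "last xs \<in> T" "T \<subseteq> {a} \<union> X'" "card (nb T \<inter> X') \<le> 3 * card T"
    "\<And>t. t \<in> T \<Longrightarrow> \<exists>P m g. fam {a} P X' \<and> m \<in> {a} \<and> last (P m) = t \<and>
       bij_betw g ({a} - {m}) ({a} - {a}) \<and> (\<forall>s\<in>{a}-{m}. last (P s) = last xs)"
    using rotation[OF f, of a] by (metis insertI1)
  have TX: "T \<subseteq> X" using T(2) axs xs(2) by (auto simp: X'_def)
  have finT: "finite T" using TX finX finite_subset by blast
  have sub: "nb T \<inter> X \<subseteq> set xs"
  proof
    fix y assume "y \<in> nb T \<inter> X"
    then obtain t where t: "t \<in> T" "E t y" "y \<in> X" by (auto simp: nb_def)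
    obtain P where P: "fam {a} P X'" "last (P a) = t" using T(4)[OF t(1)] by auto
    have s: "set (P a) = set xs" "is_path (P a)" using P(1) axs by (auto simp: fam_def X'_def)
    show "y \<in> set xs"
    proof (rule ccontr)
      assume y: "y \<notin> set xs"
      have "is_path (P a @ [y])" using s y t(2) P(2) by (subst is_path_append) (auto simp: is_path_def)
      moreover have "length (P a) = k"
        using s xs(1,3) by (metis distinct_card is_path_def)
      ultimately have "L (k + 1)" unfolding L_def using s xs(2) t(3)
        by (intro exI[of _ "P a @ [y]"]) auto
      then show False using k(2) by fastforce
    qed
  qed
  then have "nb T \<inter> X \<subseteq> insert a (nb T \<inter> X')" by (auto simp: X'_def)
  then have "card (nb T \<inter> X) \<le> card (insert a (nb T \<inter> X'))"
    by (rule card_mono[rotated]) (use finite_nb in auto)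
  also have "\<dots> \<le> card (nb T \<inter> X') + 1" using finite_nb by (simp add: card_insert_if)
  finally have c: "card (nb T \<inter> X) \<le> 3 * card T + 1" using T(3) by linarith
  have "card T > 0" using T(1) finT by (auto simp: card_gt_0_iff)
  moreover have "5 * card T \<le> card (nb T \<inter> X)" if "card T \<le> 2 * \<mu>"
    using ex TX that unfolding expands_on_def by blast
  ultimately have big: "\<mu> \<le> card T" using c by linarith
  have "card (X - set xs) < \<mu>"
  proof (rule ccontr)
    assume "\<not> ?thesis"
    then obtain t y where "t \<in> T" "y \<in> X - set xs" "E t y"
      using joined[of T "X - set xs"] big TX X by force
    then show False using sub by (auto simp: nb_def)
  qed
  then show ?thesis using that xs by blast
qed

text \<open>\<open>P s\<close> followed by the reversal of \<open>R (h s)\<close> leads from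
  \<open>s\<close> to \<open>h s\<close>. Keeping the halves apart lets each system be rotated
  within its own part, \<open>X\<close> or \<open>Z\<close>, without disturbing the other.\<close>

definition linked ::
    "'a set \<Rightarrow> 'a set \<Rightarrow> ('a \<Rightarrow> 'a list) \<Rightarrow> ('a \<Rightarrow> 'a list) \<Rightarrow> ('a \<Rightarrow> 'a) \<Rightarrow> 'a set \<Rightarrow> 'a set \<Rightarrow> bool" where
  "linked S T P R h X Z \<longleftrightarrow> fam S P X \<and> fam T R Z \<and> bij_betw h S T \<and>
     (\<forall>s\<in>S. E (last (P s)) (last (R (h s))))"

lemma fam_insert_stub:
  assumes "fam S P X" "v \<notin> S \<union> X"
  shows "fam (insert v S) (P(v := [v])) X"
proof -
  have *: "set (P s) \<subseteq> S \<union> X" if "s \<in> S" for s using assms(1) that by (auto simp: fam_def)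
  have v: "v \<notin> set (P s)" if "s \<in> S" for s using *[OF that] assms(2) by blast
  have "(\<Union>s\<in>S. set ((P(v := [v])) s)) = (\<Union>s\<in>S. set (P s))"
    using assms(2) by (intro SUP_cong) auto
  then have "(\<Union>s\<in>insert v S. set ((P(v := [v])) s)) = insert v (\<Union>s\<in>S. set (P s))"
    by simp
  then show ?thesis using assms v unfolding fam_def by auto
qed

text \<open>The new stubs enter as one-vertex paths, whose ends are the only unmatched ones.
  Rotation gives each of the two free ends at least \<open>\<mu>\<close> positions, so some pair of
  positions is adjacent; the other ends have only changed owners, and the old matching is
  transported along \<open>g\<close> and \<open>k\<close>.\<close>

lemma linked_step:
  assumes l: "linked S T P R h X Z" and v: "v \<notin> S \<union> X" "v \<in> V" and u: "u \<notin> T \<union> Z" "u \<in> V"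
    and sub: "S \<union> X \<subseteq> V" "T \<union> Z \<subseteq> V" and exX: "expands_on V X" and exZ: "expands_on V Z"
  shows "\<exists>P R h. linked (insert v S) (insert u T) P R h X Z"
proof -
  have fP: "fam S P X" and fR: "fam T R Z" and h: "bij_betw h S T"
    and hE: "\<And>s. s \<in> S \<Longrightarrow> E (last (P s)) (last (R (h s)))" using l by (auto simp: linked_def)
  let ?P0 = "P(v := [v])" and ?R0 = "R(u := [u])"
  obtain A where A: "\<mu> \<le> card A" "A \<subseteq> insert v S \<union> X"
    "\<And>t. t \<in> A \<Longrightarrow> \<exists>P m g. fam (insert v S) P X \<and> m \<in> insert v S \<and> last (P m) = t \<and>
       bij_betw g (insert v S - {m}) (insert v S - {v}) \<and> (\<forall>s\<in>insert v S-{m}. last (P s) = last (?P0 (g s)))"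
    using large_rotation[OF fam_insert_stub[OF fP v(1)] _ _ order_refl exX, of v] v sub by auto
  obtain B where B: "\<mu> \<le> card B" "B \<subseteq> insert u T \<union> Z"
    "\<And>t. t \<in> B \<Longrightarrow> \<exists>P m g. fam (insert u T) P Z \<and> m \<in> insert u T \<and> last (P m) = t \<and>
       bij_betw g (insert u T - {m}) (insert u T - {u}) \<and> (\<forall>s\<in>insert u T-{m}. last (P s) = last (?R0 (g s)))"
    using large_rotation[OF fam_insert_stub[OF fR u(1)] _ _ order_refl exZ, of u] u sub by auto
  have "A \<subseteq> V" "B \<subseteq> V" using A B v u sub by auto
  then obtain a b where ab: "a \<in> A" "b \<in> B" "E a b" using joined A(1) B(1) by metis
  obtain P' m g where P': "fam (insert v S) P' X" "m \<in> insert v S" "last (P' m) = a"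
      "bij_betw g (insert v S - {m}) (insert v S - {v})"
      "\<forall>s\<in>insert v S-{m}. last (P' s) = last (?P0 (g s))"
    using A(3)[OF ab(1)] by metis
  obtain R' m' g' where R': "fam (insert u T) R' Z" "m' \<in> insert u T" "last (R' m') = b"
      "bij_betw g' (insert u T - {m'}) (insert u T - {u})"
      "\<forall>s\<in>insert u T-{m'}. last (R' s) = last (?R0 (g' s))"
    using B(3)[OF ab(2)] by metis
  have S: "insert v S - {v} = S" "insert u T - {u} = T" using v u by auto
  define k where "k = inv_into (insert u T - {m'}) g'"
  have k: "bij_betw k T (insert u T - {m'})" unfolding k_def using R'(4) bij_betw_inv_into S by metis
  have gk: "g' (k t) = t" if "t \<in> T" for t
    unfolding k_def using R'(4) S that by (metis bij_betw_inv_into_right)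
  define h' where "h' = (\<lambda>s. if s = m then m' else k (h (g s)))"
  have "bij_betw (k \<circ> h \<circ> g) (insert v S - {m}) (insert u T - {m'})"
    using P'(4) h k unfolding S by (intro bij_betw_trans)
  then have "bij_betw h' (insert v S - {m}) (insert u T - {m'})"
    by (subst bij_betw_cong[of _ _ "k \<circ> h \<circ> g"]) (auto simp: h'_def)
  moreover have "bij_betw h' {m} {m'}" by (auto simp: h'_def bij_betw_def)
  ultimately have "bij_betw h' (insert v S - {m} \<union> {m}) (insert u T - {m'} \<union> {m'})"
    by (rule bij_betw_combine) auto
  moreover have "insert v S - {m} \<union> {m} = insert v S" "insert u T - {m'} \<union> {m'} = insert u T"
    using P'(2) R'(2) by auto
  ultimately have bij: "bij_betw h' (insert v S) (insert u T)" by simp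
  have "E (last (P' s)) (last (R' (h' s)))" if s: "s \<in> insert v S" for s
  proof (cases "s = m")
    case True
    then show ?thesis using P'(3) R'(3) ab by (simp add: h'_def)
  next
    case False
    have gs: "g s \<in> S" using P'(4) s False S by (metis DiffI bij_betwE singletonD)
    have hT: "h (g s) \<in> T" using h gs bij_betwE by blast
    have kk: "k (h (g s)) \<in> insert u T - {m'}" using k hT bij_betwE by blast
    have "last (P' s) = last (P (g s))" using P'(5) s False gs v by auto
    moreover have "last (R' (h' s)) = last (R (h (g s)))"
      using R'(5) kk gk[OF hT] hT u False by (auto simp: h'_def)
    ultimately show ?thesis using hE[OF gs] by simp
  qed
  then show ?thesis using P'(1) R'(1) bij unfolding linked_def by blast
qed

lemma linked_base:
  assumes A: "is_path A" "set A = insert a X" "hd A = a" "a \<notin> X"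
    and B: "is_path B" "set B = insert b Z" "hd B = b" "b \<notin> Z"
    and V: "set A \<subseteq> V" "set B \<subseteq> V" and exX: "expands_on V X" and exZ: "expands_on V Z"
  shows "\<exists>P R h. linked {a} {b} P R h X Z"
proof -
  have fA: "fam {a} (\<lambda>_. A) X" and fB: "fam {b} (\<lambda>_. B) Z" using A B by (auto simp: fam_def)
  obtain T where T: "\<mu> \<le> card T" "T \<subseteq> {a} \<union> X"
    "\<And>t. t \<in> T \<Longrightarrow> \<exists>P m. fam {a} P X \<and> m \<in> {a} \<and> last (P m) = t"
    using large_rotation[OF fA _ _ order_refl exX, of a] A V by auto metis
  obtain T' where T': "\<mu> \<le> card T'" "T' \<subseteq> {b} \<union> Z"
    "\<And>t. t \<in> T' \<Longrightarrow> \<exists>P m. fam {b} P Z \<and> m \<in> {b} \<and> last (P m) = t"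
    using large_rotation[OF fB _ _ order_refl exZ, of b] B V by auto metis
  have "T \<subseteq> V" "T' \<subseteq> V" using T T' A B V by auto
  then obtain s t where st: "s \<in> T" "t \<in> T'" "E s t" using joined T(1) T'(1) by metis
  obtain P R where "fam {a} P X" "last (P a) = s" "fam {b} R Z" "last (R b) = t"
    using T(3)[OF st(1)] T'(3)[OF st(2)] by auto
  then show ?thesis using st(3) unfolding linked_def
    by (intro exI[of _ P] exI[of _ R] exI[of _ "\<lambda>_. b"]) (auto simp: bij_betw_def)
qed

text \<open>All vertices of \<open>Q\<close> can be used up by disjoint paths leading from \<open>S\<close> to \<open>T\<close>, whatever sets
  \<open>S\<close> and \<open>T\<close> containing the stubs are prescribed later on; only the bijection is not under control.\<close>

definition linker :: "'a set \<Rightarrow> 'a \<Rightarrow> 'a \<Rightarrow> bool" where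
  "linker Q a b \<longleftrightarrow> (\<forall>S T. S \<subseteq> V \<longrightarrow> T \<subseteq> V \<longrightarrow> a \<in> S \<longrightarrow> b \<in> T \<longrightarrow> card S = card T \<longrightarrow>
     S \<inter> Q = {} \<longrightarrow> T \<inter> Q = {} \<longrightarrow>
     (\<exists>h I. bij_betw h S T \<and>
       (\<forall>s\<in>S. distinct (I s) \<and> successively E (s # I s @ [h s])) \<and>
       (\<forall>s\<in>S. \<forall>s'\<in>S. s \<noteq> s' \<longrightarrow> set (I s) \<inter> set (I s') = {}) \<and>
       (\<Union>s\<in>S. set (I s)) = Q))"

text \<open>Stubs are peeled off in pairs, but \<open>a\<close> and \<open>b\<close> are kept for
  last: they start the two given paths from which everything is rotated.\<close>

lemma linked_all:
  assumes l: "linked {a} {b} P R h X Z" and XZ: "X \<subseteq> V" "Z \<subseteq> V"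
    and exX: "expands_on V X" and exZ: "expands_on V Z"
    and S: "finite S" "card S = n" "S \<subseteq> V" "a \<in> S" "S \<inter> X = {}"
    and T: "finite T" "card T = n" "T \<subseteq> V" "b \<in> T" "T \<inter> Z = {}"
  shows "\<exists>P R h. linked S T P R h X Z"
  using S T
proof (induction n arbitrary: S T)
  case 0
  then show ?case by auto
next
  case (Suc n)
  show ?case
  proof (cases "n = 0")
    case True
    then have "S = {a}" "T = {b}" using Suc.prems by (auto simp: card_Suc_eq)
    then show ?thesis using l by blast
  next
    case False
    have "card (S - {a}) = n" "card (T - {b}) = n" using Suc.prems by auto
    then have "S - {a} \<noteq> {}" "T - {b} \<noteq> {}" using False by (metis card.empty)+
    then obtain v u where vu: "v \<in> S" "v \<noteq> a" "u \<in> T" "u \<noteq> b" by blast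
    have "card (S - {v}) = n" "card (T - {u}) = n" using Suc.prems vu by auto
    moreover have "S - {v} \<subseteq> V" "T - {u} \<subseteq> V" "(S - {v}) \<inter> X = {}" "(T - {u}) \<inter> Z = {}"
      "a \<in> S - {v}" "b \<in> T - {u}" using Suc.prems vu by blast+
    ultimately obtain P R h where lk: "linked (S - {v}) (T - {u}) P R h X Z"
      using Suc.IH[of "S - {v}" "T - {u}"] Suc.prems(1,6) by (meson finite_Diff)
    have "v \<notin> (S - {v}) \<union> X" "v \<in> V" "u \<notin> (T - {u}) \<union> Z" "u \<in> V"
      "(S - {v}) \<union> X \<subseteq> V" "(T - {u}) \<union> Z \<subseteq> V" using Suc.prems vu XZ by blast+
    then have "\<exists>P R h. linked (insert v (S - {v})) (insert u (T - {u})) P R h X Z"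
      by (rule linked_step[OF lk _ _ _ _ _ _ exX exZ])
    then show ?thesis using vu by (simp add: insert_absorb)
  qed
qed

theorem linker_of_paths:
  assumes A: "is_path A" "set A = insert a X" "hd A = a" "a \<notin> X"
    and B: "is_path B" "set B = insert b Z" "hd B = b" "b \<notin> Z"
    and V: "set A \<subseteq> V" "set B \<subseteq> V" and XZ: "X \<inter> Z = {}"
    and exX: "expands_on V X" and exZ: "expands_on V Z"
  shows "linker (X \<union> Z) a b"
  unfolding linker_def
proof (intro allI impI)
  fix S T assume S: "S \<subseteq> V" "a \<in> S" "S \<inter> (X \<union> Z) = {}" and T: "T \<subseteq> V" "b \<in> T" "T \<inter> (X \<union> Z) = {}"
    and c: "card S = card T"
  have fin: "finite S" "finite T" using S T finite_V by (auto intro: finite_subset)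
  obtain P0 R0 h0 where "linked {a} {b} P0 R0 h0 X Z"
    using linked_base[OF A B V exX exZ] by blast
  then obtain P R h where l: "linked S T P R h X Z"
    using linked_all[of a b P0 R0 h0 X Z S "card S" T] A(2) B(2) V exX exZ S T c fin
    by (metis (no_types, lifting) Int_Un_distrib Un_empty insert_subset)
  have fP: "fam S P X" and fR: "fam T R Z" using l by (auto simp: linked_def)
  note P = famD[OF fP] and R = famD[OF fR]
  have h: "bij_betw h S T" and hE: "\<And>s. s \<in> S \<Longrightarrow> E (last (P s)) (last (R (h s)))"
    using l by (auto simp: linked_def)
  have hT: "h s \<in> T" if "s \<in> S" for s using h that bij_betwE by blast
  \<comment> \<open>Both stubs are dropped, since \<open>linker\<close> speaks of inner vertices
    only.\<close>
  define I where "I = (\<lambda>s. tl (P s) @ rev (tl (R (h s))))"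
  have setI: "set (I s) = (set (P s) \<inter> X) \<union> (set (R (h s)) \<inter> Z)" if "s \<in> S" for s
    using P(4)[OF that] R(4)[OF hT[OF that]] by (simp add: I_def)
  have "distinct (I s) \<and> successively E (s # I s @ [h s])" if s: "s \<in> S" for s
  proof
    have "distinct (tl (P s))" "distinct (tl (R (h s)))"
      using P(1)[OF s] R(1)[OF hT[OF s]] by (auto simp: is_path_def distinct_tl)
    then show "distinct (I s)"
      using P(4)[OF s] R(4)[OF hT[OF s]] XZ by (auto simp: I_def)
    have "s # I s @ [h s] = (s # tl (P s)) @ rev (h s # tl (R (h s)))" by (simp add: I_def)
    also have "\<dots> = P s @ rev (R (h s))" using P(3)[OF s] R(3)[OF hT[OF s]] by simp
    finally have e: "s # I s @ [h s] = P s @ rev (R (h s))" .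
    show "successively E (s # I s @ [h s])" unfolding e
      using P(1)[OF s] R(1)[OF hT[OF s]] hE[OF s] is_path_rev[of "R (h s)"]
      by (auto simp: successively_append_iff is_path_def hd_rev)
  qed
  moreover have "set (I s) \<inter> set (I s') = {}" if s: "s \<in> S" "s' \<in> S" "s \<noteq> s'" for s s'
  proof -
    have "h s \<noteq> h s'" using h s by (auto simp: bij_betw_def inj_on_def)
    then have "set (R (h s)) \<inter> set (R (h s')) = {}" "set (P s) \<inter> set (P s') = {}"
      using fam_disjoint[OF fR hT[OF s(1)] hT[OF s(2)]] fam_disjoint[OF fP s] by auto
    then show ?thesis using setI s XZ by auto
  qed
  moreover have "(\<Union>s\<in>S. set (I s)) = X \<union> Z"
  proof -
    have u: "(\<Union>s\<in>S. set (P s)) = S \<union> X" "(\<Union>s\<in>T. set (R s)) = T \<union> Z"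
      using fP fR by (auto simp: fam_def)
    have "(\<Union>s\<in>S. set (I s)) = (\<Union>s\<in>S. set (P s)) \<inter> X \<union> (\<Union>s\<in>S. set (R (h s))) \<inter> Z"
      using setI by auto
    also have "(\<Union>s\<in>S. set (R (h s))) = (\<Union>s\<in>T. set (R s))"
      using h by (metis (no_types, lifting) SUP_image bij_betw_imp_surj_on comp_apply SUP_cong)
    finally show ?thesis using u S(3) T(3) by auto
  qed
  ultimately show "\<exists>h I. bij_betw h S T \<and>
       (\<forall>s\<in>S. distinct (I s) \<and> successively E (s # I s @ [h s])) \<and>
       (\<forall>s\<in>S. \<forall>s'\<in>S. s \<noteq> s' \<longrightarrow> set (I s) \<inter> set (I s') = {}) \<and>
       (\<Union>s\<in>S. set (I s)) = X \<union> Z" using h by blast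
qed

end

section \<open>Connecting vertices inside a reserved set\<close>

lemma sum_fst_card:
  assumes "finite D" "finite U"
  shows "(\<Sum>x\<in>U. card {p \<in> D. fst p = x}) = card {p \<in> D. fst p \<in> U}"
proof -
  have "{p \<in> D. fst p \<in> U} = (\<Union>x\<in>U. {p \<in> D. fst p = x})" by auto
  also have "card \<dots> = (\<Sum>x\<in>U. card {p \<in> D. fst p = x})"
    by (rule card_UN_disjoint) (use assms in auto)
  finally show ?thesis by simp
qed

locale room_graph = joined_graph +
  fixes Y :: "'a set"
  assumes Y_subset: "Y \<subseteq> V"
    and Y_expand: "\<lbrakk>U \<subseteq> V; card U \<le> 2 * \<mu>\<rbrakk> \<Longrightarrow> 10 * card U \<le> card (nb U \<inter> Y)"
begin

text \<open>The invariant of Friedman and Pippenger in the form of Glebov, Johannsen and Krivelevich: \<open>S\<close> are the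
  used vertices of the room \<open>Y\<close>, and \<open>c x\<close> is the number of further children that \<open>x\<close> may receive.\<close>

definition FP :: "'a set \<Rightarrow> ('a \<Rightarrow> nat) \<Rightarrow> bool" where
  "FP S c \<longleftrightarrow> S \<subseteq> Y \<and> (\<forall>x. c x \<le> 5) \<and> (\<forall>y\<in>Y-S. c y = 5) \<and>
     (\<forall>U\<subseteq>V. card U \<le> 2 * \<mu> \<longrightarrow> sum c U \<le> card (nb U \<inter> Y - S))"

definition outc :: "('a \<times> 'a) set \<Rightarrow> 'a \<Rightarrow> nat" where
  "outc D x = card {p \<in> D. fst p = x}"

lemma finite_subset_V: "U \<subseteq> V \<Longrightarrow> finite U"
  using finite_V finite_subset by blast

lemma finite_Y: "finite Y"
  using Y_subset finite_subset_V by blast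

lemma FP_start: "FP {} (\<lambda>_. 5)"
  unfolding FP_def
proof (intro conjI allI impI ballI)
  fix U assume "U \<subseteq> V" "card U \<le> 2 * \<mu>"
  from Y_expand[OF this] show "sum (\<lambda>_. 5) U \<le> card (nb U \<inter> Y - {})" by simp
qed auto

lemma FP_lower:
  assumes "FP S c" "\<And>x. c' x \<le> c x" "\<And>y. y \<in> Y - S \<Longrightarrow> c' y = 5"
  shows "FP S c'"
proof -
  have "sum c' U \<le> sum c U" for U by (rule sum_mono) (rule assms(2))
  then show ?thesis using assms unfolding FP_def by (meson le_trans)
qed

lemma FP_large:
  assumes FP: "FP S c" and room: "card S + 12 * \<mu> \<le> card Y"
    and U: "U \<subseteq> V" "\<mu> \<le> card U" "card U \<le> 2 * \<mu>"
  shows "sum c U < card (nb U \<inter> Y - S)"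
proof -
  have S: "S \<subseteq> Y" "finite S" using FP finite_Y finite_subset by (auto simp: FP_def)
  have "card (Y - nb U) < \<mu>"
  proof (rule ccontr)
    assume "\<not> ?thesis"
    then obtain x y where "x \<in> U" "y \<in> Y - nb U" "E x y"
      using joined[of U "Y - nb U"] U Y_subset by force
    then show False by (auto simp: nb_def)
  qed
  moreover have "card Y \<le> card (Y - nb U) + card S + card (nb U \<inter> Y - S)"
  proof -
    have "Y \<subseteq> ((Y - nb U) \<union> S) \<union> (nb U \<inter> Y - S)" by auto
    then have "card Y \<le> card (((Y - nb U) \<union> S) \<union> (nb U \<inter> Y - S))"
      by (rule card_mono[rotated]) (use finite_Y S in auto)
    also have "\<dots> \<le> card (Y - nb U) + card S + card (nb U \<inter> Y - S)"
      using card_Un_le[of "(Y - nb U) \<union> S" "nb U \<inter> Y - S"] card_Un_le[of "Y - nb U" S] by linarith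
    finally show ?thesis .
  qed
  moreover have "sum c U \<le> 5 * card U"
    using sum_bounded_above[of U c 5] FP by (simp add: FP_def mult.commute)
  ultimately show ?thesis using room U by linarith
qed

definition crit :: "'a set \<Rightarrow> ('a \<Rightarrow> nat) \<Rightarrow> 'a set \<Rightarrow> bool" where
  "crit S c U \<longleftrightarrow> U \<subseteq> V \<and> card U < \<mu> \<and> sum c U = card (nb U \<inter> Y - S)"

lemma crit_empty: "crit S c {}"
  using \<mu>_pos by (simp add: crit_def nb_def)

text \<open>\<open>card (nb U \<inter> Y - S)\<close> is submodular in \<open>U\<close> and
  \<open>sum c U\<close> is additive, so tightness passes to unions; the union has at most
  \<open>2 * \<mu>\<close> vertices, and \<open>FP_large\<close> brings it below
  \<open>\<mu>\<close> again.\<close>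

lemma crit_Un:
  assumes FP: "FP S c" and room: "card S + 12 * \<mu> \<le> card Y" and A: "crit S c A" and B: "crit S c B"
  shows "crit S c (A \<union> B)"
proof -
  define N where "N = (\<lambda>U. nb U \<inter> Y - S)"
  have fin: "finite A" "finite B" "finite (N U)" for U
    using A B finite_subset_V finite_Y by (auto simp: crit_def N_def)
  have AB: "A \<union> B \<subseteq> V" "card (A \<union> B) \<le> 2 * \<mu>" "card (A \<inter> B) \<le> 2 * \<mu>"
    using A B card_Un_le[of A B] card_mono[of A "A \<inter> B"] fin by (auto simp: crit_def)
  have "card (N (A \<union> B)) + card (N A \<inter> N B) = card (N A) + card (N B)"
  proof -
    have "N (A \<union> B) = N A \<union> N B" by (auto simp: N_def nb_def)
    then show ?thesis using card_Un_Int[of "N A" "N B"] fin by simp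
  qed
  moreover have "card (N (A \<inter> B)) \<le> card (N A \<inter> N B)"
    by (rule card_mono) (use fin in \<open>auto simp: N_def nb_def\<close>)
  moreover have "A \<inter> B \<subseteq> V" using AB(1) by blast
  then have "sum c (A \<inter> B) \<le> card (N (A \<inter> B))"
    using FP AB(3) unfolding FP_def N_def by blast
  moreover have "sum c (A \<union> B) + sum c (A \<inter> B) = sum c A + sum c B"
    using sum.union_inter[of A B c] fin by simp
  moreover have "sum c A = card (N A)" "sum c B = card (N B)" using A B by (auto simp: crit_def N_def)
  moreover have "sum c (A \<union> B) \<le> card (N (A \<union> B))" using FP AB by (auto simp: FP_def N_def)
  ultimately have eq: "sum c (A \<union> B) = card (N (A \<union> B))" by linarith
  have "card (A \<union> B) < \<mu>"
    using FP_large[OF FP room AB(1) _ AB(2)] eq by (force simp: N_def)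
  then show ?thesis using AB eq by (auto simp: crit_def N_def)
qed

text \<open>If no free neighbour \<open>y\<close> of \<open>s\<close> can be taken, each is seen by
  a tight set avoiding \<open>s\<close>; a set containing \<open>s\<close> cannot be violated,
  because its demand drops by one and its supply by at most one. The union of these tight sets is
  tight and sees all free neighbours of \<open>s\<close>, so adding \<open>s\<close> raises the
  demand but not the supply.\<close>

lemma FP_extend:
  assumes FP: "FP S c" and room: "card S + 12 * \<mu> \<le> card Y" and s: "s \<in> V" "s \<notin> Y - S" "1 \<le> c s"
  shows "\<exists>y\<in>Y-S. E s y \<and> FP (insert y S) (c(s := c s - 1))"
proof (rule ccontr)
  assume no: "\<not> ?thesis"
  define W where "W = {y \<in> Y - S. E s y}"
  have W: "finite W" using finite_Y by (simp add: W_def)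
  have ex: "\<exists>U. crit S c U \<and> s \<notin> U \<and> y \<in> nb U" if y: "y \<in> W" for y
  proof -
    have yY: "y \<in> Y - S" "E s y" using y by (auto simp: W_def)
    then have "\<not> FP (insert y S) (c(s := c s - 1))" using no by blast
    moreover have "insert y S \<subseteq> Y" "\<forall>x. (c(s := c s - 1)) x \<le> 5"
      "\<forall>z\<in>Y - insert y S. (c(s := c s - 1)) z = 5" using FP yY s(2) by (auto simp: FP_def intro: le_trans[OF diff_le_self])
    ultimately have "\<not> (\<forall>U\<subseteq>V. card U \<le> 2 * \<mu> \<longrightarrow> sum (c(s := c s - 1)) U \<le> card (nb U \<inter> Y - insert y S))"
      unfolding FP_def by blast
    then obtain U where U: "U \<subseteq> V" "card U \<le> 2 * \<mu>"
      "card (nb U \<inter> Y - insert y S) < sum (c(s := c s - 1)) U" by (meson not_le)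
    have finU: "finite U" using U finite_subset_V by blast
    have le: "sum c U \<le> card (nb U \<inter> Y - S)" using FP U by (simp add: FP_def)
    have eq: "nb U \<inter> Y - insert y S = (nb U \<inter> Y - S) - {y}" by auto
    have sU: "s \<notin> U"
    proof
      assume "s \<in> U"
      then have "sum c U = sum (c(s := c s - 1)) U + 1"
        using finU s(3) by (simp add: sum.remove[of U s])
      moreover have "card (nb U \<inter> Y - insert y S) \<ge> card (nb U \<inter> Y - S) - 1" unfolding eq
        using diff_card_le_card_Diff[of "{y}" "nb U \<inter> Y - S"] by simp
      ultimately show False using U le by linarith
    qed
    then have sum: "sum (c(s := c s - 1)) U = sum c U" by (intro sum.cong) auto
    have yU: "y \<in> nb U"
    proof (rule ccontr)
      assume "y \<notin> nb U"
      then have "nb U \<inter> Y - insert y S = nb U \<inter> Y - S" by auto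
      then show False using U le sum by simp
    qed
    then have "card (nb U \<inter> Y - insert y S) = card (nb U \<inter> Y - S) - 1" "card (nb U \<inter> Y - S) \<ge> 1"
      unfolding eq using yY finite_Y by (auto simp: Suc_le_eq card_gt_0_iff)
    then have c: "sum c U = card (nb U \<inter> Y - S)" using U le sum by linarith
    then have "card U < \<mu>" using FP_large[OF FP room U(1) _ U(2)] by force
    then show ?thesis using c U sU yU unfolding crit_def by blast
  qed
  have "\<exists>U. crit S c U \<and> s \<notin> U \<and> W' \<subseteq> nb U" if "finite W'" "W' \<subseteq> W" for W'
    using that
  proof (induction W')
    case empty
    then show ?case using crit_empty by blast
  next
    case (insert y W')
    then obtain U U' where "crit S c U" "s \<notin> U" "W' \<subseteq> nb U" "crit S c U'" "s \<notin> U'" "y \<in> nb U'"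
      using ex by blast
    then show ?case using crit_Un[OF FP room, of U U'] by (intro exI[of _ "U \<union> U'"]) (auto simp: nb_def)
  qed
  then obtain U where U: "crit S c U" "s \<notin> U" "W \<subseteq> nb U" using W by blast
  have finU: "finite U" using U finite_subset_V by (auto simp: crit_def)
  have "nb (insert s U) \<inter> Y - S = nb U \<inter> Y - S"
    using U(3) by (auto simp: nb_def W_def)
  moreover have "sum c (insert s U) \<le> card (nb (insert s U) \<inter> Y - S)"
  proof -
    have "insert s U \<subseteq> V" using U s by (simp add: crit_def)
    moreover have "card (insert s U) \<le> 2 * \<mu>" using U finU by (simp add: crit_def)
    ultimately show ?thesis using FP unfolding FP_def by blast
  qed
  ultimately show False using U finU s(3) by (simp add: crit_def)
qed

section \<open>Forests in the room that can be given back\<close>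

definition forest :: "'a set \<Rightarrow> ('a \<Rightarrow> nat) \<Rightarrow> ('a \<times> 'a) set \<Rightarrow> bool" where
  "forest S c D \<longleftrightarrow> finite D \<and> (\<forall>(a, b)\<in>D. E a b) \<and> snd ` D \<subseteq> Y - S \<and> inj_on snd D \<and>
     (\<forall>x. outc D x \<le> c x) \<and> FP (S \<union> snd ` D) (\<lambda>x. c x - outc D x)"

lemma outc_insert: "finite D \<Longrightarrow> (s, y) \<notin> D \<Longrightarrow> outc (insert (s, y) D) x = outc D x + (if x = s then 1 else 0)"
proof -
  assume "finite D" "(s, y) \<notin> D"
  moreover have "{p \<in> insert (s, y) D. fst p = x} = (if x = s then insert (s, y) {p \<in> D. fst p = x} else {p \<in> D. fst p = x})"
    by auto
  ultimately show ?thesis by (simp add: outc_def)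
qed

lemma card_snd_forest: "forest S c D \<Longrightarrow> card (snd ` D) = card D"
  by (simp add: forest_def card_image)

lemma forest_add:
  assumes f: "forest S c D" and room: "card S + card D + 12 * \<mu> \<le> card Y"
    and s: "s \<in> V" "s \<notin> Y - S - snd ` D" "outc D s < c s"
  shows "\<exists>y\<in>Y - S - snd ` D. E s y \<and> forest S c (insert (s, y) D)"
proof -
  have r: "card (S \<union> snd ` D) + 12 * \<mu> \<le> card Y"
    using card_Un_le[of S "snd ` D"] card_snd_forest[OF f] room by linarith
  have fp: "FP (S \<union> snd ` D) (\<lambda>x. c x - outc D x)" using f by (simp add: forest_def)
  have "s \<notin> Y - (S \<union> snd ` D)" using s(2) by blast
  then obtain y where y: "y \<in> Y - (S \<union> snd ` D)" "E s y"
    "FP (insert y (S \<union> snd ` D)) ((\<lambda>x. c x - outc D x)(s := c s - outc D s - 1))"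
    using FP_extend[OF fp r s(1)] s(3) by (metis One_nat_def Suc_leI zero_less_diff)
  have nD: "(s, y) \<notin> D" using y(1) by force
  have fin: "finite D" using f by (simp add: forest_def)
  have "(\<lambda>x. c x - outc (insert (s, y) D) x) = (\<lambda>x. c x - outc D x)(s := c s - outc D s - 1)"
    using outc_insert[OF fin nD] by auto
  then have "FP (S \<union> snd ` insert (s, y) D) (\<lambda>x. c x - outc (insert (s, y) D) x)" using y(3) by simp
  moreover have "\<forall>x. outc (insert (s, y) D) x \<le> c x"
    using outc_insert[OF fin nD] f s(3) by (auto simp: forest_def)
  moreover have "inj_on snd (insert (s, y) D)" using f y(1) by (auto simp: forest_def)
  ultimately show ?thesis using f y unfolding forest_def by (intro bexI[of _ y]) auto
qed

lemma forest_star: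
  assumes f: "forest S c D" and L: "finite L" "L \<subseteq> V" "L \<inter> (Y - S - snd ` D) = {}"
    "\<And>l. l \<in> L \<Longrightarrow> outc D l < c l" and room: "card S + card D + card L + 12 * \<mu> \<le> card Y"
  shows "\<exists>h. inj_on h L \<and> h ` L \<subseteq> Y - S - snd ` D \<and> forest S c (D \<union> (\<lambda>l. (l, h l)) ` L) \<and>
     (\<forall>x. outc (D \<union> (\<lambda>l. (l, h l)) ` L) x = outc D x + (if x \<in> L then 1 else 0)) \<and>
     card (D \<union> (\<lambda>l. (l, h l)) ` L) = card D + card L"
  using L room
proof (induction L)
  case empty
  then show ?case using f by (auto intro: exI[of _ id])
next
  case (insert l L)
  obtain h where h: "inj_on h L" "h ` L \<subseteq> Y - S - snd ` D" "forest S c (D \<union> (\<lambda>l. (l, h l)) ` L)"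
    "\<And>x. outc (D \<union> (\<lambda>l. (l, h l)) ` L) x = outc D x + (if x \<in> L then 1 else 0)"
    "card (D \<union> (\<lambda>l. (l, h l)) ` L) = card D + card L"
    using insert by (auto simp: insert.hyps)
  let ?D = "D \<union> (\<lambda>l. (l, h l)) ` L"
  have "\<exists>y\<in>Y - S - snd ` ?D. E l y \<and> forest S c (insert (l, y) ?D)"
  proof (rule forest_add[OF h(3)])
    show "card S + card ?D + 12 * \<mu> \<le> card Y" using insert.prems(4) insert.hyps h(5) by simp
    show "l \<in> V" using insert.prems by simp
    show "l \<notin> Y - S - snd ` ?D" using insert.prems(2) by auto
    show "outc ?D l < c l" using h(4) insert.hyps insert.prems(3) by simp
  qed
  then obtain y where y: "y \<in> Y - S - snd ` ?D" "forest S c (insert (l, y) ?D)" by blast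
  have ny: "(l, y) \<notin> ?D" using y(1) by force
  have fin: "finite ?D" using h(3) by (simp add: forest_def)
  let ?h = "h(l := y)"
  have eq: "D \<union> (\<lambda>l. (l, ?h l)) ` insert l L = insert (l, y) ?D" using insert.hyps by auto
  have yn: "y \<notin> h ` L" using y(1) by force
  show ?case
  proof (intro exI[of _ ?h] conjI)
    show "inj_on ?h (insert l L)" using h(1) yn insert.hyps by (auto simp: inj_on_def)
    show "?h ` insert l L \<subseteq> Y - S - snd ` D" using h(2) y(1) insert.hyps by auto
    show "forest S c (D \<union> (\<lambda>l. (l, ?h l)) ` insert l L)" unfolding eq by (rule y(2))
    show "\<forall>x. outc (D \<union> (\<lambda>l. (l, ?h l)) ` insert l L) x = outc D x + (if x \<in> insert l L then 1 else 0)"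
      unfolding eq using outc_insert[OF fin ny] h(4) insert.hyps by auto
    show "card (D \<union> (\<lambda>l. (l, ?h l)) ` insert l L) = card D + card (insert l L)"
      unfolding eq using ny fin h(5) insert.hyps by simp
  qed
qed

lemma forest_empty: "FP S c \<Longrightarrow> forest S c {}"
  by (simp add: forest_def outc_def)

text \<open>Deleting a forest edge returns one unit of capacity to the parent and frees the child.
  For a set \<open>U\<close> the demand grows by the number of deleted edges leaving
  \<open>U\<close>, and the supply by at least as much, since their children are distinct neighbours
  of \<open>U\<close>. The second condition on \<open>D'\<close> keeps a freed vertex from still
  being a parent, so that it regains its full capacity 5.\<close>

lemma FP_rollback:
  assumes FP: "FP (S \<union> snd ` D) (\<lambda>x. c x - outc D x)" and D: "finite D" "\<forall>(a, b)\<in>D. E a b"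
    "snd ` D \<subseteq> Y - S" "inj_on snd D" "\<And>x. outc D x \<le> c x"
    and D': "D' \<subseteq> D" "fst ` D' \<inter> (Y - S) \<subseteq> snd ` D'"
    and c: "\<And>x. c x \<le> 5" "\<And>y. y \<in> Y - S \<Longrightarrow> c y = 5"
  shows "FP (S \<union> snd ` D') (\<lambda>x. c x - outc D' x)"
  unfolding FP_def
proof (intro conjI allI ballI impI)
  have finD': "finite D'" by (rule finite_subset[OF D'(1) D(1)])
  have le: "outc D' x \<le> outc D x" for x unfolding outc_def using D(1) D' by (auto intro: card_mono)
  have "S \<union> snd ` D \<subseteq> Y" using FP by (simp add: FP_def)
  then show "S \<union> snd ` D' \<subseteq> Y" using image_mono[OF D'(1), of snd] by blast
  show "c x - outc D' x \<le> 5" for x using c(1)[of x] by simp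
  show "c y - outc D' y = 5" if "y \<in> Y - (S \<union> snd ` D')" for y
  proof -
    have "y \<notin> fst ` D'" using D'(2) that by blast
    then have "{p \<in> D'. fst p = y} = {}" by force
    then have "outc D' y = 0" unfolding outc_def by (metis card.empty)
    then show ?thesis using c(2) that by simp
  qed
  fix U assume U: "U \<subseteq> V" "card U \<le> 2 * \<mu>"
  have finU: "finite U" using U finite_subset_V by blast
  define K where "K = {p \<in> D - D'. fst p \<in> U}"
  have "sum (outc D) U = card {p \<in> D. fst p \<in> U}" "sum (outc D') U = card {p \<in> D'. fst p \<in> U}"
    using sum_fst_card finU D(1) finD' by (auto simp: outc_def)
  moreover have "card {p \<in> D. fst p \<in> U} = card {p \<in> D'. fst p \<in> U} + card K"
  proof -
    have eq: "{p \<in> D. fst p \<in> U} = {p \<in> D'. fst p \<in> U} \<union> K" using D' by (auto simp: K_def)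
    show ?thesis unfolding eq
      by (rule card_Un_disjoint) (use D(1) finD' in \<open>auto simp: K_def\<close>)
  qed
  moreover have "sum (\<lambda>x. c x - outc D x) U + sum (outc D) U = sum c U"
    "sum (\<lambda>x. c x - outc D' x) U + sum (outc D') U = sum c U"
    using D(5) le_trans[OF le D(5)] by (simp_all add: sum.distrib[symmetric])
  moreover have "sum (\<lambda>x. c x - outc D x) U \<le> card (nb U \<inter> Y - (S \<union> snd ` D))"
    using FP U by (simp add: FP_def)
  moreover have "card (nb U \<inter> Y - (S \<union> snd ` D)) + card K \<le> card (nb U \<inter> Y - (S \<union> snd ` D'))"
  proof -
    have cK: "card K = card (snd ` K)"
      using D(4) by (metis (no_types, lifting) DiffE K_def card_image inj_on_subset mem_Collect_eq subsetI)
    have s: "snd ` K \<subseteq> nb U \<inter> Y - (S \<union> snd ` D')"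
    proof
      fix y assume "y \<in> snd ` K"
      then obtain x where x: "(x, y) \<in> D" "(x, y) \<notin> D'" "x \<in> U" by (auto simp: K_def)
      have "y \<notin> snd ` D'"
      proof
        assume "y \<in> snd ` D'"
        then obtain x' where "(x', y) \<in> D'" by auto
        then show False using D(4) D' x by (metis inj_onD prod.inject snd_conv subsetD)
      qed
      then show "y \<in> nb U \<inter> Y - (S \<union> snd ` D')" using x D(2,3) by (force simp: nb_def)
    qed
    have "(nb U \<inter> Y - (S \<union> snd ` D)) \<inter> snd ` K = {}" by (auto simp: K_def)
    then have "card (nb U \<inter> Y - (S \<union> snd ` D)) + card (snd ` K) = card ((nb U \<inter> Y - (S \<union> snd ` D)) \<union> snd ` K)"
      using finite_Y D(1) by (intro card_Un_disjoint[symmetric]) (auto simp: K_def)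
    also have "\<dots> \<le> card (nb U \<inter> Y - (S \<union> snd ` D'))"
      by (rule card_mono) (use finite_Y D' s in auto)
    finally show ?thesis using cK by simp
  qed
  ultimately show "sum (\<lambda>x. c x - outc D' x) U \<le> card (nb U \<inter> Y - (S \<union> snd ` D'))" by linarith
qed

lemma FP_le5: "FP S c \<Longrightarrow> c x \<le> 5"
  by (simp add: FP_def)

lemma FP_fresh: "FP S c \<Longrightarrow> y \<in> Y - S \<Longrightarrow> c y = 5"
  by (simp add: FP_def)

lemma forest_fresh:
  assumes "FP S c" "forest S c D" "y \<in> Y - S - snd ` D"
  shows "outc D y = 0" "c y = 5"
proof -
  show "c y = 5" using assms(1,3) FP_fresh by blast
  moreover have "c y - outc D y = 5" using assms(2,3) by (simp add: forest_def FP_def)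
  ultimately show "outc D y = 0" by simp
qed

section \<open>Trees grown from many roots at once\<close>

definition branch :: "('a \<times> 'a) set \<Rightarrow> 'a set \<Rightarrow> 'a \<Rightarrow> 'a \<Rightarrow> 'a list \<Rightarrow> bool" where
  "branch D X l x zs \<longleftrightarrow> x \<in> X \<and> zs \<noteq> [] \<and> last zs = l \<and> distinct zs \<and> set zs \<subseteq> snd ` D \<and>
     set (zip (x # zs) zs) \<subseteq> D"

lemma zip_shift_snoc: "zip (x # zs @ [y]) (zs @ [y]) = zip (x # zs) zs @ [(last (x # zs), y)]"
  by (induction zs arbitrary: x) auto

lemma branch_extend:
  assumes b: "branch D X l x zs" and y: "y \<notin> snd ` D" and hl: "y = h l" "l \<in> L"
  shows "branch (D \<union> (\<lambda>l. (l, h l)) ` L) X y x (zs @ [y])"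
proof -
  have "zip (x # zs @ [y]) (zs @ [y]) = zip (x # zs) zs @ [(l, y)]"
    using b by (simp add: zip_shift_snoc branch_def)
  then have z: "set (zip (x # zs @ [y]) (zs @ [y])) \<subseteq> D \<union> (\<lambda>l. (l, h l)) ` L"
    using b hl by (auto simp: branch_def)
  have "y \<in> snd ` ((\<lambda>l. (l, h l)) ` L)" using hl by (auto simp: image_image)
  then show ?thesis using b y z unfolding branch_def by (auto simp: image_Un)
qed

text \<open>The roots get a single child, as one unit of capacity is all that is assumed of them;
  every later leaf is fresh with capacity 5 and gets two children in two rounds of
  \<open>forest_star\<close>.\<close>

lemma grow:
  assumes FP: "FP S c" and X: "finite X" "X \<subseteq> V" "X \<inter> (Y - S) = {}" "\<forall>x\<in>X. 1 \<le> c x"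
    and room: "card S + card X * 2 ^ (j + 1) + 12 * \<mu> \<le> card Y"
  shows "\<exists>D L. forest S c D \<and> fst ` D \<subseteq> X \<union> snd ` D \<and> L \<subseteq> snd ` D \<and> card L = card X * 2 ^ j \<and>
    (\<forall>l\<in>L. outc D l = 0) \<and> card D \<le> card X * (2 ^ (j + 1) - 1) \<and>
    (\<forall>l\<in>L. \<exists>x zs. length zs = j + 1 \<and> branch D X l x zs)"
  using room
proof (induction j)
  case 0
  have f: "forest S c {}" using forest_empty[OF FP] .
  obtain h where h: "inj_on h X" "h ` X \<subseteq> Y - S" "forest S c ((\<lambda>l. (l, h l)) ` X)"
    "\<And>x. outc ((\<lambda>l. (l, h l)) ` X) x = (if x \<in> X then 1 else 0)"
    "card ((\<lambda>l. (l, h l)) ` X) = card X"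
    using forest_star[OF f X(1,2)] X(3,4) 0 by (auto simp: outc_def Suc_le_eq)
  have "length [h x] = 0 + 1 \<and> branch ((\<lambda>l. (l, h l)) ` X) X (h x) x [h x]" if "x \<in> X" for x
    using that by (auto simp: branch_def image_image)
  moreover have "outc ((\<lambda>l. (l, h l)) ` X) l = 0" if "l \<in> h ` X" for l
  proof -
    have "l \<notin> X" using h(2) X(3) that by blast
    then show ?thesis using h(4) by simp
  qed
  ultimately have br: "\<forall>l\<in>h ` X. outc ((\<lambda>l. (l, h l)) ` X) l = 0 \<and>
      (\<exists>x zs. length zs = 0 + 1 \<and> branch ((\<lambda>l. (l, h l)) ` X) X l x zs)"
    by (metis (no_types, lifting) imageE)
  have "fst ` ((\<lambda>l. (l, h l)) ` X) \<subseteq> X" by auto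
  moreover have "h ` X = snd ` ((\<lambda>l. (l, h l)) ` X)" by (simp add: image_image)
  ultimately show ?case using h(3,5) br card_image[OF h(1)]
    by (intro exI[of _ "(\<lambda>l. (l, h l)) ` X"] exI[of _ "h ` X"]) auto
next
  case (Suc j)
  have "card S + card X * 2 ^ (j + 1) + 12 * \<mu> \<le> card Y" using Suc.prems by simp
  then obtain D L where D: "forest S c D" "fst ` D \<subseteq> X \<union> snd ` D" "L \<subseteq> snd ` D" "card L = card X * 2 ^ j"
    "\<And>l. l \<in> L \<Longrightarrow> outc D l = 0" "card D \<le> card X * (2 ^ (j + 1) - 1)"
    "\<And>l. l \<in> L \<Longrightarrow> \<exists>x zs. length zs = j + 1 \<and> branch D X l x zs"
    using Suc.IH by blast
  have sD: "snd ` D \<subseteq> Y - S" "finite D" using D(1) by (auto simp: forest_def)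
  have L: "finite L" "L \<subseteq> V" "L \<subseteq> Y - S" using D(3) sD Y_subset finite_subset by blast+
  have pw: "card X * (2 ^ (j + 1) - 1) + card X = card X * 2 ^ (j + 1)"
    by (simp add: algebra_simps diff_mult_distrib2)
  have pw2: "card X * (2 ^ (Suc j + 1) - 1) = card X * (2 ^ (j + 1) - 1) + card X * 2 ^ j + card X * 2 ^ j"
    by (simp add: algebra_simps diff_mult_distrib2)
  have r2: "card S + (card D + card L) + card L + 12 * \<mu> \<le> card Y"
  proof -
    have "card D + card L + card L \<le> card X * (2 ^ (Suc j + 1) - 1)" using D(4,6) pw2 by linarith
    also have "\<dots> \<le> card X * 2 ^ (Suc j + 1)" by simp
    finally show ?thesis using Suc.prems by linarith
  qed
  have c5: "c l = 5" if "l \<in> L" for l using FP_fresh[OF FP] L(3) that by blast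
  have "L \<inter> (Y - S - snd ` D) = {}" using D(3) by blast
  then obtain h where h: "inj_on h L" "h ` L \<subseteq> Y - S - snd ` D" "forest S c (D \<union> (\<lambda>l. (l, h l)) ` L)"
    "\<And>x. outc (D \<union> (\<lambda>l. (l, h l)) ` L) x = outc D x + (if x \<in> L then 1 else 0)"
    "card (D \<union> (\<lambda>l. (l, h l)) ` L) = card D + card L"
    using forest_star[OF D(1) L(1,2)] D(5) c5 r2 by auto
  let ?D = "D \<union> (\<lambda>l. (l, h l)) ` L"
  have sD': "snd ` ?D = snd ` D \<union> h ` L" by (auto simp: image_Un image_image)
  have "L \<inter> (Y - S - snd ` ?D) = {}" using D(3) by blast
  then obtain k where k: "inj_on k L" "k ` L \<subseteq> Y - S - snd ` ?D" "forest S c (?D \<union> (\<lambda>l. (l, k l)) ` L)"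
    "\<And>x. outc (?D \<union> (\<lambda>l. (l, k l)) ` L) x = outc ?D x + (if x \<in> L then 1 else 0)"
    "card (?D \<union> (\<lambda>l. (l, k l)) ` L) = card ?D + card L"
    using forest_star[OF h(3) L(1,2)] D(5) c5 r2 h(4,5) by auto
  let ?E = "?D \<union> (\<lambda>l. (l, k l)) ` L"
  let ?L = "h ` L \<union> k ` L"
  have sE: "snd ` ?E = snd ` D \<union> h ` L \<union> k ` L" by (auto simp: image_Un image_image)
  have disj: "h ` L \<inter> k ` L = {}" using k(2) sD' by auto
  have cL: "card ?L = card X * 2 ^ Suc j"
    using card_Un_disjoint[OF _ _ disj] L(1) h(1) k(1) D(4) by (simp add: card_image)
  have Ls: "?L \<subseteq> Y - S - snd ` D" using h(2) k(2) sD' by auto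
  have fresh: "outc D y = 0" if "y \<in> ?L" for y
    using forest_fresh(1)[OF FP D(1), of y] that Ls by auto
  have "?L \<inter> L = {}" using Ls D(3) by auto
  then have out0: "outc ?E l = 0" if "l \<in> ?L" for l using that fresh h(4) k(4) by auto
  have br: "\<exists>x zs. length zs = Suc j + 1 \<and> branch ?E X l x zs" if l: "l \<in> ?L" for l
  proof -
    have mono: "branch A X l x zs \<Longrightarrow> A \<subseteq> B \<Longrightarrow> branch B X l x zs" for A B x zs
      unfolding branch_def by blast
    consider i where "i \<in> L" "l = h i" | i where "i \<in> L" "l = k i" using l by blast
    then show ?thesis
    proof cases
      case 1
      obtain x zs where z: "length zs = j + 1" "branch D X i x zs" using D(7)[OF 1(1)] by blast
      have "l \<notin> snd ` D" using Ls l by auto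
      from mono[OF branch_extend[where h = h, OF z(2) this 1(2,1)], of ?E] z(1)
      show ?thesis by (intro exI[of _ x] exI[of _ "zs @ [l]"]) auto
    next
      case 2
      obtain x zs where z: "length zs = j + 1" "branch D X i x zs" using D(7)[OF 2(1)] by blast
      have "l \<notin> snd ` D" using Ls l by auto
      from mono[OF branch_extend[where h = k, OF z(2) this 2(2,1)], of ?E] z(1)
      show ?thesis by (intro exI[of _ x] exI[of _ "zs @ [l]"]) auto
    qed
  qed
  have f1: "fst ` ?E \<subseteq> X \<union> snd ` ?E"
  proof -
    have "fst ` ?E = fst ` D \<union> L" by (auto simp: image_Un image_image)
    then show ?thesis using D(2,3) unfolding sE by blast
  qed
  have f2: "?L \<subseteq> snd ` ?E" unfolding sE by blast
  have f3: "card ?E \<le> card X * (2 ^ (Suc j + 1) - 1)" using k(5) h(5) D(4,6) pw2 by linarith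
  have f4: "\<forall>l\<in>?L. outc ?E l = 0" using out0 by (rule ballI)
  have f5: "\<forall>l\<in>?L. \<exists>x zs. length zs = Suc j + 1 \<and> branch ?E X l x zs" using br by (rule ballI)
  show ?case
    by (intro exI[of _ ?E] exI[of _ ?L] conjI) (fact k(3) f1 f2 cL f4 f3 f5)+
qed

lemma outc_branch:
  assumes "branch D X l x zs" "x \<notin> set zs"
  shows "outc (set (zip (x # zs) zs)) y \<le> (if y \<in> insert x (set zs) then 1 else 0)"
proof (cases "y \<in> insert x (set zs)")
  case True
  have "{p \<in> set (zip (x # zs) zs). fst p = y} \<subseteq> {(y, z) |z. (y, z) \<in> set (zip (x # zs) zs)}" by auto
  moreover have "z = z'" if "(y, z) \<in> set (zip (x # zs) zs)" "(y, z') \<in> set (zip (x # zs) zs)" for z z'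
  proof -
    have "distinct (x # zs)" using assms by (simp add: branch_def)
    then show ?thesis using consec_succ_unique[of "x # zs" y z z'] that by (simp add: consec_def)
  qed
  ultimately have "card {p \<in> set (zip (x # zs) zs). fst p = y} \<le> 1"
    by (auto intro!: card_le_Suc0_iff_eq[THEN iffD2] simp del: set_zip)
  then show ?thesis using True by (simp add: outc_def)
next
  case False
  then have "{p \<in> set (zip (x # zs) zs). fst p = y} = {}" by (auto dest: set_zip_leftD)
  then show ?thesis using False by (simp add: outc_def)
qed

lemma branch_snd: "snd ` set (zip (x # zs) zs) = set zs"
proof -
  have "map snd (zip (x # zs) zs) = zs" by (rule map_snd_zip_take[THEN trans]) simp
  then show ?thesis by (metis set_map)
qed

lemma branch_fst: "fst ` set (zip (x # zs) zs) \<subseteq> insert x (set zs)"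
  by (auto dest: set_zip_leftD)

lemma branch_successively:
  assumes "set (zip (x # zs) zs) \<subseteq> D" "\<forall>(a, b)\<in>D. E a b"
  shows "successively E (x # zs)"
  using assms by (induction zs arbitrary: x) auto

lemma forest_FP: "forest S c D \<Longrightarrow> FP (S \<union> snd ` D) (\<lambda>x. c x - outc D x)"
  by (simp add: forest_def)

lemma forest_rollback:
  assumes "forest S c D" "D' \<subseteq> D" "fst ` D' \<inter> (Y - S) \<subseteq> snd ` D'"
    "\<And>x. c x \<le> 5" "\<And>y. y \<in> Y - S \<Longrightarrow> c y = 5"
  shows "FP (S \<union> snd ` D') (\<lambda>x. c x - outc D' x)"
  using assms unfolding forest_def by (intro FP_rollback[of S D c D']) auto

text \<open>Forests from \<open>X1\<close> and then from \<open>X2\<close> are grown until each has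
  between \<open>\<mu>\<close> and \<open>2 * \<mu>\<close> leaves, an edge between the two sets of
  leaves is found, and all but the resulting path is given back. Each forest has at most 4
  \<open>\<mu>\<close> new vertices, which with the 12 \<open>\<mu>\<close> of
  \<open>FP_large\<close> makes the 20.\<close>

lemma connect_exact:
  assumes FP: "FP S c" and X1: "X1 \<subseteq> V" "X1 \<inter> (Y - S) = {}" "\<And>x. x \<in> X1 \<Longrightarrow> 1 \<le> c x"
    and X2: "X2 \<subseteq> V" "X2 \<inter> (Y - S) = {}" "\<And>x. x \<in> X2 \<Longrightarrow> 1 \<le> c x"
    and disj: "X1 \<inter> X2 = {}" and q: "card X1 = q" "card X2 = q" "\<mu> \<le> q * 2 ^ j" "q * 2 ^ j \<le> 2 * \<mu>"
    and room: "card S + 20 * \<mu> \<le> card Y"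
  shows "\<exists>x1\<in>X1. \<exists>x2\<in>X2. \<exists>zs. length zs = 2 * (j + 1) \<and> distinct zs \<and> set zs \<subseteq> Y - S \<and>
    successively E (x1 # zs @ [x2]) \<and>
    FP (S \<union> set zs) (\<lambda>x. c x - (if x \<in> insert x1 (insert x2 (set zs)) then 1 else 0))"
proof -
  have fin: "finite X1" "finite X2" using X1 X2 finite_subset_V by auto
  have q2: "q * 2 ^ (j + 1) \<le> 4 * \<mu>" using q(4) by simp
  have r1: "card S + card X1 * 2 ^ (j + 1) + 12 * \<mu> \<le> card Y" unfolding q(1) using q2 room by linarith
  have a1: "\<forall>x\<in>X1. 1 \<le> c x" using X1(3) by blast
  obtain D1 L1 where D1: "forest S c D1" "fst ` D1 \<subseteq> X1 \<union> snd ` D1" "L1 \<subseteq> snd ` D1"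
    "card L1 = card X1 * 2 ^ j" "card D1 \<le> card X1 * (2 ^ (j + 1) - 1)"
    "\<forall>l\<in>L1. \<exists>x zs. length zs = j + 1 \<and> branch D1 X1 l x zs"
    using grow[OF FP fin(1) X1(1,2) a1 r1] by (elim exE conjE) (rule that)
  define S1 where "S1 = S \<union> snd ` D1"
  define c1 where "c1 = (\<lambda>x. c x - outc D1 x)"
  have FP1: "FP S1 c1" using forest_FP[OF D1(1)] by (simp add: S1_def c1_def)
  have D1Y: "snd ` D1 \<subseteq> Y - S" using D1(1) by (simp add: forest_def)
  have "outc D1 x = 0" if "x \<in> X2" for x
  proof -
    have "x \<notin> fst ` D1" using D1(2) D1Y X2(2) disj that by blast
    then have "{p \<in> D1. fst p = x} = {}" by force
    then show ?thesis unfolding outc_def by (metis card.empty)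
  qed
  then have X2': "\<forall>x\<in>X2. 1 \<le> c1 x" using X2(3) by (simp add: c1_def)
  have X2Y: "X2 \<inter> (Y - S1) = {}" using X2(2) by (auto simp: S1_def)
  have cS1: "card S1 \<le> card S + 4 * \<mu>"
  proof -
    have "card (snd ` D1) = card D1" by (rule card_snd_forest[OF D1(1)])
    also have "\<dots> \<le> q * 2 ^ (j + 1)" using D1(5) q(1) by (meson diff_le_self le_trans mult_le_mono2)
    finally show ?thesis using card_Un_le[of S "snd ` D1"] q2 by (simp add: S1_def)
  qed
  then have r2: "card S1 + card X2 * 2 ^ (j + 1) + 12 * \<mu> \<le> card Y" unfolding q(2) using q2 room by linarith
  obtain D2 L2 where D2: "forest S1 c1 D2" "fst ` D2 \<subseteq> X2 \<union> snd ` D2" "L2 \<subseteq> snd ` D2"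
    "card L2 = card X2 * 2 ^ j"
    "\<forall>l\<in>L2. \<exists>x zs. length zs = j + 1 \<and> branch D2 X2 l x zs"
    using grow[OF FP1 fin(2) X2(1) X2Y X2' r2] by (elim exE conjE) (rule that)
  have D2Y: "snd ` D2 \<subseteq> Y - S1" using D2(1) by (simp add: forest_def)
  have "L1 \<subseteq> V" "L2 \<subseteq> V" using D1(3) D2(3) D1Y D2Y Y_subset by blast+
  then obtain l1 l2 where l: "l1 \<in> L1" "l2 \<in> L2" "E l1 l2"
    using joined[of L1 L2] D1(4) D2(4) q by auto
  obtain x1 zs1 where z1: "length zs1 = j + 1" "branch D1 X1 l1 x1 zs1" using D1(6) l(1) by blast
  obtain x2 zs2 where z2: "length zs2 = j + 1" "branch D2 X2 l2 x2 zs2" using D2(5) l(2) by blast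
  have b1: "x1 \<in> X1" "zs1 \<noteq> []" "last zs1 = l1" "distinct zs1" "set zs1 \<subseteq> snd ` D1" "set (zip (x1 # zs1) zs1) \<subseteq> D1"
    using z1(2) by (auto simp: branch_def simp del: set_zip)
  have b2: "x2 \<in> X2" "zs2 \<noteq> []" "last zs2 = l2" "distinct zs2" "set zs2 \<subseteq> snd ` D2" "set (zip (x2 # zs2) zs2) \<subseteq> D2"
    using z2(2) by (auto simp: branch_def simp del: set_zip)
  define P1 where "P1 = set (zip (x1 # zs1) zs1)"
  define P2 where "P2 = set (zip (x2 # zs2) zs2)"
  have P: "snd ` P1 = set zs1" "snd ` P2 = set zs2" "fst ` P1 \<subseteq> insert x1 (set zs1)" "fst ` P2 \<subseteq> insert x2 (set zs2)"
    unfolding P1_def P2_def by (simp_all only: branch_snd branch_fst)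
  have PD: "P1 \<subseteq> D1" "P2 \<subseteq> D2" using b1(6) b2(6) by (auto simp: P1_def P2_def)
  have zY: "set zs1 \<subseteq> Y - S" "set zs2 \<subseteq> Y - S1" "set zs2 \<subseteq> Y - S"
    using subset_trans[OF b1(5) D1Y] subset_trans[OF b2(5) D2Y] by (auto simp: S1_def)
  have xY: "x1 \<notin> Y - S" "x2 \<notin> Y - S" using X1(2) X2(2) b1(1) b2(1) by blast+
  have zz: "set zs1 \<inter> set zs2 = {}" using zY(2) b1(5) by (auto simp: S1_def)
  have n1: "x1 \<notin> set zs1" "x2 \<notin> set zs2" "x1 \<notin> set zs2" "x2 \<notin> set zs1"
    using zY xY by blast+
  \<comment> \<open>The forests are rolled back in reverse order: the second to \<open>P2\<close>
    while the first still stands, then the first to \<open>P1\<close> over the base enlarged by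
    \<open>set zs2\<close>.\<close>
  have FP2: "FP (S1 \<union> set zs2) (\<lambda>x. c1 x - outc P2 x)"
    unfolding P(2)[symmetric]
  proof (rule forest_rollback[OF D2(1) PD(2)])
    show "fst ` P2 \<inter> (Y - S1) \<subseteq> snd ` P2" unfolding P(2) using P(4) X2Y b2(1) by auto
  qed (use FP_le5[OF FP1] FP_fresh[OF FP1] in auto)
  define c2 where "c2 = (\<lambda>x. c x - outc P2 x)"
  have o2: "outc P2 y \<le> (if y \<in> insert x2 (set zs2) then 1 else 0)" for y
    unfolding P2_def by (rule outc_branch[OF z2(2) n1(2)])
  have o1: "outc P1 y \<le> (if y \<in> insert x1 (set zs1) then 1 else 0)" for y
    unfolding P1_def by (rule outc_branch[OF z1(2) n1(1)])
  have FP3: "FP ((S \<union> set zs2) \<union> snd ` P1) (\<lambda>x. c2 x - outc P1 x)"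
  proof (rule FP_rollback[of "S \<union> set zs2" D1 c2 P1])
    have "(S \<union> set zs2) \<union> snd ` D1 = S1 \<union> set zs2" by (auto simp: S1_def)
    moreover have "(\<lambda>x. c2 x - outc D1 x) = (\<lambda>x. c1 x - outc P2 x)" by (auto simp: c2_def c1_def)
    ultimately show "FP ((S \<union> set zs2) \<union> snd ` D1) (\<lambda>x. c2 x - outc D1 x)" using FP2 by simp
    show "snd ` D1 \<subseteq> Y - (S \<union> set zs2)" using D1Y zY(2) by (auto simp: S1_def)
    show "outc D1 x \<le> c2 x" for x
    proof (cases "x \<in> insert x2 (set zs2)")
      case True
      have "x \<notin> X1" using True disj b2(1) zY(3) X1(2) by auto
      moreover have "x \<notin> snd ` D1" using True zY(2) xY(2) D1Y by (auto simp: S1_def)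
      ultimately have "x \<notin> fst ` D1" using D1(2) by blast
      then have "{p \<in> D1. fst p = x} = {}" by force
      then have "outc D1 x = 0" unfolding outc_def by (metis card.empty)
      then show ?thesis by simp
    next
      case False
      then have "outc P2 x = 0" using o2[of x] by simp
      then show ?thesis using D1(1) by (simp add: c2_def forest_def)
    qed
    show "fst ` P1 \<inter> (Y - (S \<union> set zs2)) \<subseteq> snd ` P1" unfolding P(1) using P(3) xY(1) by auto
    show "c2 x \<le> 5" for x using FP_le5[OF FP, of x] by (simp add: c2_def)
    show "c2 y = 5" if "y \<in> Y - (S \<union> set zs2)" for y
    proof -
      have "y \<notin> insert x2 (set zs2)" using that xY(2) by auto
      then have "outc P2 y = 0" using o2[of y] by simp
      then show ?thesis using FP_fresh[OF FP] that by (simp add: c2_def)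
    qed
  qed (use D1(1) PD in \<open>auto simp: forest_def\<close>)
  let ?zs = "zs1 @ rev zs2"
  \<comment> \<open>For a simple invariant one unit is charged all along the path, although the two
    leaves had no child.\<close>
  have "FP (S \<union> set ?zs) (\<lambda>x. c x - (if x \<in> insert x1 (insert x2 (set ?zs)) then 1 else 0))"
  proof (rule FP_lower)
    have "S \<union> set zs2 \<union> snd ` P1 = S \<union> set ?zs" unfolding P(1) by auto
    then show "FP (S \<union> set ?zs) (\<lambda>x. c2 x - outc P1 x)" using FP3 by simp
    show "c x - (if x \<in> insert x1 (insert x2 (set ?zs)) then 1 else 0) \<le> c2 x - outc P1 x" for x
    proof -
      have "insert x1 (set zs1) \<inter> insert x2 (set zs2) = {}"
        using n1 disj b1(1) b2(1) zz by auto
      then have "outc P1 x + outc P2 x \<le> (if x \<in> insert x1 (insert x2 (set ?zs)) then 1 else 0)"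
        using o1[of x] o2[of x] by (auto split: if_splits)
      then show ?thesis unfolding c2_def by linarith
    qed
    show "c y - (if y \<in> insert x1 (insert x2 (set ?zs)) then 1 else 0) = 5" if "y \<in> Y - (S \<union> set ?zs)" for y
      using FP_fresh[OF FP] that xY by auto
  qed
  moreover have "successively E (x1 # ?zs @ [x2])"
  proof -
    have "successively E (x1 # zs1)" "successively E (x2 # zs2)"
      using branch_successively[OF b1(6)] branch_successively[OF b2(6)] D1(1) D2(1) by (auto simp: forest_def)
    then have "is_path (x1 # zs1)" "is_path (x2 # zs2)" using n1 b1(4) b2(4) by (auto simp: is_path_def)
    then have "successively E (x1 # zs1)" "successively E (rev (x2 # zs2))"
      using is_path_rev[of "x2 # zs2"] unfolding is_path_def by blast+
    moreover have "E (last (x1 # zs1)) (hd (rev (x2 # zs2)))"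
      unfolding hd_rev using l(3) b1(2,3) b2(2,3) by simp
    ultimately have "successively E ((x1 # zs1) @ rev (x2 # zs2))"
      unfolding successively_append_iff by blast
    then show ?thesis by simp
  qed
  moreover have "distinct ?zs" "set ?zs \<subseteq> Y - S"
    using b1(4) b2(4) zz zY by auto
  ultimately show ?thesis using b1(1) b2(1) z1(1) z2(1)
    by (intro bexI[of _ x1] bexI[of _ x2] exI[of _ ?zs]) auto
qed

text \<open>Doubling from \<open>q\<close> roots reaches \<open>\<mu>\<close> after about
  log(\<mu>/q) levels, so plenty of candidates give short connections. Cutting down to
  \<open>min q \<mu>\<close> roots and taking the least sufficient depth keeps the number of leaves
  at most \<open>2 * \<mu>\<close>. The length is even because both branches have the same depth;
  the switches depend on this parity.\<close>

theorem connect: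
  assumes FP: "FP S c" and X1: "X1 \<subseteq> V" "X1 \<inter> (Y - S) = {}" "\<And>x. x \<in> X1 \<Longrightarrow> 1 \<le> c x"
    and X2: "X2 \<subseteq> V" "X2 \<inter> (Y - S) = {}" "\<And>x. x \<in> X2 \<Longrightarrow> 1 \<le> c x"
    and disj: "X1 \<inter> X2 = {}" and q: "q \<le> card X1" "q \<le> card X2" "\<mu> \<le> q * 2 ^ J"
    and room: "card S + 20 * \<mu> \<le> card Y"
  obtains x1 x2 zs where "x1 \<in> X1" "x2 \<in> X2" "zs \<noteq> []" "even (length zs)" "length zs \<le> 2 * (J + 1)"
    "distinct zs" "set zs \<subseteq> Y - S" "successively E (x1 # zs @ [x2])"
    "FP (S \<union> set zs) (\<lambda>x. c x - (if x \<in> insert x1 (insert x2 (set zs)) then 1 else 0))"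
proof -
  define p where "p = min q \<mu>"
  have "q > 0" using q(3) \<mu>_pos by (metis le_zero_eq mult_is_0 not_gr_zero not_one_le_zero)
  then have p: "p > 0" "p \<le> \<mu>" "p \<le> q" using \<mu>_pos by (auto simp: p_def)
  have ex: "\<mu> \<le> p * 2 ^ J" using q(3) by (auto simp: p_def min_def)
  define j where "j = (LEAST j. \<mu> \<le> p * 2 ^ j)"
  have j: "\<mu> \<le> p * 2 ^ j" "j \<le> J" unfolding j_def using ex by (auto intro: LeastI Least_le)
  have "p * 2 ^ j \<le> 2 * \<mu>"
  proof (cases j)
    case 0
    then show ?thesis using p by simp
  next
    case (Suc i)
    then have "\<not> \<mu> \<le> p * 2 ^ i" using not_less_Least[of i "\<lambda>j. \<mu> \<le> p * 2 ^ j"] by (simp add: j_def)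
    then show ?thesis using Suc by simp
  qed
  moreover obtain X1' X2' where "X1' \<subseteq> X1" "card X1' = p" "X2' \<subseteq> X2" "card X2' = p"
    using q p by (meson le_trans obtain_subset_with_card_n)
  ultimately have "\<exists>x1\<in>X1'. \<exists>x2\<in>X2'. \<exists>zs. length zs = 2 * (j + 1) \<and> distinct zs \<and> set zs \<subseteq> Y - S \<and>
    successively E (x1 # zs @ [x2]) \<and>
    FP (S \<union> set zs) (\<lambda>x. c x - (if x \<in> insert x1 (insert x2 (set zs)) then 1 else 0))"
    using X1 X2 disj j room by (intro connect_exact[OF FP]) auto
  then obtain x1 x2 zs where "x1 \<in> X1'" "x2 \<in> X2'" "length zs = 2 * (j + 1)" "distinct zs" "set zs \<subseteq> Y - S"
    "successively E (x1 # zs @ [x2])"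
    "FP (S \<union> set zs) (\<lambda>x. c x - (if x \<in> insert x1 (insert x2 (set zs)) then 1 else 0))" by blast
  moreover from this have "zs \<noteq> []" by auto
  ultimately show ?thesis using that[of x1 x2 zs] \<open>X1' \<subseteq> X1\<close> \<open>X2' \<subseteq> X2\<close> j(2) by (auto simp del: insert_iff)
qed

end

section \<open>Switches\<close>

context fin_graph
begin

text \<open>Two ways of covering the same vertices by two paths; replacing the first by the second exchanges the ends.\<close>

definition switch :: "'a list \<Rightarrow> 'a list \<Rightarrow> 'a list \<Rightarrow> 'a list \<Rightarrow> bool" where
  "switch p0 p1 q0 q1 \<longleftrightarrow> is_path p0 \<and> is_path p1 \<and> is_path q0 \<and> is_path q1 \<and>
     hd q0 = hd p0 \<and> last q0 = last p1 \<and> hd q1 = hd p1 \<and> last q1 = last p0 \<and>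
     set p0 \<inter> set p1 = {} \<and> set q0 \<inter> set q1 = {} \<and> set p0 \<union> set p1 = set q0 \<union> set q1 \<and> hd p1 \<noteq> last p1"

text \<open>Only the \<open>p0 g\<close> are chained. The wires \<open>p1 g\<close> keep both ends
  free, for linkers to attach to.\<close>

definition hub :: "nat \<Rightarrow> (nat \<Rightarrow> 'a list) \<Rightarrow> (nat \<Rightarrow> 'a list) \<Rightarrow> (nat \<Rightarrow> 'a list) \<Rightarrow> (nat \<Rightarrow> 'a list) \<Rightarrow> 'a set \<Rightarrow> bool" where
  "hub k p0 p1 q0 q1 S \<longleftrightarrow> (\<forall>g<k. switch (p0 g) (p1 g) (q0 g) (q1 g)) \<and>
     (\<forall>g. Suc g < k \<longrightarrow> E (last (p0 g)) (hd (p0 (Suc g)))) \<and>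
     (\<forall>g<k. \<forall>g'<k. g \<noteq> g' \<longrightarrow> (set (p0 g) \<union> set (p1 g)) \<inter> (set (p0 g') \<union> set (p1 g')) = {}) \<and>
     (\<Union>g<k. set (p0 g) \<union> set (p1 g)) = S"

end

context room_graph
begin

lemma FP_subset_V: "FP S c \<Longrightarrow> S \<subseteq> V"
  using Y_subset by (auto simp: FP_def)

lemma FP_finite: "FP S c \<Longrightarrow> finite S"
  using FP_subset_V finite_subset_V by blast

lemma connect_pair:
  assumes FP: "FP S c" and x: "x \<in> V" "x \<notin> Y - S" "1 \<le> c x" and y: "y \<in> V" "y \<notin> Y - S" "1 \<le> c y"
    and xy: "x \<noteq> y" and J: "\<mu> \<le> 2 ^ J" and room: "card S + 20 * \<mu> \<le> card Y"
  obtains zs where "zs \<noteq> []" "even (length zs)" "length zs \<le> 2 * (J + 1)"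
    "distinct zs" "set zs \<subseteq> Y - S" "successively E (x # zs @ [y])"
    "FP (S \<union> set zs) (\<lambda>u. c u - (if u \<in> insert x (insert y (set zs)) then 1 else 0))"
proof -
  obtain x1 x2 zs where "x1 \<in> {x}" "x2 \<in> {y}" "zs \<noteq> []" "even (length zs)" "length zs \<le> 2 * (J + 1)"
    "distinct zs" "set zs \<subseteq> Y - S" "successively E (x1 # zs @ [x2])"
    "FP (S \<union> set zs) (\<lambda>u. c u - (if u \<in> insert x1 (insert x2 (set zs)) then 1 else 0))"
    by (rule connect[OF FP, of "{x}" "{y}" 1 J]) (use assms in auto)
  then show ?thesis using that by blast
qed

text \<open>The remaining part \<open>ws\<close> of an even cycle through \<open>z\<close> is used up two vertices at a time. Two spanning
  paths are maintained: \<open>A\<close> from \<open>z\<close> to \<open>x\<close> and \<open>B\<close> from \<open>x\<close> to \<open>hd ws\<close>.\<close>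

lemma switch_loop:
  assumes "FP S c" "\<mu> \<le> 2 ^ J" "length ws = 2 * i + 2"
    "is_path A" "hd A = z" "last A = x" "set A = insert z U"
    "is_path B" "hd B = x" "last B = hd ws" "set B = insert (hd ws) U"
    "x \<in> U" "z \<notin> U" "U \<inter> set ws = {}" "z \<notin> set ws" "is_path ws" "E (last ws) z"
    "insert z U \<union> set ws \<subseteq> S" "1 \<le> c x" "\<forall>w\<in>set ws. 1 \<le> c w"
    "card S + i * (2 * (J + 1)) + 20 * \<mu> \<le> card Y"
  shows "\<exists>p0 p1 q0 q1 S' c'. switch p0 p1 q0 q1 \<and> hd p0 = z \<and> FP S' c' \<and> S \<subseteq> S' \<and>
    card S' \<le> card S + i * (2 * (J + 1)) \<and> set p0 \<union> set p1 = insert z U \<union> set ws \<union> (S' - S) \<and>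
    1 \<le> c' (last p0) \<and> 1 \<le> c' (hd p1) \<and> 1 \<le> c' (last p1) \<and>
    (\<forall>y. y \<notin> insert z U \<union> set ws \<union> (S' - S) \<longrightarrow> c' y = c y)"
  using assms
proof (induction i arbitrary: S c ws A B x U)
  case 0
  then obtain w1 w2 where ws: "ws = [w1, w2]" by (auto simp: length_Suc_conv numeral_2_eq_2)
  \<comment> \<open>Two vertices of the cycle are left. \<open>A\<close> together with the edge
    \<open>w1 w2\<close> is one cover; the closing edge from \<open>z\<close> to \<open>w2\<close>
    together with \<open>B\<close> walked backwards from \<open>w1\<close> to \<open>x\<close> is
    the other.\<close>
  have "switch A ws [z, w2] (rev B)"
    using 0 E_sym[of w2 z] unfolding ws switch_def is_path_rev
    by (auto simp: is_path_def hd_rev last_rev)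
  then show ?case using 0 unfolding ws
    by (intro exI[of _ A] exI[of _ "[w1, w2]"] exI[of _ "[z, w2]"] exI[of _ "rev B"] exI[of _ S] exI[of _ c]) auto
next
  case (Suc i)
  obtain w1 w2 w3 rest where ws: "ws = w1 # w2 # w3 # rest"
    using Suc.prems(3) by (auto simp: length_Suc_conv Suc_length_conv)
  note prems = Suc.prems[unfolded ws]
  have SV: "S \<subseteq> V" using FP_subset_V[OF prems(1)] .
  have xw2: "x \<noteq> w2" "x \<in> S" "w2 \<in> S" using prems(12,14,18) by auto
  \<comment> \<open>Joining \<open>x\<close> to \<open>w2\<close> by \<open>zs\<close> extends both
    paths: \<open>A\<close> continues from \<open>x\<close> through \<open>zs\<close> and
    \<open>w2\<close> to \<open>w1\<close>, while \<open>B\<close> reversed runs from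
    \<open>w1\<close> to \<open>x\<close> and on through \<open>zs\<close> and \<open>w2\<close> to
    \<open>w3\<close>. So \<open>w1\<close> takes the part of \<open>x\<close>, and two vertices of
    \<open>ws\<close> are used up.\<close>
  obtain zs where zs: "zs \<noteq> []" "even (length zs)" "length zs \<le> 2 * (J + 1)"
    "distinct zs" "set zs \<subseteq> Y - S" "successively E (x # zs @ [w2])"
    "FP (S \<union> set zs) (\<lambda>u. c u - (if u \<in> insert x (insert w2 (set zs)) then 1 else 0))"
    by (rule connect_pair[OF prems(1), of x w2 J]) (use prems xw2 SV in auto)
  define c1 where "c1 = (\<lambda>u. c u - (if u \<in> insert x (insert w2 (set zs)) then 1 else 0 :: nat))"
  define S1 where "S1 = S \<union> set zs"
  define U1 where "U1 = U \<union> {w1, w2} \<union> set zs"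
  have FP1: "FP S1 c1" using zs(7) by (simp add: c1_def S1_def)
  have zS: "set zs \<inter> S = {}" using zs(5) by auto
  have cS1: "card S1 \<le> card S + 2 * (J + 1)"
    using card_Un_le[of S "set zs"] distinct_card[OF zs(4)] zs(3) by (simp add: S1_def)
  have ez: "successively E zs" "E x (hd zs)" "E (last zs) w2"
    using zs(1,6) by (auto simp: successively_Cons successively_append_iff)
  have pz: "is_path zs" using zs(1,4) ez by (simp add: is_path_def)
  have dw: "w1 \<noteq> w2" "w1 \<noteq> w3" "w2 \<noteq> w3" "E w1 w2" "E w2 w3" "w1 \<notin> set rest" "w2 \<notin> set rest"
    "is_path (w3 # rest)" using prems(16) by (auto simp: is_path_def)
  have AS: "set A \<subseteq> S" "set B \<subseteq> S" "w1 \<in> S" "w2 \<in> S" "w3 \<in> S" using prems(7,11,18) by auto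
  have dA: "w1 \<notin> set A" "w2 \<notin> set A" "w2 \<notin> set B" "w3 \<notin> set B" using prems(7,11,14,15) dw by auto
  have p21: "is_path [w2, w1]" "is_path [w2, w3]" using dw E_sym by (auto simp: is_path_def)
  have pzw: "is_path (zs @ [w2, w1])" "is_path (zs @ [w2, w3])"
    using pz p21 ez zS AS zs(1) by (subst is_path_append; auto)+
  have pA: "is_path (A @ zs @ [w2, w1])"
    using prems(4,6) pzw ez zs(1) AS zS dA by (subst is_path_append) (auto simp: is_path_def)
  have pB: "is_path (rev B @ zs @ [w2, w3])"
    using prems(8,9) pzw ez zs(1) AS zS dA
    by (subst is_path_append) (auto simp: is_path_rev last_rev, auto simp: is_path_def)
  have neB: "B \<noteq> []" "A \<noteq> []" using prems(4,8) by (auto simp: is_path_def)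
  have IH: "\<exists>p0 p1 q0 q1 S' c'. switch p0 p1 q0 q1 \<and> hd p0 = z \<and> FP S' c' \<and> S1 \<subseteq> S' \<and>
    card S' \<le> card S1 + i * (2 * (J + 1)) \<and> set p0 \<union> set p1 = insert z U1 \<union> set (w3 # rest) \<union> (S' - S1) \<and>
    1 \<le> c' (last p0) \<and> 1 \<le> c' (hd p1) \<and> 1 \<le> c' (last p1) \<and>
    (\<forall>y. y \<notin> insert z U1 \<union> set (w3 # rest) \<union> (S' - S1) \<longrightarrow> c' y = c1 y)"
  proof (rule Suc.IH[OF FP1 prems(2)])
    show "length (w3 # rest) = 2 * i + 2" using prems(3) by simp
    show "is_path (A @ zs @ [w2, w1])" by (rule pA)
    show "hd (A @ zs @ [w2, w1]) = z" using prems(5) neB by simp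
    show "last (A @ zs @ [w2, w1]) = w1" by simp
    show "set (A @ zs @ [w2, w1]) = insert z U1" using prems(7) by (auto simp: U1_def)
    show "is_path (rev B @ zs @ [w2, w3])" by (rule pB)
    show "hd (rev B @ zs @ [w2, w3]) = w1" using prems(10) neB by (simp add: hd_rev)
    show "last (rev B @ zs @ [w2, w3]) = hd (w3 # rest)" by simp
    show "set (rev B @ zs @ [w2, w3]) = insert (hd (w3 # rest)) U1" using prems(11) by (auto simp: U1_def)
    show "w1 \<in> U1" by (simp add: U1_def)
    show "z \<notin> U1" using prems(13,15,18) zS by (auto simp: U1_def)
    show "U1 \<inter> set (w3 # rest) = {}" using prems(14,18) zS dw by (auto simp: U1_def)
    show "z \<notin> set (w3 # rest)" using prems(15) by simp
    show "is_path (w3 # rest)" by (rule dw)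
    show "E (last (w3 # rest)) z" using prems(17) by simp
    show "insert z U1 \<union> set (w3 # rest) \<subseteq> S1" using prems(18) by (auto simp: U1_def S1_def)
    show "1 \<le> c1 w1" using prems(12,14,20) dw AS zS by (auto simp: c1_def)
    show "\<forall>w\<in>set (w3 # rest). 1 \<le> c1 w" using prems(12,14,18,20) dw zS by (auto simp: c1_def)
    show "card S1 + i * (2 * (J + 1)) + 20 * \<mu> \<le> card Y" using prems(21) cS1 by simp
  qed
  then obtain p0 p1 q0 q1 S' c' where *: "switch p0 p1 q0 q1" "hd p0 = z" "FP S' c'" "S1 \<subseteq> S'"
    "card S' \<le> card S1 + i * (2 * (J + 1))" "set p0 \<union> set p1 = insert z U1 \<union> set (w3 # rest) \<union> (S' - S1)"
    "1 \<le> c' (last p0)" "1 \<le> c' (hd p1)" "1 \<le> c' (last p1)"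
    "\<forall>y. y \<notin> insert z U1 \<union> set (w3 # rest) \<union> (S' - S1) \<longrightarrow> c' y = c1 y" by (elim exE conjE) (rule that)
  have eq: "insert z U1 \<union> set (w3 # rest) \<union> (S' - S1) = insert z U \<union> set ws \<union> (S' - S)"
    using *(4) zS unfolding ws U1_def S1_def by auto
  have s1: "S \<subseteq> S'" using *(4) by (auto simp: S1_def)
  have s2: "card S' \<le> card S + Suc i * (2 * (J + 1))" using *(5) cS1 by simp
  have s3: "set p0 \<union> set p1 = insert z U \<union> set ws \<union> (S' - S)" using *(6) eq by simp
  have s4: "\<forall>y. y \<notin> insert z U \<union> set ws \<union> (S' - S) \<longrightarrow> c' y = c y"
  proof (intro allI impI)
    fix y assume y: "y \<notin> insert z U \<union> set ws \<union> (S' - S)"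
    then have "c' y = c1 y" using *(10) eq by blast
    moreover have "y \<notin> insert x (insert w2 (set zs))"
      using y prems(12) *(4) zS by (auto simp: ws S1_def)
    ultimately show "c' y = c y" by (simp add: c1_def)
  qed
  show ?case by (intro exI conjI) (fact *(1) *(2) *(3) s1 s2 s3 *(7) *(8) *(9) s4)+
qed

text \<open>The even cycle is \<open>z\<close>, \<open>y\<close>, \<open>zs\<close>, with
  \<open>z\<close> attached to \<open>h\<close>. At most \<open>J\<close> rounds of
  \<open>switch_loop\<close> add a path of at most \<open>2 * (J + 1)\<close> vertices each, so a
  switch costs a quantity quadratic in \<open>J\<close>; \<open>2 * (J + 2) ^ 2\<close> rounds this
  up.\<close>

lemma gadget:
  assumes FP: "FP S c" and h: "h \<in> V" "h \<notin> Y - S" "1 \<le> c h" and J: "\<mu> \<le> 2 ^ J"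
    and room: "card S + 2 * (J + 2) ^ 2 + 20 * \<mu> \<le> card Y"
  shows "\<exists>p0 p1 q0 q1 S' c'. switch p0 p1 q0 q1 \<and> E h (hd p0) \<and> FP S' c' \<and> S \<subseteq> S' \<and>
    card S' \<le> card S + 2 * (J + 2) ^ 2 \<and> set p0 \<union> set p1 = S' - S \<and>
    1 \<le> c' (last p0) \<and> 1 \<le> c' (hd p1) \<and> 1 \<le> c' (last p1) \<and>
    (\<forall>y. y \<notin> insert h (S' - S) \<longrightarrow> c' y = c y) \<and> c' h = c h - 1"
proof -
  have sq: "2 * (J + 2) ^ 2 = 2 + 2 * (J + 1) + J * (2 * (J + 1)) + (4 + 4 * J)"
    by (simp add: power2_eq_square algebra_simps)
  have r0: "card S + 12 * \<mu> \<le> card Y" using room by linarith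
  obtain z where z: "z \<in> Y - S" "E h z" "FP (insert z S) (c(h := c h - 1))"
    using FP_extend[OF FP r0 h] by blast
  define S1 where "S1 = insert z S"
  define c1 where "c1 = c(h := c h - 1)"
  have FP1: "FP S1 c1" using z by (simp add: S1_def c1_def)
  have finS: "finite S" using FP_finite[OF FP] .
  have zh: "z \<noteq> h" using z(1) h(2) by blast
  have c1z: "c1 z = 5" using FP_fresh[OF FP z(1)] zh by (simp add: c1_def)
  have cS1: "card S1 = card S + 1" using z(1) finS by (simp add: S1_def)
  have zV: "z \<in> V" using z(1) Y_subset by blast
  obtain y where y: "y \<in> Y - S1" "E z y" "FP (insert y S1) (c1(z := c1 z - 1))"
    using FP_extend[OF FP1 _ zV, of] room cS1 sq c1z by (auto simp: S1_def)
  define S2 where "S2 = insert y S1"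
  define c2 where "c2 = c1(z := c1 z - 1)"
  have FP2: "FP S2 c2" using y by (simp add: S2_def c2_def)
  have yz: "y \<noteq> z" "y \<noteq> h" using y(1) h(2) by (auto simp: S1_def)
  have c2: "c2 z = 4" "c2 y = 5" using c1z FP_fresh[OF FP1 y(1)] yz by (auto simp: c2_def)
  have cS2: "card S2 = card S + 2" using y(1) finS cS1 by (simp add: S2_def S1_def)
  have yV: "y \<in> V" using y(1) Y_subset by blast
  have in2: "z \<in> S2" "y \<in> S2" by (auto simp: S2_def S1_def)
  have r2: "card S2 + 20 * \<mu> \<le> card Y" using room cS2 sq by linarith
  obtain zs where zs: "zs \<noteq> []" "even (length zs)" "length zs \<le> 2 * (J + 1)"
    "distinct zs" "set zs \<subseteq> Y - S2" "successively E (y # zs @ [z])"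
    "FP (S2 \<union> set zs) (\<lambda>u. c2 u - (if u \<in> insert y (insert z (set zs)) then 1 else 0))"
    by (rule connect_pair[OF FP2, of y z J]) (use in2 yV zV yz c2 J r2 in auto)
  define S3 where "S3 = S2 \<union> set zs"
  define c3 where "c3 = (\<lambda>u. c2 u - (if u \<in> insert y (insert z (set zs)) then 1 else 0 :: nat))"
  have FP3: "FP S3 c3" using zs(7) by (simp add: S3_def c3_def)
  have zS: "set zs \<inter> S2 = {}" using zs(5) by auto
  have cS3: "card S3 \<le> card S + 2 + 2 * (J + 1)"
    using card_Un_le[of S2 "set zs"] distinct_card[OF zs(4)] zs(3) cS2 by (simp add: S3_def)
  define i where "i = length zs div 2 - 1"
  have "length zs \<ge> 2" using zs(1,2) by (cases zs; cases "tl zs") auto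
  then have len: "length zs = 2 * i + 2" using zs(2) unfolding i_def by (auto elim!: evenE)
  have iJ: "i \<le> J" using len zs(3) by simp
  have ez: "successively E zs" "E y (hd zs)" "E (last zs) z"
    using zs(1,6) by (auto simp: successively_Cons successively_append_iff)
  have hdz: "hd zs \<in> set zs" using zs(1) by simp
  have hzy: "hd zs \<noteq> y" "y \<noteq> hd zs" using hdz zS in2 by blast+
  have iJ2: "i * (2 * (J + 1)) \<le> J * (2 * (J + 1))" using iJ by (rule mult_le_mono1)
  have "\<exists>p0 p1 q0 q1 S' c'. switch p0 p1 q0 q1 \<and> hd p0 = z \<and> FP S' c' \<and> S3 \<subseteq> S' \<and>
    card S' \<le> card S3 + i * (2 * (J + 1)) \<and> set p0 \<union> set p1 = insert z {y} \<union> set zs \<union> (S' - S3) \<and>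
    1 \<le> c' (last p0) \<and> 1 \<le> c' (hd p1) \<and> 1 \<le> c' (last p1) \<and>
    (\<forall>u. u \<notin> insert z {y} \<union> set zs \<union> (S' - S3) \<longrightarrow> c' u = c3 u)"
  proof (rule switch_loop[OF FP3 J len, of "[z, y]" z y "{y}" "[y, hd zs]"])
    show "is_path [z, y]" "is_path [y, hd zs]" "is_path zs"
      using y(2) yz ez hdz zS in2 zs(1,4) hzy by (auto simp: is_path_def)
    show "{y} \<inter> set zs = {}" "z \<notin> set zs" using zS in2 by auto
    show "E (last zs) z" by (rule ez)
    show "insert z {y} \<union> set zs \<subseteq> S3" using in2 by (auto simp: S3_def)
    show "1 \<le> c3 y" using c2 by (simp add: c3_def)
    show "\<forall>w\<in>set zs. 1 \<le> c3 w" using FP_fresh[OF FP2] zs(5) by (auto simp: c3_def)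
    have "card S3 + i * (2 * (J + 1)) \<le> card S + 2 * (J + 2) ^ 2" using cS3 iJ2 sq by linarith
    then show "card S3 + i * (2 * (J + 1)) + 20 * \<mu> \<le> card Y" using room by linarith
  qed (use yz in auto)
  then obtain p0 p1 q0 q1 S' c' where *: "switch p0 p1 q0 q1" "hd p0 = z" "FP S' c'" "S3 \<subseteq> S'"
    "card S' \<le> card S3 + i * (2 * (J + 1))" "set p0 \<union> set p1 = insert z {y} \<union> set zs \<union> (S' - S3)"
    "1 \<le> c' (last p0)" "1 \<le> c' (hd p1)" "1 \<le> c' (last p1)"
    "\<forall>u. u \<notin> insert z {y} \<union> set zs \<union> (S' - S3) \<longrightarrow> c' u = c3 u" by (elim exE conjE) (rule that)
  have S3: "S3 = S \<union> {z, y} \<union> set zs" by (auto simp: S3_def S2_def S1_def)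
  have eq: "insert z {y} \<union> set zs \<union> (S' - S3) = S' - S"
    using *(4) z(1) y(1) zS unfolding S3 by (auto simp: S2_def S1_def)
  have s0: "E h (hd p0)" using *(2) z(2) by simp
  have s1: "S \<subseteq> S'" using *(4) by (auto simp: S3)
  have s2: "card S' \<le> card S + 2 * (J + 2) ^ 2" using *(5) cS3 iJ2 sq by linarith
  have s3: "set p0 \<union> set p1 = S' - S" using *(6) eq by simp
  have s4: "\<forall>u. u \<notin> insert h (S' - S) \<longrightarrow> c' u = c u"
  proof (intro allI impI)
    fix u assume u: "u \<notin> insert h (S' - S)"
    then have "c' u = c3 u" using *(10) eq by blast
    moreover have "u \<noteq> z" "u \<noteq> y" "u \<notin> set zs" using u eq by blast+
    ultimately show "c' u = c u" using u by (simp add: c3_def c2_def c1_def)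
  qed
  have hS: "h \<notin> S' - S" using *(3) h(2) by (auto simp: FP_def)
  have "c' h = c3 h" using *(10) eq hS by blast
  moreover have "h \<notin> set zs" using zs(5) h(2) by (auto simp: S2_def S1_def)
  ultimately have s5: "c' h = c h - 1" using zh yz by (auto simp: c3_def c2_def c1_def)
  show ?thesis by (intro exI conjI) (fact *(1) s0 *(3) s1 s2 s3 *(7) *(8) *(9) s4 s5)+
qed

text \<open>Each switch hangs on the last vertex \<open>h\<close> of the hub so far. The vertex
  \<open>x0\<close> outside the room only stands in as parent of the first switch; it does not join
  the hub but loses a unit, whence 4 in place of 5.\<close>

lemma hub_exists:
  assumes x0: "x0 \<in> V - Y" and J: "\<mu> \<le> 2 ^ J" and room: "k * (2 * (J + 2) ^ 2) + 20 * \<mu> \<le> card Y"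
  shows "\<exists>p0 p1 q0 q1 S c. hub k p0 p1 q0 q1 S \<and> FP S c \<and> card S \<le> k * (2 * (J + 2) ^ 2) \<and>
    (\<forall>g<k. 1 \<le> c (hd (p1 g)) \<and> 1 \<le> c (last (p1 g))) \<and> (\<forall>y\<in>V - Y. 4 \<le> c y)"
proof -
  have "\<exists>p0 p1 q0 q1 S c h. hub k p0 p1 q0 q1 S \<and> FP S c \<and> card S \<le> k * (2 * (J + 2) ^ 2) \<and>
    (\<forall>g<k. 1 \<le> c (hd (p1 g)) \<and> 1 \<le> c (last (p1 g))) \<and>
    (\<forall>y\<in>V - Y. c y = (if k \<noteq> 0 \<and> y = x0 then 4 else 5)) \<and> h \<in> V \<and> h \<notin> Y - S \<and> 1 \<le> c h \<and> h = (if k = 0 then x0 else last (p0 (k - 1)))"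
    using room
  proof (induction k)
    case 0
    show ?case using x0 FP_start
      by (intro exI[of _ "\<lambda>_. []"] exI[of _ "{}"] exI[of _ "\<lambda>_. 5"] exI[of _ x0]) (auto simp: hub_def)
  next
    case (Suc k)
    obtain p0 p1 q0 q1 S c h where IH: "hub k p0 p1 q0 q1 S" "FP S c" "card S \<le> k * (2 * (J + 2) ^ 2)"
      "\<forall>g<k. 1 \<le> c (hd (p1 g)) \<and> 1 \<le> c (last (p1 g))" "\<forall>y\<in>V - Y. c y = (if k \<noteq> 0 \<and> y = x0 then 4 else 5)"
      "h \<in> V" "h \<notin> Y - S" "1 \<le> c h" "h = (if k = 0 then x0 else last (p0 (k - 1)))"
      using Suc by (auto simp: algebra_simps)
    have "card S + 2 * (J + 2) ^ 2 + 20 * \<mu> \<le> card Y" using IH(3) Suc.prems by simp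
    from gadget[OF IH(2,6,7,8) J this] obtain a0 a1 b0 b1 S' c' where
      *: "switch a0 a1 b0 b1" "E h (hd a0)" "FP S' c'" "S \<subseteq> S'" "card S' \<le> card S + 2 * (J + 2) ^ 2"
      "set a0 \<union> set a1 = S' - S" "1 \<le> c' (last a0)" "1 \<le> c' (hd a1)" "1 \<le> c' (last a1)"
      "\<forall>y. y \<notin> insert h (S' - S) \<longrightarrow> c' y = c y" "c' h = c h - 1" by (elim exE conjE) (rule that)
    have ne: "a0 \<noteq> []" "a1 \<noteq> []" using *(1) by (auto simp: switch_def is_path_def)
    have sub: "set (p0 g) \<union> set (p1 g) \<subseteq> S" if "g < k" for g using IH(1) that by (auto simp: hub_def)
    have hub: "hub (Suc k) (p0(k := a0)) (p1(k := a1)) (q0(k := b0)) (q1(k := b1)) S'"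
      unfolding hub_def
    proof (intro conjI allI impI)
      show "switch ((p0(k := a0)) g) ((p1(k := a1)) g) ((q0(k := b0)) g) ((q1(k := b1)) g)" if "g < Suc k" for g
        using that *(1) IH(1) by (cases "g = k") (auto simp: hub_def)
      show "E (last ((p0(k := a0)) g)) (hd ((p0(k := a0)) (Suc g)))" if "Suc g < Suc k" for g
      proof (cases "Suc g = k")
        case True
        then have "h = last (p0 g)" "g \<noteq> k" using IH(9) by auto
        then show ?thesis using *(2) True by simp
      next
        case False
        then show ?thesis using IH(1) that by (auto simp: hub_def)
      qed
      fix g g' assume g: "g < Suc k" "g' < Suc k" "g \<noteq> g'"
      consider "g < k" "g' < k" | "g = k" "g' < k" | "g < k" "g' = k" using g by linarith
      then show "(set ((p0(k := a0)) g) \<union> set ((p1(k := a1)) g)) \<inter> (set ((p0(k := a0)) g') \<union> set ((p1(k := a1)) g')) = {}"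
      proof cases
        case 1
        then show ?thesis using IH(1) g(3) by (simp add: hub_def)
      next
        case 2
        have "(S' - S) \<inter> (set (p0 g') \<union> set (p1 g')) = {}" using sub[OF 2(2)] by blast
        then show ?thesis using 2 *(6) by simp
      next
        case 3
        have "(set (p0 g) \<union> set (p1 g)) \<inter> (S' - S) = {}" using sub[OF 3(1)] by blast
        then show ?thesis using 3 *(6) by simp
      qed
    next
      have "(\<Union>g<k. set ((p0(k := a0)) g) \<union> set ((p1(k := a1)) g)) = S"
        using IH(1) by (simp add: hub_def)
      then show "(\<Union>g<Suc k. set ((p0(k := a0)) g) \<union> set ((p1(k := a1)) g)) = S'"
        using *(4,6) by (simp add: lessThan_Suc) blast
    qed
    have c: "card S' \<le> Suc k * (2 * (J + 2) ^ 2)" using *(5) IH(3) by simp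
    have caps: "\<forall>g<Suc k. 1 \<le> c' (hd ((p1(k := a1)) g)) \<and> 1 \<le> c' (last ((p1(k := a1)) g))"
    proof (intro allI impI)
      fix g assume g: "g < Suc k"
      show "1 \<le> c' (hd ((p1(k := a1)) g)) \<and> 1 \<le> c' (last ((p1(k := a1)) g))"
      proof (cases "g = k")
        case True
        then show ?thesis using *(8,9) by simp
      next
        case False
        then have gk: "g < k" using g by simp
        have sw: "switch (p0 g) (p1 g) (q0 g) (q1 g)" using IH(1) gk by (simp add: hub_def)
        then have ne1: "p1 g \<noteq> []" by (auto simp: switch_def is_path_def)
        have inS: "hd (p1 g) \<in> S" "last (p1 g) \<in> S" using ne1 sub[OF gk] by auto
        have hn: "h \<notin> set (p1 g)"
        proof -
          have k: "k \<noteq> 0" using gk by simp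
          have "is_path (p0 (k - 1))" using IH(1) k by (auto simp: hub_def switch_def)
          then have hk: "h \<in> set (p0 (k - 1))" using IH(9) k by (auto simp: is_path_def)
          show ?thesis
          proof (cases "g = k - 1")
            case True
            then show ?thesis using sw hk by (auto simp: switch_def)
          next
            case False
            then have "(set (p0 g) \<union> set (p1 g)) \<inter> (set (p0 (k - 1)) \<union> set (p1 (k - 1))) = {}"
              using IH(1) gk k by (simp add: hub_def)
            then show ?thesis using hk by blast
          qed
        qed
        have "hd (p1 g) \<noteq> h" "last (p1 g) \<noteq> h" using hn ne1 by auto
        then have "c' (hd (p1 g)) = c (hd (p1 g))" "c' (last (p1 g)) = c (last (p1 g))"
          using *(10) inS by auto
        then show ?thesis using IH(4) gk False by simp
      qed
    qed
    have S'Y: "S' \<subseteq> Y" using *(3) by (simp add: FP_def)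
    have c5: "\<forall>y\<in>V - Y. c' y = (if Suc k \<noteq> 0 \<and> y = x0 then 4 else 5)"
    proof
      fix y assume y: "y \<in> V - Y"
      have eq: "c' y = c y" if "y \<noteq> h" using *(10) y S'Y that by auto
      show "c' y = (if Suc k \<noteq> 0 \<and> y = x0 then 4 else 5)"
      proof (cases "k = 0")
        case True
        then show ?thesis using y IH(5,9) eq *(11) by (cases "y = h") auto
      next
        case False
        then have "is_path (p0 (k - 1))" using IH(1) by (auto simp: hub_def switch_def)
        then have "last (p0 (k - 1)) \<in> set (p0 (k - 1))" by (auto simp: is_path_def)
        then have "h \<in> S" using sub[of "k - 1"] IH(9) False by auto
        then have "y \<noteq> h" using y S'Y *(4) by blast
        then show ?thesis using eq y IH(5) False by simp
      qed
    qed
    have last: "last a0 \<in> V" "last a0 \<notin> Y - S'" "1 \<le> c' (last a0)"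
      using ne(1) *(6,7) S'Y Y_subset by (auto dest!: last_in_set)
    have l0: "last a0 = (if Suc k = 0 then x0 else last ((p0(k := a0)) (Suc k - 1)))" by simp
    show ?case by (intro exI conjI) (fact hub *(3) c caps c5 last l0)+
  qed
  then obtain p0 p1 q0 q1 S c h where *: "hub k p0 p1 q0 q1 S" "FP S c" "card S \<le> k * (2 * (J + 2) ^ 2)"
      "\<forall>g<k. 1 \<le> c (hd (p1 g)) \<and> 1 \<le> c (last (p1 g))"
      "\<forall>y\<in>V - Y. c y = (if k \<noteq> 0 \<and> y = x0 then 4 else 5)" by (elim exE conjE) (rule that)
  have "\<forall>y\<in>V - Y. 4 \<le> c y" using *(5) by simp
  with * show ?thesis by (intro exI conjI)
qed

end

section \<open>Absorbing regions\<close>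

context fin_graph
begin

section \<open>Systems of disjoint paths\<close>

definition paths :: "'a list set \<Rightarrow> bool" where
  "paths P \<longleftrightarrow> finite P \<and> (\<forall>p\<in>P. is_path p) \<and> (\<forall>p\<in>P. \<forall>q\<in>P. p \<noteq> q \<longrightarrow> set p \<inter> set q = {})"

abbreviation verts :: "'a list set \<Rightarrow> 'a set" where
  "verts P \<equiv> \<Union> (set ` P)"

lemma paths_nonempty: "paths P \<Longrightarrow> p \<in> P \<Longrightarrow> p \<noteq> []"
  by (simp add: paths_def is_path_def)

lemma paths_eq: "paths P \<Longrightarrow> p \<in> P \<Longrightarrow> q \<in> P \<Longrightarrow> x \<in> set p \<Longrightarrow> x \<in> set q \<Longrightarrow> p = q"
  unfolding paths_def by blast

lemma paths_subset: "paths P \<Longrightarrow> Q \<subseteq> P \<Longrightarrow> paths Q"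
  unfolding paths_def by (meson finite_subset subsetD)

lemma inj_on_hd_paths: "paths P \<Longrightarrow> inj_on hd P"
  by (rule inj_onI) (metis paths_nonempty paths_eq hd_in_set)

lemma inj_on_last_paths: "paths P \<Longrightarrow> inj_on last P"
  by (rule inj_onI) (metis paths_nonempty paths_eq last_in_set)

lemma paths_insert:
  assumes "paths P" "is_path p" "set p \<inter> verts P = {}"
  shows "paths (insert p P)"
proof -
  have "set p \<inter> set q = {}" "set q \<inter> set p = {}" if "q \<in> P" for q using assms(3) that by blast+
  then show ?thesis using assms(1,2) unfolding paths_def by simp
qed

end

context joined_graph
begin

text \<open>The fewer than \<open>\<mu>\<close> vertices missed by an almost spanning path become
  one-vertex paths.\<close>

lemma cover_by_paths:
  assumes "X \<subseteq> V" "expands_on X X"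
  obtains P where "paths P" "verts P = X" "card P \<le> \<mu>"
proof (cases "X = {}")
  case True
  then show ?thesis using that[of "{}"] by (simp add: paths_def)
next
  case False
  obtain xs where xs: "is_path xs" "set xs \<subseteq> X" "card (X - set xs) < \<mu>"
    using almost_spanning_path[OF assms(1) False assms(2)] by blast
  let ?R = "X - set xs"
  have fin: "finite ?R" using assms(1) finite_V by (meson finite_Diff finite_subset)
  have R: "paths ((\<lambda>x. [x]) ` ?R)" using fin by (auto simp: paths_def is_path_def)
  have "paths (insert xs ((\<lambda>x. [x]) ` ?R))"
    by (rule paths_insert[OF R xs(1)]) auto
  moreover have "verts (insert xs ((\<lambda>x. [x]) ` ?R)) = X" using xs(2) by auto
  moreover have "card (insert xs ((\<lambda>x. [x]) ` ?R)) \<le> \<mu>"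
    using card_insert_le_m1[of "\<mu>" "(\<lambda>x. [x]) ` ?R" xs] card_image_le[OF fin, of "\<lambda>x. [x]"] xs(3) \<mu>_pos
    by linarith
  ultimately show ?thesis by (rule that)
qed

end

context room_graph
begin

text \<open>Half of the paths offer their ends and the other half their starts, so the two paths
  joined are always different. A one-vertex path may be joined on both sides at the same vertex,
  hence the demand for two units there.\<close>

lemma merge_two:
  assumes P: "paths P" "card P \<ge> 2" "verts P \<subseteq> V" "verts P \<inter> (Y - S) = {}" and FP: "FP S c"
    and caps: "\<forall>p\<in>P. 1 \<le> c (hd p) \<and> 1 \<le> c (last p) \<and> (hd p = last p \<longrightarrow> 2 \<le> c (hd p))"
    and J: "\<mu> \<le> (card P div 2) * 2 ^ J" and room: "card S + 20 * \<mu> \<le> card Y"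
  shows "\<exists>P' S' c'. paths P' \<and> card P = Suc (card P') \<and> FP S' c' \<and> S \<subseteq> S' \<and>
    card S' \<le> card S + 2 * (J + 1) \<and> verts P' = verts P \<union> (S' - S) \<and>
    (\<forall>p\<in>P'. 1 \<le> c' (hd p) \<and> 1 \<le> c' (last p) \<and> (hd p = last p \<longrightarrow> 2 \<le> c' (hd p))) \<and>
    (\<forall>u. u \<notin> verts P \<union> (S' - S) \<longrightarrow> c' u = c u)"
proof -
  define q where "q = card P div 2"
  have finP: "finite P" using P(1) by (simp add: paths_def)
  obtain A where A: "A \<subseteq> P" "card A = q"
    using obtain_subset_with_card_n[of q P] by (auto simp: q_def)
  have finA: "finite A" using A(1) finP by (rule finite_subset)
  have "q \<le> card (P - A)" using A finA by (simp add: card_Diff_subset q_def)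
  moreover define B where "B = P - A"
  ultimately have B: "B \<subseteq> P" "q \<le> card B" "A \<inter> B = {}" by auto
  have cA: "q \<le> card (last ` A)"
    using card_image[OF inj_on_subset[OF inj_on_last_paths[OF P(1)] A(1)]] A(2) by simp
  have cB: "q \<le> card (hd ` B)"
    using card_image[OF inj_on_subset[OF inj_on_hd_paths[OF P(1)] B(1)]] B(2) by simp
  have lastP: "last p \<in> set p" "hd p \<in> set p" if "p \<in> P" for p
    using paths_nonempty[OF P(1) that] by auto
  have lA: "last ` A \<subseteq> verts P" using lastP A(1) by blast
  have hB: "hd ` B \<subseteq> verts P" using lastP B(1) by blast
  have d: "last ` A \<inter> hd ` B = {}"
  proof (rule ccontr)
    assume "last ` A \<inter> hd ` B \<noteq> {}"
    then obtain p p' where p: "p \<in> A" "p' \<in> B" "last p = hd p'" by auto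
    then have "p = p'" using paths_eq[OF P(1), of p p' "last p"] A(1) B(1) lastP by (metis subsetD)
    then show False using p B(3) by blast
  qed
  have qJ: "\<mu> \<le> q * 2 ^ J" using J by (simp add: q_def)
  obtain x1 x2 zs where z: "x1 \<in> last ` A" "x2 \<in> hd ` B" "zs \<noteq> []" "even (length zs)"
    "length zs \<le> 2 * (J + 1)" "distinct zs" "set zs \<subseteq> Y - S" "successively E (x1 # zs @ [x2])"
    "FP (S \<union> set zs) (\<lambda>x. c x - (if x \<in> insert x1 (insert x2 (set zs)) then 1 else 0))"
  proof (rule connect[OF FP _ _ _ _ _ _ d cA cB qJ room])
    show "last ` A \<subseteq> V" "hd ` B \<subseteq> V" using lA hB P(3) by blast+
    show "last ` A \<inter> (Y - S) = {}" "hd ` B \<inter> (Y - S) = {}" using lA hB P(4) by blast+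
    show "1 \<le> c x" if "x \<in> last ` A" for x using that caps A(1) by auto
    show "1 \<le> c x" if "x \<in> hd ` B" for x using that caps B(1) by auto
  qed
  obtain p p' where p: "p \<in> A" "x1 = last p" "p' \<in> B" "x2 = hd p'" using z(1,2) by blast
  have pP: "p \<in> P" "p' \<in> P" "p \<noteq> p'" using p A(1) B(1,3) by auto
  define S' where "S' = S \<union> set zs"
  define c' where "c' = (\<lambda>x. c x - (if x \<in> insert x1 (insert x2 (set zs)) then 1 else 0 :: nat))"
  define r where "r = p @ zs @ p'"
  define P' where "P' = insert r (P - {p, p'})"
  have ip: "is_path p" "is_path p'" using P(1) pP by (auto simp: paths_def)
  have zV: "set zs \<inter> verts P = {}" using z(7) P(4) by blast
  have dp: "set p \<inter> set p' = {}" using P(1) pP by (simp add: paths_def)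
  have zp: "set p \<inter> set zs = {}" "set zs \<inter> set p' = {}" using zV pP by blast+
  have ez: "successively E zs" "E x1 (hd zs)" "E (last zs) x2"
    using z(3,8) by (auto simp: successively_Cons successively_append_iff)
  have ne: "p \<noteq> []" "p' \<noteq> []" using ip by (auto simp: is_path_def)
  have ir: "is_path r"
    unfolding r_def is_path_def using ip ez z(3,6) zp dp p ne
    by (auto simp: is_path_def successively_append_iff)
  have sr: "set r = set p \<union> set zs \<union> set p'" by (auto simp: r_def)
  have rest: "set u \<inter> set r = {}" if "u \<in> P - {p, p'}" for u
  proof -
    have "set u \<inter> set p = {}" "set u \<inter> set p' = {}" using P(1) pP that by (auto simp: paths_def)
    moreover have "set u \<inter> set zs = {}" using zV that by blast
    ultimately show ?thesis unfolding sr by blast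
  qed
  have paths': "paths P'" unfolding P'_def
    by (rule paths_insert[OF paths_subset[OF P(1)] ir]) (use rest in blast)+
  have rP: "r \<notin> P - {p, p'}" using rest[of r] ne by (auto simp: r_def)
  have card: "card P = Suc (card P')"
  proof -
    have "card (P - {p, p'}) = card P - 2" using pP finP by (simp add: card_Diff_subset)
    then show ?thesis using rP finP P(2) by (simp add: P'_def)
  qed
  have zS: "set zs \<inter> S = {}" using z(7) by blast
  have cS: "card S' \<le> card S + 2 * (J + 1)"
    using card_Un_le[of S "set zs"] distinct_card[OF z(6)] z(5) by (simp add: S'_def)
  have sS: "S' - S = set zs" using zS by (auto simp: S'_def)
  have vt: "verts P' = verts P \<union> (S' - S)"
  proof -
    have "verts P = verts (P - {p, p'}) \<union> set p \<union> set p'" using pP by blast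
    then show ?thesis unfolding sS P'_def by (auto simp: sr)
  qed
  have FP': "FP S' c'" using z(9) by (simp add: S'_def c'_def)
  have eq: "c' u = c u" if "u \<notin> {x1, x2} \<union> set zs" for u using that by (simp add: c'_def)
  have x12: "x1 \<in> set p" "x2 \<in> set p'" using p ne by auto
  have caps': "\<forall>u\<in>P'. 1 \<le> c' (hd u) \<and> 1 \<le> c' (last u) \<and> (hd u = last u \<longrightarrow> 2 \<le> c' (hd u))"
  proof
    fix u assume "u \<in> P'"
    then consider "u = r" | "u \<in> P - {p, p'}" by (auto simp: P'_def)
    then show "1 \<le> c' (hd u) \<and> 1 \<le> c' (last u) \<and> (hd u = last u \<longrightarrow> 2 \<le> c' (hd u))"
    proof cases
      case 1
      have h: "hd p \<in> set p" "last p' \<in> set p'" using ne by auto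
      have "hd p \<noteq> last p'" "hd p \<noteq> x2" "last p' \<noteq> x1" "hd p \<notin> set zs" "last p' \<notin> set zs"
        using h dp x12 zp by (auto simp: disjoint_iff)
      moreover have "1 \<le> c' (hd p)"
        using bspec[OF caps pP(1)] p(2) calculation by (cases "hd p = last p") (auto simp: c'_def)
      moreover have "1 \<le> c' (last p')"
        using bspec[OF caps pP(2)] p(4) calculation by (cases "hd p' = last p'") (auto simp: c'_def)
      ultimately show ?thesis using 1 ne by (simp add: r_def)
    next
      case 2
      have hu: "hd u \<in> set u" "last u \<in> set u" using lastP 2 by auto
      have "set u \<inter> set r = {}" using rest[OF 2] .
      then have "hd u \<notin> {x1, x2} \<union> set zs" "last u \<notin> {x1, x2} \<union> set zs"
        using hu x12 unfolding sr by blast+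
      then have "c' (hd u) = c (hd u)" "c' (last u) = c (last u)" using eq by blast+
      then show ?thesis using caps 2 by simp
    qed
  qed
  have same: "\<forall>u. u \<notin> verts P \<union> (S' - S) \<longrightarrow> c' u = c u"
    using eq x12 pP unfolding sS by blast
  have sub: "S \<subseteq> S'" by (simp add: S'_def)
  show ?thesis by (intro exI conjI) (fact paths' card FP' sub cS vt caps' same)+
qed

text \<open>While at least \<open>2 * q\<close> paths are left, \<open>q\<close> ends and
  \<open>q\<close> starts are on offer and a connection costs \<open>2 * (j + 1)\<close>; only the
  later merges pay the full \<open>2 * (J + 1)\<close>. With \<open>\<mu>\<close> paths all charged
  at the full price, of order log n each, the room would overflow.\<close>

lemma merge_all:
  assumes "paths P" "P \<noteq> {}" "verts P \<subseteq> V" "verts P \<inter> (Y - S) = {}" "FP S c"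
    and "\<forall>p\<in>P. 1 \<le> c (hd p) \<and> 1 \<le> c (last p) \<and> (hd p = last p \<longrightarrow> 2 \<le> c (hd p))"
    and J: "\<mu> \<le> 2 ^ J" and j: "\<mu> \<le> q * 2 ^ j"
    and "card S + (card P * (2 * (j + 1)) + min (card P) (2 * q) * (2 * (J + 1))) + 20 * \<mu> \<le> card Y"
  shows "\<exists>r S' c'. is_path r \<and> FP S' c' \<and> S \<subseteq> S' \<and>
    card S' \<le> card S + (card P * (2 * (j + 1)) + min (card P) (2 * q) * (2 * (J + 1))) \<and>
    set r = verts P \<union> (S' - S) \<and> 1 \<le> c' (hd r) \<and> (\<forall>u. u \<notin> verts P \<union> (S' - S) \<longrightarrow> c' u = c u)"
  using assms(1-6,9)
proof (induction "card P" arbitrary: P S c)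
  case 0
  then show ?case by (auto simp: paths_def)
next
  case (Suc k)
  show ?case
  proof (cases "k = 0")
    case True
    then obtain r where r: "P = {r}" using Suc.hyps(2) by (metis card_1_singletonE One_nat_def)
    have "is_path r" using Suc.prems(1) r by (simp add: paths_def)
    then show ?thesis using Suc.prems r
      by (intro exI[of _ r] exI[of _ S] exI[of _ c]) auto
  next
    case False
    then have c2: "2 \<le> card P" using Suc.hyps(2) by simp
    define i where "i = (if 2 * q \<le> card P then j else J)"
    have i: "\<mu> \<le> (card P div 2) * 2 ^ i"
    proof (cases "2 * q \<le> card P")
      case True
      then have "q * 2 ^ j \<le> (card P div 2) * 2 ^ j" by (intro mult_le_mono1) linarith
      then show ?thesis using le_trans[OF j] True by (simp add: i_def)
    next
      case False
      have "1 * 2 ^ J \<le> (card P div 2) * 2 ^ J" using c2 by (intro mult_le_mono1) linarith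
      then have "\<mu> \<le> (card P div 2) * 2 ^ J" using J by linarith
      then show ?thesis using False by (simp add: i_def)
    qed
    have r20: "card S + 20 * \<mu> \<le> card Y" using Suc.prems(7) by linarith
    from merge_two[OF Suc.prems(1) c2 Suc.prems(3-6) i r20] obtain P' S' c' where
      *: "paths P'" "card P = Suc (card P')" "FP S' c'" "S \<subseteq> S'" "card S' \<le> card S + 2 * (i + 1)"
      "verts P' = verts P \<union> (S' - S)"
      "\<forall>p\<in>P'. 1 \<le> c' (hd p) \<and> 1 \<le> c' (last p) \<and> (hd p = last p \<longrightarrow> 2 \<le> c' (hd p))"
      "\<forall>u. u \<notin> verts P \<union> (S' - S) \<longrightarrow> c' u = c u" by (elim exE conjE) (rule that)
    have k: "k = card P'" using Suc.hyps(2) *(2) by simp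
    have ne: "P' \<noteq> {}" using k False by auto
    have S'Y: "S' \<subseteq> Y" using *(3) by (simp add: FP_def)
    have sv: "verts P' \<subseteq> V" "verts P' \<inter> (Y - S') = {}"
      unfolding *(6) using Suc.prems(3,4) S'Y Y_subset *(4) by blast+
    have cost: "2 * (i + 1) + (card P' * (2 * (j + 1)) + min (card P') (2 * q) * (2 * (J + 1)))
        \<le> card P * (2 * (j + 1)) + min (card P) (2 * q) * (2 * (J + 1))"
    proof (cases "2 * q \<le> card P")
      case True
      have "min (card P') (2 * q) * (2 * (J + 1)) \<le> min (card P) (2 * q) * (2 * (J + 1))"
        using *(2) by (intro mult_le_mono1) simp
      then show ?thesis using True *(2) by (simp add: i_def)
    next
      case False
      then have "min (card P) (2 * q) = Suc (min (card P') (2 * q))" using *(2) by simp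
      then show ?thesis using False *(2) by (simp add: i_def)
    qed
    have rm: "card S' + (card P' * (2 * (j + 1)) + min (card P') (2 * q) * (2 * (J + 1))) + 20 * \<mu> \<le> card Y"
      using cost *(5) Suc.prems(7) by linarith
    from Suc.hyps(1)[OF k *(1) ne sv *(3,7) rm] obtain r S'' c'' where
      **: "is_path r" "FP S'' c''" "S' \<subseteq> S''"
      "card S'' \<le> card S' + (card P' * (2 * (j + 1)) + min (card P') (2 * q) * (2 * (J + 1)))"
      "set r = verts P' \<union> (S'' - S')" "1 \<le> c'' (hd r)" "\<forall>u. u \<notin> verts P' \<union> (S'' - S') \<longrightarrow> c'' u = c' u"
      by (elim exE conjE) (rule that)
    have s1: "S \<subseteq> S''" using *(4) **(3) by blast
    have s2: "card S'' \<le> card S + (card P * (2 * (j + 1)) + min (card P) (2 * q) * (2 * (J + 1)))"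
      using cost *(5) **(4) by linarith
    have un: "S'' - S = (S' - S) \<union> (S'' - S')" using *(4) **(3) by blast
    have s3: "set r = verts P \<union> (S'' - S)" unfolding un **(5) *(6) by blast
    have s4: "\<forall>u. u \<notin> verts P \<union> (S'' - S) \<longrightarrow> c'' u = c u"
      unfolding un using *(6,8) **(7) by auto
    show ?thesis by (intro exI conjI) (fact **(1,2) s1 s2 s3 **(6) s4)+
  qed
qed

text \<open>A prescribed start \<open>a\<close> lies in the hub, so it is not counted among the
  vertices of the region, and reaching it takes one more long connection: the summand 1 in
  \<open>2 * q + 1\<close>. With \<open>None\<close> the path starts anywhere and is counted
  whole.\<close>

lemma absorb_region:
  assumes FP: "FP S c" and W: "W \<subseteq> V - Y" "W \<noteq> {}" "expands_on W W" "\<forall>w\<in>W. 2 \<le> c w"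
    and st: "\<forall>a. st = Some a \<longrightarrow> a \<in> S \<and> 1 \<le> c a"
    and J: "\<mu> \<le> 2 ^ J" and j: "\<mu> \<le> q * 2 ^ j"
    and room: "card S + (\<mu> * (2 * (j + 1)) + (2 * q + 1) * (2 * (J + 1))) + 20 * \<mu> \<le> card Y"
  shows "\<exists>A S' c'. is_path A \<and> FP S' c' \<and> S \<subseteq> S' \<and>
    card S' \<le> card S + (\<mu> * (2 * (j + 1)) + (2 * q + 1) * (2 * (J + 1))) \<and>
    (case st of None \<Rightarrow> set A | Some a \<Rightarrow> set (tl A)) = W \<union> (S' - S) \<and>
    (\<forall>a. st = Some a \<longrightarrow> hd A = a) \<and>
    (\<forall>u. u \<notin> W \<union> (S' - S) \<union> set_option st \<longrightarrow> c' u = c u)"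
proof -
  have WV: "W \<subseteq> V" using W(1) by blast
  obtain P where P: "paths P" "verts P = W" "card P \<le> \<mu>" using cover_by_paths[OF WV W(3)] by blast
  have P0: "P \<noteq> {}" using P(2) W(2) by auto
  have vV: "verts P \<subseteq> V" "verts P \<inter> (Y - S) = {}" using P(2) W(1) by blast+
  have caps: "\<forall>p\<in>P. 1 \<le> c (hd p) \<and> 1 \<le> c (last p) \<and> (hd p = last p \<longrightarrow> 2 \<le> c (hd p))"
  proof
    fix p assume that: "p \<in> P"
    have "hd p \<in> W" "last p \<in> W" using paths_nonempty[OF P(1) that] that P(2) by auto
    then show "1 \<le> c (hd p) \<and> 1 \<le> c (last p) \<and> (hd p = last p \<longrightarrow> 2 \<le> c (hd p))" using bspec[OF W(4), of "hd p"] bspec[OF W(4), of "last p"] by simp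
  qed
  have c1: "card P * (2 * (j + 1)) \<le> \<mu> * (2 * (j + 1))" using P(3) by (rule mult_le_mono1)
  have c2: "min (card P) (2 * q) * (2 * (J + 1)) \<le> (2 * q) * (2 * (J + 1))" by (rule mult_le_mono1) simp
  have c3: "(2 * q + 1) * (2 * (J + 1)) = (2 * q) * (2 * (J + 1)) + 2 * (J + 1)" by (simp add: algebra_simps)
  have rm: "card S + (card P * (2 * (j + 1)) + min (card P) (2 * q) * (2 * (J + 1))) + 20 * \<mu> \<le> card Y"
    using room c1 c2 c3 by linarith
  from merge_all[OF P(1) P0 vV FP caps J j rm] obtain r S' c' where
    *: "is_path r" "FP S' c'" "S \<subseteq> S'"
    "card S' \<le> card S + (card P * (2 * (j + 1)) + min (card P) (2 * q) * (2 * (J + 1)))"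
    "set r = verts P \<union> (S' - S)" "1 \<le> c' (hd r)" "\<forall>u. u \<notin> verts P \<union> (S' - S) \<longrightarrow> c' u = c u"
    by (elim exE conjE) (rule that)
  have cS': "card S' + 2 * (J + 1) \<le> card S + (\<mu> * (2 * (j + 1)) + (2 * q + 1) * (2 * (J + 1)))"
    using *(4) c1 c2 c3 by linarith
  have ne: "r \<noteq> []" using *(1) by (simp add: is_path_def)
  show ?thesis
  proof (cases st)
    case None
    have "card S' \<le> card S + (\<mu> * (2 * (j + 1)) + (2 * q + 1) * (2 * (J + 1)))" using cS' by linarith
    then show ?thesis using * None unfolding P(2)
      by (intro exI[of _ r] exI[of _ S'] exI[of _ c']) auto
  next
    case (Some a)
    have S'Y: "S' \<subseteq> Y" using *(2) by (simp add: FP_def)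
    have aS: "a \<in> S" "1 \<le> c a" using st Some by auto
    have ar: "a \<notin> set r" using aS(1) W(1) S'Y *(3) unfolding *(5) P(2) by blast
    then have ca: "c' a = c a" using *(5,7) by blast
    have hr: "hd r \<in> set r" using ne by simp
    have hv: "hd r \<in> V" "hd r \<notin> Y - S'" using hr W(1) S'Y Y_subset unfolding *(5) P(2) by blast+
    have av: "a \<in> V" "a \<notin> Y - S'" using aS(1) S'Y *(3) Y_subset by blast+
    have r2: "card S' + 20 * \<mu> \<le> card Y" using cS' room by linarith
    obtain zs where zs: "zs \<noteq> []" "even (length zs)" "length zs \<le> 2 * (J + 1)"
      "distinct zs" "set zs \<subseteq> Y - S'" "successively E (a # zs @ [hd r])"
      "FP (S' \<union> set zs) (\<lambda>u. c' u - (if u \<in> insert a (insert (hd r) (set zs)) then 1 else 0))"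
      by (rule connect_pair[OF *(2) av _ hv *(6) _ J r2]) (use ca aS ar hr in auto)
    define S'' where "S'' = S' \<union> set zs"
    define c'' where "c'' = (\<lambda>u. c' u - (if u \<in> insert a (insert (hd r) (set zs)) then 1 else 0 :: nat))"
    have FP'': "FP S'' c''" using zs(7) by (simp add: S''_def c''_def)
    have zr: "set zs \<inter> set r = {}" using zs(5) W(1) *(3) S'Y unfolding *(5) P(2) by blast
    have za: "a \<notin> set zs" using zs(5) av by blast
    have ez: "successively E zs" "E a (hd zs)" "E (last zs) (hd r)"
      using zs(1,6) by (auto simp: successively_Cons successively_append_iff)
    have A: "is_path (a # zs @ r)"
      using ez zs(1,4) zr za ar *(1) ne
      by (auto simp: is_path_def successively_Cons successively_append_iff)
    have s1: "S \<subseteq> S''" using *(3) by (auto simp: S''_def)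
    have s2: "card S'' \<le> card S + (\<mu> * (2 * (j + 1)) + (2 * q + 1) * (2 * (J + 1)))"
      using cS' card_Un_le[of S' "set zs"] distinct_card[OF zs(4)] zs(3) by (simp add: S''_def)
    have un: "S'' - S = (S' - S) \<union> set zs" using zs(5) *(3) by (auto simp: S''_def)
    have s3: "(case st of None \<Rightarrow> set (a # zs @ r) | Some a' \<Rightarrow> set (tl (a # zs @ r))) = W \<union> (S'' - S)"
      using *(5) P(2) un Some by auto
    have s4: "\<forall>a'. st = Some a' \<longrightarrow> hd (a # zs @ r) = a'" using Some by simp
    have s5: "\<forall>u. u \<notin> W \<union> (S'' - S) \<union> set_option st \<longrightarrow> c'' u = c u"
    proof (intro allI impI)
      fix u assume u: "u \<notin> W \<union> (S'' - S) \<union> set_option st"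
      then have "u \<notin> set r" "u \<notin> set zs" "u \<noteq> a" unfolding un *(5) P(2) using Some by auto
      moreover have "u \<noteq> hd r" using \<open>u \<notin> set r\<close> hr by blast
      ultimately show "c'' u = c u" using *(7) u unfolding c''_def *(5)[symmetric] by simp
    qed
    show ?thesis by (intro exI conjI) (fact A FP'' s1 s2 s3 s4 s5)+
  qed
qed

end

context room_graph
begin

text \<open>\<open>T i\<close> is what region \<open>i\<close> consumes beyond a prescribed start:
  the class and its connecting vertices. The induction also records that capacities elsewhere are
  unchanged, which later classes and starts rely on.\<close>

lemma absorb_regions:
  assumes FP: "FP S c"
    and W: "\<forall>i<m. W i \<subseteq> V - Y \<and> W i \<noteq> {} \<and> expands_on (W i) (W i) \<and> (\<forall>w\<in>W i. 2 \<le> c w)"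
    and disj: "\<forall>i<m. \<forall>i'<m. i \<noteq> i' \<longrightarrow> W i \<inter> W i' = {}"
    and st: "\<forall>i<m. \<forall>a. st i = Some a \<longrightarrow> a \<in> S \<and> 1 \<le> c a"
    and st_inj: "\<forall>i<m. \<forall>i'<m. \<forall>a. i \<noteq> i' \<longrightarrow> st i = Some a \<longrightarrow> st i' \<noteq> Some a"
    and J: "\<mu> \<le> 2 ^ J" and j: "\<mu> \<le> q * 2 ^ j"
    and room: "card S + m * (\<mu> * (2 * (j + 1)) + (2 * q + 1) * (2 * (J + 1))) + 20 * \<mu> \<le> card Y"
  shows "\<exists>A T S' c'. FP S' c' \<and> S \<subseteq> S' \<and>
    (\<forall>i<m. is_path (A i) \<and> W i \<subseteq> T i \<and> (case st i of None \<Rightarrow> T i = set (A i) | Some a \<Rightarrow> hd (A i) = a \<and> T i = set (tl (A i)))) \<and>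
    (\<forall>i<m. \<forall>i'<m. i \<noteq> i' \<longrightarrow> T i \<inter> T i' = {}) \<and> (\<Union>i<m. T i) = (\<Union>i<m. W i) \<union> (S' - S)"
proof -
  define cost where "cost = \<mu> * (2 * (j + 1)) + (2 * q + 1) * (2 * (J + 1))"
  have "\<exists>A T S' c'. FP S' c' \<and> S \<subseteq> S' \<and> card S' \<le> card S + m * cost \<and>
    (\<forall>i<m. is_path (A i) \<and> W i \<subseteq> T i \<and> (case st i of None \<Rightarrow> T i = set (A i) | Some a \<Rightarrow> hd (A i) = a \<and> T i = set (tl (A i)))) \<and>
    (\<forall>i<m. \<forall>i'<m. i \<noteq> i' \<longrightarrow> T i \<inter> T i' = {}) \<and> (\<Union>i<m. T i) = (\<Union>i<m. W i) \<union> (S' - S) \<and>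
    (\<forall>u. u \<notin> (\<Union>i<m. W i \<union> set_option (st i)) \<union> (S' - S) \<longrightarrow> c' u = c u)"
    using W disj st st_inj room unfolding cost_def[symmetric]
  proof (induction m)
    case 0
    then show ?case using FP by (intro exI[of _ "\<lambda>_. []"] exI[of _ "\<lambda>_. {}"] exI[of _ S] exI[of _ c]) auto
  next
    case (Suc m)
    have "\<exists>A T S' c'. FP S' c' \<and> S \<subseteq> S' \<and> card S' \<le> card S + m * cost \<and>
    (\<forall>i<m. is_path (A i) \<and> W i \<subseteq> T i \<and> (case st i of None \<Rightarrow> T i = set (A i) | Some a \<Rightarrow> hd (A i) = a \<and> T i = set (tl (A i)))) \<and>
    (\<forall>i<m. \<forall>i'<m. i \<noteq> i' \<longrightarrow> T i \<inter> T i' = {}) \<and> (\<Union>i<m. T i) = (\<Union>i<m. W i) \<union> (S' - S) \<and>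
    (\<forall>u. u \<notin> (\<Union>i<m. W i \<union> set_option (st i)) \<union> (S' - S) \<longrightarrow> c' u = c u)"
    proof (rule Suc.IH)
      show "\<forall>i<m. W i \<subseteq> V - Y \<and> W i \<noteq> {} \<and> expands_on (W i) (W i) \<and> (\<forall>w\<in>W i. 2 \<le> c w)"
        by (intro allI impI, rule Suc.prems(1)[rule_format]) simp
      show "\<forall>i<m. \<forall>i'<m. i \<noteq> i' \<longrightarrow> W i \<inter> W i' = {}"
        by (intro allI impI, rule Suc.prems(2)[rule_format]) simp_all
      show "\<forall>i<m. \<forall>a. st i = Some a \<longrightarrow> a \<in> S \<and> 1 \<le> c a"
        by (intro allI impI, rule Suc.prems(3)[rule_format]) simp_all
      show "\<forall>i<m. \<forall>i'<m. \<forall>a. i \<noteq> i' \<longrightarrow> st i = Some a \<longrightarrow> st i' \<noteq> Some a"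
        by (intro allI impI, rule Suc.prems(4)[rule_format]) simp_all
      show "card S + m * cost + 20 * \<mu> \<le> card Y" using Suc.prems(5) by simp
    qed
    then obtain A T S' c' where IH: "FP S' c'" "S \<subseteq> S'" "card S' \<le> card S + m * cost"
      "\<forall>i<m. is_path (A i) \<and> W i \<subseteq> T i \<and> (case st i of None \<Rightarrow> T i = set (A i) | Some a \<Rightarrow> hd (A i) = a \<and> T i = set (tl (A i)))"
      "\<forall>i<m. \<forall>i'<m. i \<noteq> i' \<longrightarrow> T i \<inter> T i' = {}" "(\<Union>i<m. T i) = (\<Union>i<m. W i) \<union> (S' - S)"
      "\<forall>u. u \<notin> (\<Union>i<m. W i \<union> set_option (st i)) \<union> (S' - S) \<longrightarrow> c' u = c u"
      by (elim exE conjE) (rule that)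
    have S'Y: "S' \<subseteq> Y" using IH(1) by (simp add: FP_def)
    have SY: "S \<subseteq> Y" using IH(2) S'Y by blast
    have Wm: "W m \<subseteq> V - Y" "W m \<noteq> {}" "expands_on (W m) (W m)" "\<forall>w\<in>W m. 2 \<le> c w"
      using Suc.prems(1) by auto
    have sto: "set_option (st i) \<subseteq> S" if "i < Suc m" for i
      using Suc.prems(3) that by (cases "st i") auto
    have cW: "\<forall>w\<in>W m. 2 \<le> c' w"
    proof
      fix w assume that: "w \<in> W m"
      have "w \<notin> W i" if "i < m" for i using Suc.prems(2) \<open>w \<in> W m\<close> that
        by (metis disjoint_iff less_Suc_eq nat_neq_iff)
      moreover have "w \<notin> set_option (st i)" if "i < m" for i
        using sto[of i] that Wm(1) SY \<open>w \<in> W m\<close> by (meson DiffD2 less_SucI subsetD)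
      moreover have "w \<notin> S' - S" using Wm(1) S'Y that by blast
      ultimately have "c' w = c w" using IH(7) by auto
      then show "2 \<le> c' w" using Wm(4) that by simp
    qed
    have stm: "\<forall>a. st m = Some a \<longrightarrow> a \<in> S' \<and> 1 \<le> c' a"
    proof (intro allI impI)
      fix a assume that: "st m = Some a"
      have a: "a \<in> S" "1 \<le> c a" using Suc.prems(3) that by auto
      have "a \<notin> W i" if "i < m" for i using Suc.prems(1) a SY that by (meson DiffD2 less_SucI subsetD)
      moreover have "a \<notin> set_option (st i)" if "i < m" for i
        using Suc.prems(4) that \<open>st m = Some a\<close> by (auto simp: less_Suc_eq)
      ultimately have "c' a = c a" using IH(7) a by auto
      then show "a \<in> S' \<and> 1 \<le> c' a" using a IH(2) by auto
    qed
    have rm: "card S' + (\<mu> * (2 * (j + 1)) + (2 * q + 1) * (2 * (J + 1))) + 20 * \<mu> \<le> card Y"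
      using IH(3) Suc.prems(5) unfolding cost_def[symmetric] by simp
    from absorb_region[OF IH(1) Wm(1-3) cW stm J j rm] obtain B S'' c'' where
      *: "is_path B" "FP S'' c''" "S' \<subseteq> S''" "card S'' \<le> card S' + cost"
      "(case st m of None \<Rightarrow> set B | Some a \<Rightarrow> set (tl B)) = W m \<union> (S'' - S')"
      "\<forall>a. st m = Some a \<longrightarrow> hd B = a"
      "\<forall>u. u \<notin> W m \<union> (S'' - S') \<union> set_option (st m) \<longrightarrow> c'' u = c' u"
      unfolding cost_def[symmetric] by (elim exE conjE) (rule that)
    have S''Y: "S'' \<subseteq> Y" using *(2) by (simp add: FP_def)
    define A' where "A' = A(m := B)"
    define T' where "T' = T(m := W m \<union> (S'' - S'))"
    have s1: "S \<subseteq> S''" using IH(2) *(3) by blast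
    have s2: "card S'' \<le> card S + Suc m * cost" using *(4) IH(3) by simp
    have s3: "\<forall>i<Suc m. is_path (A' i) \<and> W i \<subseteq> T' i \<and>
      (case st i of None \<Rightarrow> T' i = set (A' i) | Some a \<Rightarrow> hd (A' i) = a \<and> T' i = set (tl (A' i)))"
    proof (intro allI impI)
      fix i assume i: "i < Suc m"
      show "is_path (A' i) \<and> W i \<subseteq> T' i \<and>
        (case st i of None \<Rightarrow> T' i = set (A' i) | Some a \<Rightarrow> hd (A' i) = a \<and> T' i = set (tl (A' i)))"
      proof (cases "i = m")
        case True
        then show ?thesis using *(1,5,6) by (cases "st m") (auto simp: A'_def T'_def)
      next
        case False
        then have im: "i < m" and eq: "A' i = A i" "T' i = T i" using i by (simp_all add: A'_def T'_def)
        show ?thesis unfolding eq by (rule IH(4)[rule_format, OF im])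
      qed
    qed
    have Tm: "T i \<inter> (W m \<union> (S'' - S')) = {}" if "i < m" for i
    proof -
      have "T i \<subseteq> (\<Union>i<m. W i) \<union> (S' - S)" unfolding IH(6)[symmetric] using that by blast
      moreover have "(\<Union>i<m. W i) \<inter> W m = {}" using Suc.prems(2) by (auto simp: less_Suc_eq)
      moreover have "(\<Union>i<m. W i) \<inter> S'' = {}" using Suc.prems(1) S''Y by (fastforce simp: less_Suc_eq)
      moreover have "S' \<inter> W m = {}" using Wm(1) S'Y by blast
      ultimately show ?thesis by blast
    qed
    have s4: "\<forall>i<Suc m. \<forall>i'<Suc m. i \<noteq> i' \<longrightarrow> T' i \<inter> T' i' = {}"
    proof (intro allI impI)
      fix i i' assume i: "i < Suc m" "i' < Suc m" "i \<noteq> i'"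
      then consider "i < m" "i' < m" | "i < m" "i' = m" | "i = m" "i' < m" by linarith
      then show "T' i \<inter> T' i' = {}"
      proof cases
        case 1
        then show ?thesis using IH(5) i(3) by (simp add: T'_def)
      next
        case 2
        then show ?thesis using Tm[OF 2(1)] by (simp add: T'_def)
      next
        case 3
        then show ?thesis using Tm[OF 3(2)] by (simp add: T'_def Int_commute)
      qed
    qed
    have un: "S'' - S = (S' - S) \<union> (S'' - S')" using IH(2) *(3) by blast
    have s5: "(\<Union>i<Suc m. T' i) = (\<Union>i<Suc m. W i) \<union> (S'' - S)"
    proof -
      have "(\<Union>i<m. T' i) = (\<Union>i<m. T i)" by (simp add: T'_def)
      then show ?thesis using IH(6) unfolding un by (simp add: lessThan_Suc T'_def) blast
    qed
    have s6: "\<forall>u. u \<notin> (\<Union>i<Suc m. W i \<union> set_option (st i)) \<union> (S'' - S) \<longrightarrow> c'' u = c u"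
    proof (intro allI impI)
      fix u assume u: "u \<notin> (\<Union>i<Suc m. W i \<union> set_option (st i)) \<union> (S'' - S)"
      then have "c'' u = c' u" using *(7) unfolding un by (simp add: lessThan_Suc)
      then show "c'' u = c u" using IH(7) u unfolding un by (simp add: lessThan_Suc)
    qed
    show ?case by (intro exI conjI) (fact *(2) s1 s2 s3 s4 s5 s6)+
  qed
  then show ?thesis by (elim exE conjE) (intro exI conjI)
qed

end

text \<open>The hub runs through \<open>p0 0, \<dots>, p0 (k - 1)\<close>, and the paths \<open>p1 g\<close> serve as wires. The linker \<open>Q 0\<close>
  closes the cycles, \<open>Q 1\<close> attaches the pool \<open>P\<close> to the wires, and the others each halve the pool.\<close>

locale absorbing_system = joined_graph +
  fixes k p :: nat and p0 p1 q0 q1 :: "nat \<Rightarrow> 'a list" and S0 :: "'a set"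
    and Q :: "nat \<Rightarrow> 'a set" and a b :: "nat \<Rightarrow> 'a" and P :: "'a list set"
  assumes hub: "hub k p0 p1 q0 q1 S0" and k2: "2 \<le> k" and p2: "2 \<le> p"
    and linker: "i < p \<Longrightarrow> linker (Q i) (a i) (b i)"
    and a0: "a 0 = last (p1 0)" and b0: "b 0 = hd (p1 0)" and a1: "a 1 = last (p1 1)"
    and b1: "b 1 \<notin> Q 1" and ab: "2 \<le> i \<Longrightarrow> i < p \<Longrightarrow> a i \<noteq> b i \<and> a i \<notin> Q i \<and> b i \<notin> Q i"
    and P: "paths P" "card P \<le> \<mu>"
begin

text \<open>\<open>a 0\<close>, \<open>b 0\<close> and \<open>a 1\<close> are ends of wires and so
  belong to the hub already; every other stub is counted with its linker.\<close>

definition region :: "nat \<Rightarrow> 'a set" where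
  "region i = Q i \<union> (if i = 0 then {} else if i = 1 then {b 1} else {a i, b i})"

end

locale absorbing_partition = absorbing_system +
  assumes region_disjoint: "i < p \<Longrightarrow> i' < p \<Longrightarrow> i \<noteq> i' \<Longrightarrow> region i \<inter> region i' = {}"
    and hub_region: "i < p \<Longrightarrow> S0 \<inter> region i = {}"
    and P_region: "i < p \<Longrightarrow> verts P \<inter> region i = {}" and hub_P: "S0 \<inter> verts P = {}"
    and cover: "S0 \<union> (\<Union>i<p. region i) \<union> verts P = V"

context room_graph
begin

text \<open>Classes \<open>2 * i\<close> and \<open>2 * i + 1\<close> supply the two halves of
  linker \<open>i\<close>. What is left of the room is covered by at most \<open>\<mu>\<close>
  paths, the pool.\<close>

theorem absorbing_partition_exists:
  assumes W: "\<forall>i<2 * p. W i \<subseteq> V - Y \<and> W i \<noteq> {}"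
    and Wdisj: "\<forall>i<2 * p. \<forall>i'<2 * p. i \<noteq> i' \<longrightarrow> W i \<inter> W i' = {}"
    and Wcover: "(\<Union>i<2 * p. W i) = V - Y"
    and Wexp: "\<forall>i<2 * p. \<forall>U. U \<subseteq> V \<longrightarrow> card U \<le> 2 * \<mu> \<longrightarrow> 10 * card U \<le> card (nb U \<inter> W i)"
    and J: "\<mu> \<le> 2 ^ J" and j: "\<mu> \<le> q * 2 ^ j" and p: "2 \<le> p" and k: "2 \<le> k"
    and room: "k * (2 * (J + 2) ^ 2) + 2 * p * (\<mu> * (2 * (j + 1)) + (2 * q + 1) * (2 * (J + 1)))
      + 20 * \<mu> \<le> card Y"
  obtains p0 p1 q0 q1 S0 Q a b P where "absorbing_partition V E \<mu> k p p0 p1 q0 q1 S0 Q a b P"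
proof -
  define cost where "cost = \<mu> * (2 * (j + 1)) + (2 * q + 1) * (2 * (J + 1))"
  have "W 0 \<noteq> {}" "W 0 \<subseteq> V - Y" using W p by auto
  then obtain x0 where x0: "x0 \<in> V - Y" by blast
  have r1: "k * (2 * (J + 2) ^ 2) + 20 * \<mu> \<le> card Y" using room by linarith
  from hub_exists[OF x0 J r1] obtain p0 p1 q0 q1 S c where
    h: "hub k p0 p1 q0 q1 S" "FP S c" "card S \<le> k * (2 * (J + 2) ^ 2)"
      "\<forall>g<k. 1 \<le> c (hd (p1 g)) \<and> 1 \<le> c (last (p1 g))" "\<forall>y\<in>V - Y. 4 \<le> c y"
    by (elim exE conjE) (rule that)
  have SY: "S \<subseteq> Y" using h(2) by (simp add: FP_def)
  \<comment> \<open>Linker 0 will close the cycles and linker 1 will hook the pool to the wires, so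
    three of their four stubs have to be ends of wires 0 and 1; all other paths may start
    anywhere.\<close>
  define st where "st = (\<lambda>i::nat. if i = 0 then Some (last (p1 0)) else if i = 1 then Some (hd (p1 0))
    else if i = 2 then Some (last (p1 1)) else None)"
  have sw: "switch (p0 g) (p1 g) (q0 g) (q1 g)" if "g < k" for g using h(1) that by (simp add: hub_def)
  have k01: "0 < k" "1 < k" using k by auto
  have p1S: "set (p1 g) \<subseteq> S" if "g < k" for g using h(1) that by (auto simp: hub_def)
  have ne: "p1 g \<noteq> []" if "g < k" for g using sw[OF that] by (auto simp: switch_def is_path_def)
  have inS: "last (p1 0) \<in> S" "hd (p1 0) \<in> S" "last (p1 1) \<in> S"
    using p1S[OF k01(1)] p1S[OF k01(2)] ne[OF k01(1)] ne[OF k01(2)] by auto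
  have d01: "set (p1 0) \<inter> set (p1 1) = {}" using h(1) k01 by (fastforce simp: hub_def)
  have dist: "last (p1 0) \<noteq> hd (p1 0)" "last (p1 0) \<noteq> last (p1 1)" "hd (p1 0) \<noteq> last (p1 1)"
  proof -
    show "last (p1 0) \<noteq> hd (p1 0)" using sw[OF k01(1)] by (auto simp: switch_def)
    show "last (p1 0) \<noteq> last (p1 1)" "hd (p1 0) \<noteq> last (p1 1)"
      using d01 ne[OF k01(1)] ne[OF k01(2)] by (metis disjoint_iff last_in_set hd_in_set)+
  qed
  have WW: "\<forall>i<2 * p. W i \<subseteq> V - Y \<and> W i \<noteq> {} \<and> expands_on (W i) (W i) \<and> (\<forall>w\<in>W i. 2 \<le> c w)"
  proof (intro allI impI)
    fix i assume i: "i < 2 * p"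
    have sub: "W i \<subseteq> V - Y" using W i by blast
    have "5 * card U \<le> card (nb U \<inter> W i)" if "U \<subseteq> W i" "card U \<le> 2 * \<mu>" for U
    proof -
      have "U \<subseteq> V" using that(1) sub by blast
      then show ?thesis using Wexp[rule_format, OF i _ that(2)] by simp
    qed
    then have "expands_on (W i) (W i)" by (simp add: expands_on_def)
    moreover have "\<forall>w\<in>W i. 2 \<le> c w" using sub h(5) by (metis One_nat_def add_leD2 numeral_Bit0 subsetD)
    ultimately show "W i \<subseteq> V - Y \<and> W i \<noteq> {} \<and> expands_on (W i) (W i) \<and> (\<forall>w\<in>W i. 2 \<le> c w)"
      using W i by blast
  qed
  have stS: "\<forall>i<2 * p. \<forall>a. st i = Some a \<longrightarrow> a \<in> S \<and> 1 \<le> c a"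
    using inS h(4) k01 by (auto simp: st_def)
  have stI: "\<forall>i<2 * p. \<forall>i'<2 * p. \<forall>a. i \<noteq> i' \<longrightarrow> st i = Some a \<longrightarrow> st i' \<noteq> Some a"
    using dist by (auto simp: st_def)
  have r2: "card S + (2 * p) * cost + 20 * \<mu> \<le> card Y" using room h(3) unfolding cost_def by linarith
  from absorb_regions[OF h(2) WW Wdisj stS stI J j r2[unfolded cost_def]] obtain A T S' c' where
    *: "FP S' c'" "S \<subseteq> S'"
    "\<forall>i<2 * p. is_path (A i) \<and> W i \<subseteq> T i \<and> (case st i of None \<Rightarrow> T i = set (A i) | Some a \<Rightarrow> hd (A i) = a \<and> T i = set (tl (A i)))"
    "\<forall>i<2 * p. \<forall>i'<2 * p. i \<noteq> i' \<longrightarrow> T i \<inter> T i' = {}" "(\<Union>i<2 * p. T i) = (\<Union>i<2 * p. W i) \<union> (S' - S)"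
    by (elim exE conjE) (rule that)
  have S'Y: "S' \<subseteq> Y" using *(1) by (simp add: FP_def)
  have exY: "expands_on (Y - S') (Y - S')"
    unfolding expands_on_def
  proof (intro allI impI)
    fix U assume U: "U \<subseteq> Y - S'" "card U \<le> 2 * \<mu>"
    then have UV: "U \<subseteq> V" using Y_subset by blast
    have "sum c' U = (\<Sum>u\<in>U. 5)" using FP_fresh[OF *(1)] U(1) by (intro sum.cong) auto
    moreover have "sum c' U \<le> card (nb U \<inter> Y - S')" using *(1) UV U(2) by (simp add: FP_def)
    ultimately show "5 * card U \<le> card (nb U \<inter> (Y - S'))" by (simp add: Int_Diff)
  qed
  have "Y - S' \<subseteq> V" using Y_subset by blast
  from cover_by_paths[OF this exY] obtain P where P: "paths P" "verts P = Y - S'" "card P \<le> \<mu>" by blast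
  define s where "s = (\<lambda>i. hd (A i))"
  define X where "X = (\<lambda>i. set (tl (A i)))"
  have TV: "T i \<subseteq> V" if "i < 2 * p" for i
  proof -
    have "T i \<subseteq> (\<Union>i<2 * p. W i) \<union> (S' - S)" unfolding *(5)[symmetric] using that by blast
    then show ?thesis unfolding Wcover using S'Y Y_subset by blast
  qed
  have A: "is_path (A i)" "set (A i) = insert (s i) (X i)" "s i \<notin> X i" "X i \<subseteq> T i" "W i - {s i} \<subseteq> X i"
    "s i \<in> V" if i: "i < 2 * p" for i
  proof -
    show ip: "is_path (A i)" using *(3) i by blast
    have n: "A i \<noteq> []" "distinct (A i)" using ip by (auto simp: is_path_def)
    show sA: "set (A i) = insert (s i) (X i)" using n by (cases "A i") (auto simp: s_def X_def)
    show "s i \<notin> X i" using n by (cases "A i") (auto simp: s_def X_def)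
    have c: "W i \<subseteq> T i \<and> (case st i of None \<Rightarrow> T i = set (A i) | Some a \<Rightarrow> hd (A i) = a \<and> T i = set (tl (A i)))"
      using *(3) i by blast
    show "X i \<subseteq> T i" using c sA by (cases "st i") (auto simp: X_def)
    show "W i - {s i} \<subseteq> X i" using c sA by (cases "st i") (auto simp: X_def)
    show "s i \<in> V"
    proof (cases "st i")
      case None
      then show ?thesis using c sA TV[OF i] by auto
    next
      case (Some x)
      then have "s i = x" using c by (simp add: s_def)
      then show ?thesis using stS i Some SY Y_subset by blast
    qed
  qed
  have st_s: "st i = Some x \<Longrightarrow> s i = x \<and> T i = X i" if "i < 2 * p" for i x
    using *(3) that by (auto simp: s_def X_def)
  have st_n: "st i = None \<Longrightarrow> T i = insert (s i) (X i)" if "i < 2 * p" for i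
    using *(3) A(2)[OF that] that by auto
  have AV: "set (A i) \<subseteq> V" if i: "i < 2 * p" for i
    using A(4)[OF i] A(6)[OF i] TV[OF i] unfolding A(2)[OF i] by blast
  have finV: "finite V" by (rule finite_V)
  \<comment> \<open>\<open>X i\<close> may lack the vertex \<open>s i\<close> of its class;
    expansion by 10 still leaves expansion by 5 after the loss of one vertex.\<close>
  have exX: "expands_on V (X i)" if i: "i < 2 * p" for i
    unfolding expands_on_def
  proof (intro allI impI)
    fix U assume U: "U \<subseteq> V" "card U \<le> 2 * \<mu>"
    show "5 * card U \<le> card (nb U \<inter> X i)"
    proof (cases "U = {}")
      case True
      then show ?thesis by simp
    next
      case False
      then have u1: "1 \<le> card U" using U(1) finV by (metis One_nat_def Suc_leI card_gt_0_iff finite_subset)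
      have "nb U \<inter> W i \<subseteq> insert (s i) (nb U \<inter> X i)" using A(5)[OF i] by blast
      moreover have f: "finite (nb U \<inter> X i)" using nb_subset_V finV by (meson finite_Int finite_subset)
      ultimately have "card (nb U \<inter> W i) \<le> card (insert (s i) (nb U \<inter> X i))" by (intro card_mono) auto
      also have "\<dots> \<le> Suc (card (nb U \<inter> X i))" by (rule card_insert_le_m1) simp_all
      finally show ?thesis using Wexp[rule_format, OF i U] u1 by linarith
    qed
  qed
  define Q where "Q = (\<lambda>i. X (2 * i) \<union> X (2 * i + 1))"
  define a where "a = (\<lambda>i. s (2 * i))"
  define b where "b = (\<lambda>i. s (2 * i + 1))"
  have i2: "2 * i < 2 * p" "2 * i + 1 < 2 * p" if "i < p" for i using that by auto
  have disjT: "T (2 * i) \<inter> T (2 * i + 1) = {}" if "i < p" for i using *(4) i2[OF that] by simp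
  have lk: "linker (Q i) (a i) (b i)" if i: "i < p" for i
    unfolding Q_def a_def b_def
  proof (rule linker_of_paths)
    show "is_path (A (2 * i))" "is_path (A (2 * i + 1))" using A(1) i2[OF i] by blast+
    show "set (A (2 * i)) = insert (s (2 * i)) (X (2 * i))"
      "set (A (2 * i + 1)) = insert (s (2 * i + 1)) (X (2 * i + 1))" using A(2) i2[OF i] by blast+
    show "hd (A (2 * i)) = s (2 * i)" "hd (A (2 * i + 1)) = s (2 * i + 1)" by (simp_all add: s_def)
    show "s (2 * i) \<notin> X (2 * i)" "s (2 * i + 1) \<notin> X (2 * i + 1)" using A(3) i2[OF i] by blast+
    show "set (A (2 * i)) \<subseteq> V" "set (A (2 * i + 1)) \<subseteq> V"
      using AV i2[OF i] by blast+
    show "X (2 * i) \<inter> X (2 * i + 1) = {}" using A(4)[OF i2(1)[OF i]] A(4)[OF i2(2)[OF i]] disjT[OF i] by blast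
    show "expands_on V (X (2 * i))" "expands_on V (X (2 * i + 1))" using exX i2[OF i] by blast+
  qed
  have i0: "0 < 2 * p" "1 < 2 * p" "2 < 2 * p" "3 < 2 * p" using p by auto
  have s0: "s 0 = last (p1 0) \<and> T 0 = X 0" "s 1 = hd (p1 0) \<and> T 1 = X 1" "s 2 = last (p1 1) \<and> T 2 = X 2"
    using st_s[OF i0(1)] st_s[OF i0(2)] st_s[OF i0(3)] by (simp_all add: st_def)
  have s3: "T 3 = insert (s 3) (X 3)" using st_n[OF i0(4)] by (simp add: st_def)
  have s4: "T (2 * i) = insert (a i) (X (2 * i))" "T (2 * i + 1) = insert (b i) (X (2 * i + 1))"
    if "2 \<le> i" "i < p" for i
    using st_n[OF i2(1)[OF that(2)]] st_n[OF i2(2)[OF that(2)]] that by (simp_all add: st_def a_def b_def)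
  interpret abs: absorbing_system V E \<mu> k p p0 p1 q0 q1 S Q a b P
  proof
    show "hub k p0 p1 q0 q1 S" by (rule h(1))
    show "2 \<le> k" "2 \<le> p" by (rule k p)+
    show "linker (Q i) (a i) (b i)" if "i < p" for i by (rule lk[OF that])
    show "a 0 = last (p1 0)" "b 0 = hd (p1 0)" "a 1 = last (p1 1)" using s0 by (simp_all add: a_def b_def)
    have "s 3 \<notin> T 2" using *(4) i0 s3 by auto
    then have "s 3 \<notin> X 2" using A(4)[OF i0(3)] by blast
    then show "b 1 \<notin> Q 1" using A(3)[OF i0(4)] by (simp add: b_def Q_def numeral_2_eq_2[symmetric] numeral_3_eq_3[symmetric])
    show "a i \<noteq> b i \<and> a i \<notin> Q i \<and> b i \<notin> Q i" if i: "2 \<le> i" "i < p" for i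
    proof -
      have "a i \<notin> X (2 * i)" "b i \<notin> X (2 * i + 1)" using A(3) i2[OF i(2)] by (auto simp: a_def b_def)
      then show ?thesis using disjT[OF i(2)] unfolding s4[OF i] Q_def by blast
    qed
    show "paths P" "card P \<le> \<mu>" by (rule P)+
  qed
  have reg: "abs.region i = T (2 * i) \<union> T (2 * i + 1)" if i: "i < p" for i
  proof -
    consider "i = 0" | "i = 1" | "2 \<le> i" by linarith
    then show ?thesis
    proof cases
      case 1
      then show ?thesis using s0 unfolding abs.region_def by (simp add: Q_def)
    next
      case 2
      then show ?thesis using s0 s3
        unfolding abs.region_def
        by (simp add: Q_def b_def numeral_2_eq_2[symmetric] numeral_3_eq_3[symmetric])
    next
      case 3
      then show ?thesis unfolding s4[OF 3 i] unfolding abs.region_def by (auto simp: Q_def)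
    qed
  qed
  have TW: "T i \<subseteq> (V - Y) \<union> (S' - S)" if "i < 2 * p" for i
    using *(5) that unfolding Wcover by blast
  have regT: "(\<Union>i<p. abs.region i) = (\<Union>i<2 * p. T i)"
  proof -
    have "\<exists>i'<p. i = 2 * i' \<or> i = 2 * i' + 1" if "i < 2 * p" for i
      using that by (intro exI[of _ "i div 2"]) auto
    then show ?thesis using reg i2 by fastforce
  qed
  have "absorbing_partition V E \<mu> k p p0 p1 q0 q1 S Q a b P"
  proof
    show "abs.region i \<inter> abs.region i' = {}" if i: "i < p" "i' < p" "i \<noteq> i'" for i i'
    proof -
      have "T (2 * i) \<inter> T (2 * i') = {}" "T (2 * i) \<inter> T (2 * i' + 1) = {}"
        "T (2 * i + 1) \<inter> T (2 * i') = {}" "T (2 * i + 1) \<inter> T (2 * i' + 1) = {}"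
        using *(4) i i2[OF i(1)] i2[OF i(2)] by (presburger | simp)+
      then show ?thesis unfolding reg[OF i(1)] reg[OF i(2)] by blast
    qed
    show "S \<inter> abs.region i = {}" if "i < p" for i
      unfolding reg[OF that] using TW i2[OF that] SY by blast
    show "verts P \<inter> abs.region i = {}" if "i < p" for i
      unfolding reg[OF that] P(2) using TW i2[OF that] by blast
    show "S \<inter> verts P = {}" unfolding P(2) using *(2) by blast
    show "S \<union> (\<Union>i<p. abs.region i) \<union> verts P = V"
      unfolding regT *(5) P(2) Wcover using *(2) S'Y Y_subset by blast
  qed
  then show ?thesis by (rule that)
qed

end

section \<open>Merging cycles by switches\<close>

text \<open>A transposition of points on two different cycles splices these cycles: from
  \<open>b\<close> the new map runs along the whole old cycle of \<open>a\<close> back to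
  \<open>a\<close>, and from \<open>a\<close> it continues as the old map did from \<open>b\<close>.
  No other successor changes, so orbits only grow.\<close>

lemma orbit_comp_transpose:
  assumes p: "permutation f" and b: "b \<notin> orbit f a"
  shows "b \<in> orbit (f \<circ> Transposition.transpose a b) a"
    and "x \<in> orbit f y \<Longrightarrow> x \<in> orbit (f \<circ> Transposition.transpose a b) y"
proof -
  define f' where "f' = f \<circ> Transposition.transpose a b"
  have pf': "permutation f'" unfolding f'_def using p by (simp add: permutation_compose permutation_swap_id)
  have self: "y \<in> orbit f y" "y \<in> orbit f' y" for y by (rule permutation_self_in_orbit[OF p], rule permutation_self_in_orbit[OF pf'])
  have ab: "a \<noteq> b" using self b by blast
  have f'a: "f' a = f b" "f' b = f a" and f'o: "y \<noteq> a \<Longrightarrow> y \<noteq> b \<Longrightarrow> f' y = f y" for y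
    by (simp_all add: f'_def)
  define n where "n = (LEAST n. 0 < n \<and> (f ^^ n) a = a)"
  have "\<exists>n. 0 < n \<and> (f ^^ n) a = a" using self(1)[of a] unfolding orbit_altdef by (auto dest: sym)
  then have n: "0 < n" "(f ^^ n) a = a" unfolding n_def by (metis (mono_tags, lifting) LeastI)+
  have walk: "(f' ^^ i) b = (f ^^ i) a" if "0 < i" "i \<le> n" for i
    using that
  proof (induction i)
    case (Suc i)
    show ?case
    proof (cases "i = 0")
      case True
      then show ?thesis using f'a by simp
    next
      case False
      then have "(f' ^^ i) b = (f ^^ i) a" using Suc by simp
      moreover have "(f ^^ i) a \<noteq> a" using not_less_Least[of i "\<lambda>n. 0 < n \<and> (f ^^ n) a = a"] Suc.prems False
        by (simp add: n_def)
      moreover have "(f ^^ i) a \<noteq> b" using b False by (auto simp: orbit_altdef)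
      ultimately show ?thesis using f'o by simp
    qed
  qed simp
  have "(f' ^^ n) b = a" using walk[of n] n by simp
  then have aob: "a \<in> orbit f' b" using n(1) unfolding orbit_altdef by force
  then have boa: "b \<in> orbit f' a" using orbit_swap[OF self(2)] by blast
  then show "b \<in> orbit (f \<circ> Transposition.transpose a b) a" by (simp add: f'_def)
  have step: "f y \<in> orbit f' y" for y
  proof -
    consider "y = a" | "y = b" | "y \<noteq> a" "y \<noteq> b" by blast
    then show ?thesis
    proof cases
      case 1
      have "f a \<in> orbit f' b" using orbit.base[of f' b] f'a by simp
      then show ?thesis unfolding 1 by (rule orbit_trans[OF _ boa])
    next
      case 2
      have "f b \<in> orbit f' a" using orbit.base[of f' a] f'a by simp
      then show ?thesis unfolding 2 by (rule orbit_trans[OF _ aob])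
    next
      case 3
      then show ?thesis using orbit.base[of f' y] f'o by simp
    qed
  qed
  show "x \<in> orbit (f \<circ> Transposition.transpose a b) y" if "x \<in> orbit f y"
    using that unfolding f'_def[symmetric]
    by (induction rule: orbit.induct) (rule step, rule orbit_trans[OF step])
qed

text \<open>\<open>(g, False)\<close> stands for the hub segment of switch \<open>g\<close> and
  \<open>(g, True)\<close> for its wire, so a way of joining up the strands is a permutation of such
  pairs.\<close>

definition strand :: "(nat \<Rightarrow> 'a list) \<Rightarrow> (nat \<Rightarrow> 'a list) \<Rightarrow> nat \<times> bool \<Rightarrow> 'a list" where
  "strand p0 p1 x = (if snd x then p1 (fst x) else p0 (fst x))"

text \<open>Replacing \<open>p0 g\<close>, \<open>p1 g\<close> by \<open>q0 g\<close>,
  \<open>q1 g\<close> exchanges the ends of the two strands; on successor maps this is composition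
  with \<open>toggle\<close>.\<close>

definition toggle :: "nat set \<Rightarrow> nat \<times> bool \<Rightarrow> nat \<times> bool" where
  "toggle e x = (fst x, snd x \<noteq> (fst x \<in> e))"

lemma toggle_toggle [simp]: "toggle e (toggle e x) = x"
  by (auto simp: toggle_def prod_eq_iff)

lemma toggle_permutes:
  assumes "e \<subseteq> {..<k}"
  shows "toggle e permutes {..<k} \<times> UNIV"
  unfolding permutes_def
proof (intro conjI allI impI)
  show "toggle e x = x" if "x \<notin> {..<k} \<times> UNIV" for x
    using that assms by (cases x) (auto simp: toggle_def)
  show "\<exists>!x. toggle e x = y" for y by (metis toggle_toggle)
qed

lemma toggle_insert:
  "m \<notin> e \<Longrightarrow> toggle (insert m e) = toggle e \<circ> Transposition.transpose (m, False) (m, True)"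
  by (auto simp: fun_eq_iff toggle_def Transposition.transpose_def prod_eq_iff)

text \<open>Toggling at \<open>m\<close> merges the orbits of \<open>(m, False)\<close> and \<open>(m, True)\<close>, if they are distinct.\<close>

lemma toggle_to_one_orbit:
  assumes t: "t permutes {..<k} \<times> UNIV" and chain: "\<And>g. Suc g < k \<Longrightarrow> t (g, False) = (Suc g, False)"
  shows "\<exists>e\<subseteq>{..<k}. \<forall>x\<in>{..<k} \<times> UNIV. x \<in> orbit (t \<circ> toggle e) (0, False)"
proof -
  have perm: "permutation (t \<circ> toggle e)" if "e \<subseteq> {..<k}" for e
    using permutes_compose[OF toggle_permutes[OF that] t] permutes_imp_permutation
    by (metis finite_SigmaI finite finite_lessThan)
  \<comment> \<open>The switches are decided in order. The invariant includes the next hub segment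
    \<open>(m, False)\<close>, so the only question at \<open>m\<close> is whether its wire is
    already on the cycle. After toggling it is the wire that leads on to
    \<open>Suc m\<close>.\<close>
  have "\<exists>e\<subseteq>{..<m}. (\<forall>g<m. \<forall>c. (g, c) \<in> orbit (t \<circ> toggle e) (0, False)) \<and>
      (m < k \<longrightarrow> (m, False) \<in> orbit (t \<circ> toggle e) (0, False))" if "m \<le> k" for m
    using that
  proof (induction m)
    case 0
    have "(0, False) \<in> orbit (t \<circ> toggle {}) (0, False)"
      by (rule permutation_self_in_orbit[OF perm]) simp
    then show ?case by (intro exI[of _ "{}"] conjI impI allI) (fact | blast | simp)+
  next
    case (Suc m)
    from Suc.IH Suc.prems have "\<exists>e\<subseteq>{..<m}. (\<forall>g<m. \<forall>c. (g, c) \<in> orbit (t \<circ> toggle e) (0, False)) \<and>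
      (m < k \<longrightarrow> (m, False) \<in> orbit (t \<circ> toggle e) (0, False))" by (metis Suc_leD)
    moreover have mk: "m < k" using Suc.prems by simp
    ultimately obtain e where e: "e \<subseteq> {..<m}" "\<forall>g<m. \<forall>c. (g, c) \<in> orbit (t \<circ> toggle e) (0, False)"
      "(m, False) \<in> orbit (t \<circ> toggle e) (0, False)" by blast
    have ek: "e \<subseteq> {..<k}" "m \<notin> e" using e(1) Suc.prems by auto
    define f where "f = t \<circ> toggle e"
    show ?case
    proof (cases "(m, True) \<in> orbit f (m, False)")
      case True
      then have mT: "(m, True) \<in> orbit f (0, False)" using e(3) orbit_trans unfolding f_def by fast
      have "(Suc m, False) \<in> orbit f (0, False)" if "Suc m < k"
      proof -
        have "f (m, False) = (Suc m, False)" using ek(2) chain[OF that] by (simp add: f_def toggle_def)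
        then show ?thesis using orbit.step[OF e(3)[folded f_def]] by simp
      qed
      moreover have "(g, c) \<in> orbit f (0, False)" if "g < Suc m" for g c
        using that mT e(2,3) by (cases "g = m"; cases c) (auto simp: f_def)
      moreover have "e \<subseteq> {..<Suc m}" using e(1) by auto
      ultimately show ?thesis unfolding f_def by blast
    next
      case False
      define f' where "f' = f \<circ> Transposition.transpose (m, False) (m, True)"
      have f': "f' = t \<circ> toggle (insert m e)"
        unfolding f'_def f_def toggle_insert[OF ek(2)] by (simp only: comp_assoc)
      have mg: "(m, True) \<in> orbit f' (m, False)" "x \<in> orbit f y \<Longrightarrow> x \<in> orbit f' y" for x y
        using orbit_comp_transpose[OF perm[OF ek(1), folded f_def] False] unfolding f'_def by blast+
      have mF: "(m, False) \<in> orbit f' (0, False)" using mg(2) e(3) unfolding f_def by blast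
      then have mT: "(m, True) \<in> orbit f' (0, False)" using mg(1) orbit_trans by fast
      have "(Suc m, False) \<in> orbit f' (0, False)" if "Suc m < k"
      proof -
        have "f' (m, True) = (Suc m, False)" using chain[OF that] by (simp add: f' toggle_def)
        then show ?thesis using orbit.step[OF mT] by simp
      qed
      moreover have "(g, c) \<in> orbit f' (0, False)" if "g < Suc m" for g c
      proof (cases "g = m")
        case True
        then show ?thesis using mT mF by (cases c) auto
      next
        case False
        then show ?thesis using mg(2) e(2) that by (simp add: f_def)
      qed
      moreover have "insert m e \<subseteq> {..<Suc m}" using e(1) by auto
      ultimately show ?thesis unfolding f' by blast
    qed
  qed
  from this[of k] obtain e where "e \<subseteq> {..<k}" "\<forall>g<k. \<forall>c. (g, c) \<in> orbit (t \<circ> toggle e) (0, False)" by auto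
  then show ?thesis by (intro exI[of _ e]) auto
qed

lemma orbit_as_list:
  assumes "x \<in> orbit f x"
  obtains xs where "distinct xs" "xs \<noteq> []" "hd xs = x" "set xs = orbit f x"
    "successively (\<lambda>u v. v = f u) (xs @ [x])"
proof -
  define n where "n = funpow_dist1 f x x"
  define xs where "xs = map (\<lambda>i. (f ^^ i) x) [0..<n]"
  have n0: "0 < n" by (simp add: n_def)
  have fx: "(f ^^ n) x = x" unfolding n_def by (rule funpow_dist1_prop[OF assms])
  have "inj_on (\<lambda>i. (f ^^ i) x) {0..<n}" unfolding n_def by (rule inj_on_funpow_dist1[OF assms])
  then have "distinct xs" by (simp add: xs_def distinct_map)
  moreover have "xs \<noteq> []" "hd xs = x" using n0 by (auto simp: xs_def hd_map upt_rec[of 0 n])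
  moreover have "set xs = orbit f x" 
    unfolding xs_def n_def orbit_conv_funpow_dist1[OF assms] by (simp only: set_map set_upt)
  moreover have "xs @ [x] = map (\<lambda>i. (f ^^ i) x) [0..<Suc n]" using fx by (simp add: xs_def)
  then have "successively (\<lambda>u v. v = f u) (xs @ [x])"
    using fx by (auto simp: successively_conv_nth nth_append xs_def less_Suc_eq)
  ultimately show ?thesis by (rule that)
qed

context fin_graph
begin

lemma successively_concat_blocks:
  assumes "successively (\<lambda>x y. successively E (B x @ [hd (B y)])) (xs @ [z])" "xs \<noteq> []" "\<And>x. x \<in> set xs \<Longrightarrow> B x \<noteq> []"
  shows "successively E (concat (map B xs) @ [hd (B z)])"
  using assms
proof (induction xs)
  case (Cons x xs)
  show ?case
  proof (cases "xs = []")
    case True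
    then show ?thesis using Cons.prems by simp
  next
    case False
    then obtain y ys where xs: "xs = y # ys" by (cases xs) auto
    have "successively E (concat (map B xs) @ [hd (B z)])" using Cons xs by simp
    moreover have "successively E (B x @ [hd (B y)])" using Cons.prems(1) xs by simp
    moreover have "hd (concat (map B xs) @ [hd (B z)]) = hd (B y)" using Cons.prems(3)[of y] xs by simp
    ultimately show ?thesis
      using Cons.prems(3)[of x] xs by (auto simp: successively_append_iff)
  qed
qed simp

text \<open>\<open>L x\<close> fills the gap between the end of strand \<open>x\<close> and the
  start of strand \<open>t x\<close>. Toggled switches contribute their second cover, and the single
  orbit of \<open>t \<circ> toggle e\<close> lists all strands in cyclic order.\<close>

theorem switch_cycle:
  fixes L :: "nat \<times> bool \<Rightarrow> 'a list"
  assumes hub: "hub k p0 p1 q0 q1 S0" and k: "0 < k"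
    and t: "t permutes {..<k} \<times> UNIV" and chain: "\<And>g. Suc g < k \<Longrightarrow> t (g, False) = (Suc g, False)"
    and L: "\<And>x. x \<in> {..<k} \<times> UNIV \<Longrightarrow> distinct (L x) \<and> set (L x) \<inter> S0 = {} \<and>
      successively E (last (strand p0 p1 x) # L x @ [hd (strand p0 p1 (t x))])"
    and Ldisj: "\<And>x y. x \<in> {..<k} \<times> UNIV \<Longrightarrow> y \<in> {..<k} \<times> UNIV \<Longrightarrow> x \<noteq> y \<Longrightarrow> set (L x) \<inter> set (L y) = {}"
  shows "\<exists>zs. zs \<noteq> [] \<and> distinct zs \<and> set zs = S0 \<union> (\<Union>x\<in>{..<k} \<times> UNIV. set (L x)) \<and> successively E (zs @ [hd zs])"
proof -
  let ?D = "{..<k} \<times> (UNIV :: bool set)"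
  define w where "w = strand p0 p1"
  obtain e where e: "e \<subseteq> {..<k}" "\<forall>x\<in>?D. x \<in> orbit (t \<circ> toggle e) (0, False)"
    using toggle_to_one_orbit[OF t chain] by blast
  define f where "f = t \<circ> toggle e"
  have pf: "f permutes ?D" unfolding f_def by (rule permutes_compose[OF toggle_permutes[OF e(1)] t])
  have o: "(0, False) \<in> orbit f (0, False)" using e(2) k by (simp add: f_def)
  have "orbit f (0, False) \<subseteq> ?D" by (rule permutes_orbit_subset[OF pf]) (use k in simp)
  then have oD: "orbit f (0, False) = ?D" using e(2) by (auto simp: f_def)
  obtain xs where xs: "distinct xs" "xs \<noteq> []" "hd xs = (0, False)" "set xs = ?D"
    "successively (\<lambda>u v. v = f u) (xs @ [(0, False)])" using orbit_as_list[OF o] oD by metis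
  \<comment> \<open>A strand of a toggled switch keeps its start but ends where its partner did, so
    the gap after it is filled by \<open>L (toggle e x)\<close>.\<close>
  define v where "v = (\<lambda>x::nat \<times> bool. if fst x \<in> e then (if snd x then q1 (fst x) else q0 (fst x)) else w x)"
  define B where "B = (\<lambda>x. v x @ L (toggle e x))"
  have tog: "toggle e x \<in> ?D" if "x \<in> ?D" for x using that by (auto simp: toggle_def)
  have sw: "switch (p0 g) (p1 g) (q0 g) (q1 g)" if "g < k" for g using hub that by (simp add: hub_def)
  have v: "is_path (v x)" "hd (v x) = hd (w x)" "last (v x) = last (w (toggle e x))"
    "set (v x) \<subseteq> set (p0 (fst x)) \<union> set (p1 (fst x))" if "x \<in> ?D" for x
    using sw[of "fst x"] that by (auto simp: v_def w_def strand_def toggle_def switch_def)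
  have v_un: "set (v (g, False)) \<union> set (v (g, True)) = set (p0 g) \<union> set (p1 g)" 
    "set (v (g, False)) \<inter> set (v (g, True)) = {}" if "g < k" for g
    using sw[OF that] by (auto simp: v_def w_def strand_def switch_def)
  have S0: "S0 = (\<Union>g<k. set (p0 g) \<union> set (p1 g))" using hub by (simp add: hub_def)
  have vS0: "set (v x) \<subseteq> S0" if "x \<in> ?D" for x
  proof -
    have "fst x < k" using that by auto
    then show ?thesis using v(4)[OF that] unfolding S0 by blast
  qed
  have vdisj: "set (v x) \<inter> set (v y) = {}" if "x \<in> ?D" "y \<in> ?D" "x \<noteq> y" for x y
  proof (cases "fst x = fst y")
    case True
    then have "snd x \<noteq> snd y" using that(3) by (auto simp: prod_eq_iff)
    then have "(x = (fst x, False) \<and> y = (fst x, True)) \<or> (x = (fst x, True) \<and> y = (fst x, False))"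
      using True by (auto simp: prod_eq_iff)
    moreover have "fst x < k" using that(1) by auto
    ultimately show ?thesis using v_un(2)[of "fst x"] by (metis Int_commute)
  next
    case False
    have "fst x < k" "fst y < k" using that by auto
    then have "(set (p0 (fst x)) \<union> set (p1 (fst x))) \<inter> (set (p0 (fst y)) \<union> set (p1 (fst y))) = {}"
      using hub False by (simp add: hub_def)
    then show ?thesis using v(4)[OF that(1)] v(4)[OF that(2)] by blast
  qed
  have vne: "v x \<noteq> []" if "x \<in> ?D" for x using v(1)[OF that] by (simp add: is_path_def)
  have Bset: "set (B x) = set (v x) \<union> set (L (toggle e x))" for x by (simp add: B_def)
  have BL: "set (v x) \<inter> set (L y) = {}" if "x \<in> ?D" "y \<in> ?D" for x y
    using vS0[OF that(1)] L[OF that(2)] by blast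
  have Bd: "distinct (B x)" if "x \<in> ?D" for x
    using v(1)[OF that] L[OF tog[OF that]] BL[OF that tog[OF that]] by (simp add: B_def is_path_def)
  have Bdisj: "set (B x) \<inter> set (B y) = {}" if "x \<in> ?D" "y \<in> ?D" "x \<noteq> y" for x y
  proof -
    have "toggle e x \<noteq> toggle e y" using that(3) toggle_toggle by metis
    then have "set (L (toggle e x)) \<inter> set (L (toggle e y)) = {}" by (rule Ldisj[OF tog[OF that(1)] tog[OF that(2)]])
    moreover have "set (v x) \<inter> set (L (toggle e y)) = {}" "set (v y) \<inter> set (L (toggle e x)) = {}"
      using BL that tog by blast+
    ultimately show ?thesis using vdisj[OF that] unfolding Bset by blast
  qed
  have Bhd: "hd (B x) = hd (w x)" if "x \<in> ?D" for x using v(2)[OF that] vne[OF that] by (simp add: B_def)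
  have Bsucc: "successively E (B x @ [hd (B (f x))])" if "x \<in> ?D" for x
  proof -
    have fx: "f x \<in> ?D" using permutes_in_image[OF pf] that by blast
    have "successively E (last (v x) # L (toggle e x) @ [hd (B (f x))])"
      using L[OF tog[OF that]] unfolding Bhd[OF fx] v(3)[OF that] by (simp add: f_def w_def)
    moreover have "successively E (v x)" using v(1)[OF that] by (simp add: is_path_def)
    ultimately show ?thesis using vne[OF that] by (simp add: B_def successively_append_iff successively_Cons)
  qed
  define zs where "zs = concat (map B xs)"
  have Bne: "B x \<noteq> []" if "x \<in> ?D" for x using vne[OF that] by (simp add: B_def)
  have hdzs: "hd zs = hd (B (0, False))" using xs(2,3) Bne[of "(0, False)"] k
    by (cases xs) (auto simp: zs_def)
  have "successively (\<lambda>x y. successively E (B x @ [hd (B y)])) (xs @ [(0, False)])"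
    by (rule successively_mono[OF xs(5)]) (use Bsucc xs(4) k in auto)
  then have sz: "successively E (zs @ [hd zs])" unfolding zs_def hdzs[unfolded zs_def]
    by (rule successively_concat_blocks) (use xs(2,4) Bne in auto)
  have "hd xs \<in> set xs" using xs(2) by simp
  then have ne: "zs \<noteq> []" using Bne[of "hd xs"] xs(4) by (auto simp: zs_def)
  have dz: "distinct zs"
    unfolding zs_def
  proof (rule distinct_concat)
    show "distinct (map B xs)"
      unfolding distinct_map
    proof (intro conjI inj_onI)
      fix x y assume "x \<in> set xs" "y \<in> set xs" "B x = B y"
      then have "x \<in> ?D" "y \<in> ?D" "set (B x) \<inter> set (B y) \<noteq> {}" using Bne[of x] xs(4) by auto
      then show "x = y" using Bdisj by blast
    qed (rule xs(1))
    show "distinct ys" if "ys \<in> set (map B xs)" for ys using that Bd xs(4) by auto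
    fix ys ys' assume "ys \<in> set (map B xs)" "ys' \<in> set (map B xs)" "ys \<noteq> ys'"
    then obtain x y where "x \<in> ?D" "y \<in> ?D" "ys = B x" "ys' = B y" "x \<noteq> y" unfolding set_map xs(4) by blast
    then show "set ys \<inter> set ys' = {}" using Bdisj by blast
  qed
  have "(\<Union>x\<in>?D. set (v x)) = S0"
  proof -
    have "(\<Union>x\<in>?D. set (v x)) = (\<Union>g<k. set (v (g, False)) \<union> set (v (g, True)))"
      by (auto simp: UNIV_bool)
    then show ?thesis unfolding S0 using v_un(1) by simp
  qed
  moreover have im: "toggle e ` ?D = ?D" by (rule permutes_image[OF toggle_permutes[OF e(1)]])
  have "(\<Union>x\<in>?D. set (L (toggle e x))) = (\<Union>x\<in>toggle e ` ?D. set (L x))" by blast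
  then have "(\<Union>x\<in>?D. set (L (toggle e x))) = (\<Union>x\<in>?D. set (L x))" unfolding im .
  ultimately have "set zs = S0 \<union> (\<Union>x\<in>?D. set (L x))"
    unfolding zs_def set_concat set_map xs(4) image_image Bset UN_Un_distrib by simp
  then show ?thesis using ne dz sz by blast
qed

end

section \<open>Assembling a Hamilton cycle\<close>

context joined_graph
begin

text \<open>As \<open>A\<close> and \<open>B\<close> are disjoint, whatever bijection the linker
  returns glues each path of \<open>A\<close> to one of \<open>B\<close> and closes no cycle; here
  the lack of control does no harm.\<close>

lemma join_paths:
  assumes lk: "linker Q a b" and P: "paths P" "verts P \<subseteq> V" "verts P \<inter> Q = {}"
    and A: "A \<subseteq> P" and B: "B \<subseteq> P" and AB: "A \<inter> B = {}" "card A = card B"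
    and a: "a \<in> last ` A" and b: "b \<in> hd ` B"
  obtains R where "paths ((P - A - B) \<union> (\<lambda>u. u @ R u) ` A)"
    "verts ((P - A - B) \<union> (\<lambda>u. u @ R u) ` A) = verts P \<union> Q"
    "card ((P - A - B) \<union> (\<lambda>u. u @ R u) ` A) + card A = card P"
proof -
  have finP: "finite P" using P(1) by (simp add: paths_def)
  then have fin: "finite A" "finite B" using A B by (auto intro: finite_subset)
  have injA: "inj_on last A" and injB: "inj_on hd B"
    using inj_on_last_paths inj_on_hd_paths P(1) A B inj_on_subset by blast+
  have hl: "hd u \<in> set u" "last u \<in> set u" if "u \<in> P" for u using paths_nonempty[OF P(1) that] by auto
  have lA: "last ` A \<subseteq> verts P" and hB: "hd ` B \<subseteq> verts P" using hl A B by blast+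
  have S: "last ` A \<subseteq> V" "hd ` B \<subseteq> V" "last ` A \<inter> Q = {}" "hd ` B \<inter> Q = {}" using lA hB P by blast+
  have c: "card (last ` A) = card (hd ` B)" using card_image[OF injA] card_image[OF injB] AB(2) by simp
  from lk[unfolded linker_def, rule_format, OF S(1,2) a b c S(3,4)]
obtain h I where h: "bij_betw h (last ` A) (hd ` B)"
    and I: "\<forall>s\<in>last ` A. distinct (I s) \<and> successively E (s # I s @ [h s])"
      "\<forall>s\<in>last ` A. \<forall>s'\<in>last ` A. s \<noteq> s' \<longrightarrow> set (I s) \<inter> set (I s') = {}"
      "(\<Union>s\<in>last ` A. set (I s)) = Q" by (elim exE conjE) (rule that)
  define f where "f = (\<lambda>u. inv_into B hd (h (last u)))"
  have bf: "bij_betw f A B"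
  proof -
    have 1: "bij_betw last A (last ` A)" using injA by (rule inj_on_imp_bij_betw)
    have 2: "bij_betw (inv_into B hd) (hd ` B) B"
      by (rule bij_betw_inv_into[OF inj_on_imp_bij_betw[OF injB]])
    show ?thesis using bij_betw_trans[OF bij_betw_trans[OF 1 h] 2] by (simp add: f_def comp_def)
  qed
  have fB: "f u \<in> B" "hd (f u) = h (last u)" if "u \<in> A" for u
  proof -
    have "h (last u) \<in> hd ` B" using h that by (auto simp: bij_betw_def)
    then show "hd (f u) = h (last u)" unfolding f_def by (rule f_inv_into_f)
    show "f u \<in> B" using bf that by (auto simp: bij_betw_def)
  qed
  define R where "R = (\<lambda>u. I (last u) @ f u)"
  define N where "N = (\<lambda>u. u @ R u)"
  have Iu: "distinct (I (last u))" "successively E (last u # I (last u) @ [hd (f u)])" "set (I (last u)) \<subseteq> Q"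
    if "u \<in> A" for u using I(1,3) that fB(2)[OF that] by auto
  have setN: "set (N u) = set u \<union> set (I (last u)) \<union> set (f u)" for u by (auto simp: N_def R_def)
  have dP: "set u \<inter> set v = {}" if "u \<in> P" "v \<in> P" "u \<noteq> v" for u v using P(1) that by (simp add: paths_def)
  have QP: "set u \<inter> Q = {}" if "u \<in> P" for u using P(3) that by blast
  have AP: "u \<in> P" "f u \<in> P" "u \<noteq> f u" if "u \<in> A" for u using that fB(1)[OF that] A B AB(1) by auto
  have Npath: "is_path (N u)" if u: "u \<in> A" for u
  proof -
    have p: "is_path u" "is_path (f u)" using P(1) AP[OF u] by (auto simp: paths_def)
    have d: "set u \<inter> set (f u) = {}" by (rule dP[OF AP[OF u]])
    have dI: "set u \<inter> set (I (last u)) = {}" "set (f u) \<inter> set (I (last u)) = {}"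
      using QP AP(1,2)[OF u] Iu(3)[OF u] by blast+
    have "hd (I (last u) @ f u) = hd (I (last u) @ [hd (f u)])" by (cases "I (last u)") auto
    then show ?thesis unfolding N_def R_def using p d dI Iu[OF u]
      by (auto simp: is_path_def successively_append_iff successively_Cons)
  qed
  have Ndisj: "set (N u) \<inter> set (N v) = {}" if uv: "u \<in> A" "v \<in> A" "u \<noteq> v" for u v
  proof -
    have "f u \<noteq> f v" using bf uv by (auto simp: bij_betw_def inj_on_def)
    moreover have "u \<noteq> f v" "f u \<noteq> v" using fB(1) uv AB(1) by blast+
    ultimately have 1: "set u \<inter> set v = {}" "set u \<inter> set (f v) = {}" "set (f u) \<inter> set v = {}"
      "set (f u) \<inter> set (f v) = {}" using dP AP(1,2) uv by simp_all
    have "last u \<noteq> last v" using injA uv by (auto simp: inj_on_def)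
    then have 2: "set (I (last u)) \<inter> set (I (last v)) = {}" using I(2) uv by simp
    have 3: "set u \<inter> set (I (last v)) = {}" "set (f u) \<inter> set (I (last v)) = {}"
       "set v \<inter> set (I (last u)) = {}" "set (f v) \<inter> set (I (last u)) = {}"
      using QP AP(1,2) Iu(3) uv by (meson disjoint_iff subsetD)+
    show ?thesis unfolding setN using 1 2 3 by blast
  qed
  have Nrest: "set (N u) \<inter> set w = {}" if u: "u \<in> A" and w: "w \<in> P - A - B" for u w
  proof -
    have "u \<noteq> w" "f u \<noteq> w" using u w fB(1)[OF u] by auto
    then have 1: "set u \<inter> set w = {}" "set (f u) \<inter> set w = {}" using dP AP[OF u] w by auto
    have "set (I (last u)) \<inter> set w = {}" using QP[of w] Iu(3)[OF u] w by blast
    then show ?thesis unfolding setN using 1 by blast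
  qed
  let ?P = "(P - A - B) \<union> N ` A"
  have "paths ?P"
    unfolding paths_def
  proof (intro conjI ballI impI)
    show "finite ?P" using finP fin by simp
    show "is_path u" if "u \<in> ?P" for u using that Npath P(1) by (auto simp: paths_def)
    fix u v assume "u \<in> ?P" "v \<in> ?P" "u \<noteq> v"
    then consider "u \<in> P" "v \<in> P" | u' where "u' \<in> A" "u = N u'" "v \<in> P - A - B"
      | v' where "v' \<in> A" "v = N v'" "u \<in> P - A - B"
      | u' v' where "u' \<in> A" "u = N u'" "v' \<in> A" "v = N v'" "u' \<noteq> v'" by blast
    then show "set u \<inter> set v = {}"
    proof cases
      case 1
      then show ?thesis using dP \<open>u \<noteq> v\<close> by blast
    next
      case 2
      then show ?thesis using Nrest by blast
    next
      case 3
      then show ?thesis using Nrest by blast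
    next
      case 4
      then show ?thesis using Ndisj by blast
    qed
  qed
  moreover have "verts ?P = verts P \<union> Q"
  proof -
    have "f ` A = B" using bf by (simp add: bij_betw_def)
    then have "verts (N ` A) = verts A \<union> Q \<union> verts B"
      using I(3) by (simp add: setN image_image UN_Un_distrib flip: image_Union) blast
    moreover have "verts P = verts (P - A - B) \<union> verts A \<union> verts B" using A B by blast
    ultimately show ?thesis by (simp only: image_Un Union_Un_distrib Un_ac)
  qed
  moreover have "card ?P + card A = card P"
  proof -
    have Nne: "N u \<noteq> []" if "u \<in> A" for u using Npath[OF that] by (simp add: is_path_def)
    have "inj_on N A"
    proof (rule inj_onI)
      fix u v assume "u \<in> A" "v \<in> A" "N u = N v"
      then show "u = v" using Ndisj[of u v] Nne[of u] by auto
    qed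
    moreover have "N ` A \<inter> (P - A - B) = {}" using Nrest Nne by fastforce
    moreover have "card (P - A - B) + card A + card B = card P"
    proof -
      have "card (P - A) = card P - card A" "card A \<le> card P" using A fin finP by (simp_all add: card_Diff_subset card_mono)
      moreover have "B \<subseteq> P - A" using B AB(1) by blast
      then have "card (P - A - B) = card (P - A) - card B" "card B \<le> card (P - A)"
        using fin finP by (simp_all add: card_Diff_subset card_mono)
      ultimately show ?thesis by simp
    qed
    ultimately show ?thesis using AB(2) finP fin card_image[of N A]
      by (subst card_Un_disjoint) auto
  qed
  ultimately show ?thesis using that[of R] unfolding N_def by blast
qed

end

context absorbing_partition
begin

lemma region_V: "i < p \<Longrightarrow> region i \<subseteq> V"
  using cover by blast

text \<open>The stubs of linker \<open>i\<close> join the pool as the one-vertex paths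
  \<open>[a i]\<close> and \<open>[b i]\<close>, so \<open>m\<close> paths become
  \<open>m + 1 - m div 2\<close>. This map fixes 3, and for larger pools the excess over 3 is at
  least halved in each round.\<close>

lemma absorb_pool:
  assumes "r + 2 \<le> p"
  shows "\<exists>P'. paths P' \<and> verts P' = verts P \<union> (\<Union>i\<in>{2..<r + 2}. region i) \<and> (card P' - 3) * 2 ^ r \<le> \<mu>"
  using assms
proof (induction r)
  case 0
  have "card P - 3 \<le> \<mu>" using P(2) by simp
  then show ?case using P(1) by (intro exI[of _ P]) simp
next
  case (Suc r)
  then obtain P' where P': "paths P'" "verts P' = verts P \<union> (\<Union>i\<in>{2..<r + 2}. region i)" "(card P' - 3) * 2 ^ r \<le> \<mu>"
    by auto
  define i where "i = r + 2"
  have i: "2 \<le> i" "i < p" using Suc.prems by (auto simp: i_def)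
  have reg: "region i = Q i \<union> {a i, b i}" using i by (simp add: region_def)
  have abi: "a i \<noteq> b i" "a i \<notin> Q i" "b i \<notin> Q i" using ab[OF i] by auto
  have disj: "verts P' \<inter> region i = {}"
  proof -
    have "region i' \<inter> region i = {}" if "i' \<in> {2..<r + 2}" for i'
      using region_disjoint[of i' i] i that by (auto simp: i_def)
    then show ?thesis unfolding P'(2) using P_region[OF i(2)] by blast
  qed
  have finP': "finite P'" using P'(1) by (simp add: paths_def)
  define q where "q = card P' div 2"
  obtain A0 where A0: "A0 \<subseteq> P'" "card A0 = q" using obtain_subset_with_card_n[of q P'] by (auto simp: q_def)
  have finA0: "finite A0" using A0(1) finP' by (rule finite_subset)
  have "q \<le> card (P' - A0)" using A0 finA0 by (simp add: card_Diff_subset q_def)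
  then obtain B0 where B0: "B0 \<subseteq> P' - A0" "card B0 = q" using obtain_subset_with_card_n by blast
  have finB0: "finite B0" using B0(1) finP' by (meson finite_Diff finite_subset)
  define P1 where "P1 = insert [a i] (insert [b i] P')"
  have nin: "[a i] \<notin> P'" "[b i] \<notin> P'" using disj unfolding reg by auto
  have "paths (insert [b i] P')"
    by (rule paths_insert[OF P'(1)]) (use disj in \<open>auto simp: reg is_path_def\<close>)
  then have P1: "paths P1" unfolding P1_def
    by (rule paths_insert) (use disj abi in \<open>auto simp: reg is_path_def\<close>)
  have v1: "verts P1 = verts P' \<union> {a i, b i}" by (auto simp: P1_def)
  have P'V: "verts P' \<subseteq> V" unfolding P'(2) using cover region_V i by (auto simp: i_def)
  have v1V: "verts P1 \<subseteq> V" "verts P1 \<inter> Q i = {}"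
    unfolding v1 using P'V region_V[OF i(2)] disj abi unfolding reg by auto
  define A where "A = insert [a i] A0"
  define B where "B = insert [b i] B0"
  have AB: "A \<subseteq> P1" "B \<subseteq> P1" "A \<inter> B = {}"
    using A0 B0 nin abi(1) by (auto simp: A_def B_def P1_def)
  have ninAB: "[a i] \<notin> A0" "[b i] \<notin> B0" using nin A0(1) B0(1) by blast+
  have cA: "card A = Suc q" "card B = Suc q" using ninAB finA0 finB0 A0(2) B0(2) by (simp_all add: A_def B_def)
  have "a i \<in> last ` A" "b i \<in> hd ` B" by (simp_all add: A_def B_def)
  from join_paths[OF linker[OF i(2)] P1 v1V AB _ this] cA
  obtain R where R: "paths ((P1 - A - B) \<union> (\<lambda>u. u @ R u) ` A)"
    "verts ((P1 - A - B) \<union> (\<lambda>u. u @ R u) ` A) = verts P1 \<union> Q i"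
    "card ((P1 - A - B) \<union> (\<lambda>u. u @ R u) ` A) + card A = card P1" by auto
  define P2 where "P2 = (P1 - A - B) \<union> (\<lambda>u. u @ R u) ` A"
  have "card P1 = card P' + 2" using nin finP' abi(1) by (simp add: P1_def)
  then have c2: "card P2 = card P' + 1 - card P' div 2" using R(3) cA unfolding P2_def[symmetric] q_def by linarith
  have "(card P2 - 3) * 2 \<le> card P' - 3" using c2 by linarith
  then have "(card P2 - 3) * 2 * 2 ^ r \<le> (card P' - 3) * 2 ^ r" by (rule mult_le_mono1)
  then have "(card P2 - 3) * 2 * 2 ^ r \<le> \<mu>" using P'(3) by (rule le_trans)
  then have "(card P2 - 3) * 2 ^ Suc r \<le> \<mu>" by (simp add: mult.assoc)
  moreover have "verts P2 = verts P \<union> (\<Union>i\<in>{2..<Suc r + 2}. region i)"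
  proof -
    have "{2..<Suc r + 2} = insert i {2..<r + 2}" by (auto simp: i_def)
    then show ?thesis using R(2) P'(2) unfolding P2_def[symmetric] v1 by (simp add: reg) blast
  qed
  ultimately show ?case using R(1) unfolding P2_def[symmetric] by blast
qed

text \<open>Wire 0 stays bare for the closing linker, whose stubs are its two ends. The reduced pool
  and the one-vertex path \<open>[b 1]\<close> are hung on wires 1, 2 and so on; wire 1 must be
  among them because its end is the stub \<open>a 1\<close>. The \<open>k - 4\<close> in
  \<open>kP\<close> balances the 3 of \<open>absorb_pool\<close> so that the remaining
  \<open>k - 1\<close> wires suffice.\<close>

lemma attach_pool:
  assumes kP: "\<mu> < 2 ^ (p - 2) * (k - 4)"
  shows "\<exists>R. R 0 = [] \<and> (\<forall>g<k. is_path (p1 g @ R g) \<and> set (R g) \<inter> S0 = {}) \<and>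
    (\<forall>g<k. \<forall>g'<k. g \<noteq> g' \<longrightarrow> set (R g) \<inter> set (R g') = {}) \<and>
    (\<Union>g<k. set (R g)) = verts P \<union> (\<Union>i\<in>{1..<p}. region i)"
proof -
  have "p - 2 + 2 \<le> p" using p2 by simp
  from absorb_pool[OF this] obtain P' where P': "paths P'" "verts P' = verts P \<union> (\<Union>i\<in>{2..<p}. region i)"
    "(card P' - 3) * 2 ^ (p - 2) \<le> \<mu>"
    unfolding le_add_diff_inverse2[OF p2] by blast
  have "(card P' - 3) * 2 ^ (p - 2) < (k - 4) * 2 ^ (p - 2)" 
    using le_less_trans[OF P'(3) kP] by (simp only: mult.commute)
  then have "card P' - 3 < k - 4" by simp
  then have ck: "card P' + 2 \<le> k" by linarith
  have finP': "finite P'" using P'(1) by (simp add: paths_def)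
  have p1: "1 < p" using p2 by simp
  have reg: "region 1 = insert (b 1) (Q 1)" by (simp add: region_def)
  have disj: "verts P' \<inter> region 1 = {}"
  proof -
    have "region i' \<inter> region 1 = {}" if "i' \<in> {2..<p}" for i' using region_disjoint[of i' 1] that by auto
    then show ?thesis unfolding P'(2) using P_region[OF p1] by blast
  qed
  have P'V: "verts P' \<subseteq> V" unfolding P'(2) using cover region_V by auto
  have P'S: "verts P' \<inter> S0 = {}" unfolding P'(2) using hub_P hub_region by (auto simp: disjoint_iff)
  have sw: "switch (p0 g) (p1 g) (q0 g) (q1 g)" if "g < k" for g using hub that by (simp add: hub_def)
  have wp: "is_path (p1 g)" "set (p1 g) \<subseteq> S0" if "g < k" for g
    using sw[OF that] hub that by (auto simp: hub_def switch_def)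
  have wd: "set (p1 g) \<inter> set (p1 g') = {}" if "g < k" "g' < k" "g \<noteq> g'" for g g'
  proof -
    have "(set (p0 g) \<union> set (p1 g)) \<inter> (set (p0 g') \<union> set (p1 g')) = {}" using hub that by (simp add: hub_def)
    then show ?thesis by blast
  qed
  have winj: "inj_on p1 {1..<k}"
  proof (rule inj_onI)
    fix g g' assume "g \<in> {1..<k}" "g' \<in> {1..<k}" "p1 g = p1 g'"
    then show "g = g'" using wd[of g g'] wp(1)[of g] by (auto simp: is_path_def)
  qed
  define W where "W = p1 ` {1..<k}"
  define B where "B = insert [b 1] P'"
  have b1P: "b 1 \<notin> verts P'" using disj unfolding reg by blast
  have B: "paths B" unfolding B_def
    by (rule paths_insert[OF P'(1)]) (use b1P in \<open>auto simp: is_path_def\<close>)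
  have vB: "verts B = insert (b 1) (verts P')" by (auto simp: B_def)
  have b1S: "b 1 \<notin> S0" using hub_region[OF p1] reg by auto
  have vW: "verts W \<subseteq> S0" unfolding W_def using wp(2) by fastforce
  have BW: "verts B \<inter> verts W = {}" using vW P'S b1S unfolding vB by blast
  have W: "paths W"
    unfolding paths_def W_def
  proof (intro conjI ballI impI)
    show "is_path u" if "u \<in> p1 ` {1..<k}" for u using that wp(1) by auto
    fix u v assume "u \<in> p1 ` {1..<k}" "v \<in> p1 ` {1..<k}" "u \<noteq> v"
    then obtain g g' where g: "u = p1 g" "v = p1 g'" "g < k" "g' < k" by auto
    then have "g \<noteq> g'" using \<open>u \<noteq> v\<close> by blast
    with g show "set u \<inter> set v = {}" using wd by simp
  qed simp
  have neB: "u \<noteq> []" if "u \<in> B \<union> W" for u using paths_nonempty[OF B] paths_nonempty[OF W] that by blast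
  have BWd: "B \<inter> W = {}"
  proof (rule ccontr)
    assume "B \<inter> W \<noteq> {}"
    then obtain u where "u \<in> B" "u \<in> W" by blast
    moreover from this have "hd u \<in> set u" using neB by simp
    ultimately have "hd u \<in> verts B" "hd u \<in> verts W" by blast+
    then show False using BW by blast
  qed
  have BWs: "set u \<inter> set v = {}" "set v \<inter> set u = {}" if "u \<in> B" "v \<in> W" for u v using BW that by blast+
  have BWp: "paths (W \<union> B)"
    unfolding paths_def
  proof (intro conjI ballI impI)
    show "finite (W \<union> B)" using B W by (simp add: paths_def)
    show "is_path u" if "u \<in> W \<union> B" for u using B W that by (auto simp: paths_def)
    fix u v assume "u \<in> W \<union> B" "v \<in> W \<union> B" "u \<noteq> v"
    then consider "u \<in> W" "v \<in> W" | "u \<in> B" "v \<in> B" | "u \<in> B" "v \<in> W" | "u \<in> W" "v \<in> B" by blast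
    then show "set u \<inter> set v = {}"
      by cases (use W B BWs \<open>u \<noteq> v\<close> in \<open>simp_all add: paths_def\<close>)
  qed
  have S0V: "S0 \<subseteq> V" using cover by blast
  have vV: "verts (W \<union> B) \<subseteq> V" using vW S0V P'V region_V[OF p1] reg by (auto simp: vB)
  have vQ: "verts (W \<union> B) \<inter> Q 1 = {}"
    using vW hub_region[OF p1] disj b1 unfolding reg by (auto simp: vB)
  have nb: "[b 1] \<notin> P'" using b1P by auto
  have cB: "card B = Suc (card P')" using nb finP' by (simp add: B_def)
  define G where "G = {1..card B}"
  have G: "G \<subseteq> {1..<k}" "1 \<in> G" "0 \<notin> G" "card G = card B" using ck cB by (auto simp: G_def)
  define A where "A = p1 ` G"
  have AW: "A \<subseteq> W" using G by (auto simp: A_def W_def)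
  have cA: "card A = card B" unfolding A_def using card_image[OF inj_on_subset[OF winj G(1)]] G(4) by simp
  have la: "a 1 \<in> last ` A" unfolding a1 A_def using G(2) by blast
  have hb: "b 1 \<in> hd ` B" by (simp add: B_def)
  have AB: "A \<subseteq> W \<union> B" "B \<subseteq> W \<union> B" "A \<inter> B = {}" using AW BWd by blast+
  obtain R where R: "paths ((W \<union> B - A - B) \<union> (\<lambda>u. u @ R u) ` A)"
    "verts ((W \<union> B - A - B) \<union> (\<lambda>u. u @ R u) ` A) = verts (W \<union> B) \<union> Q 1"
    "card ((W \<union> B - A - B) \<union> (\<lambda>u. u @ R u) ` A) + card A = card (W \<union> B)"
    by (rule join_paths[OF linker[OF p1] BWp vV vQ AB cA la hb])
  have WA: "W \<union> B - A - B = W - A" using BWd by blast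
  define r where "r = (\<lambda>g. if g \<in> G then R (p1 g) else [])"
  define C where "C = (\<lambda>g. p1 g @ r g)"
  have CW: "(W - A) \<union> (\<lambda>u. u @ R u) ` A = C ` {1..<k}"
  proof -
    have "W - A = p1 ` ({1..<k} - G)" unfolding W_def A_def using inj_on_image_set_diff[OF winj, of "{1..<k}" G] G(1) by simp
    moreover have "(\<lambda>u. u @ R u) ` A = C ` G" by (auto simp: A_def C_def r_def)
    moreover have "p1 ` ({1..<k} - G) = C ` ({1..<k} - G)" by (auto simp: C_def r_def)
    moreover have "{1..<k} = ({1..<k} - G) \<union> G" using G(1) by blast
    ultimately show ?thesis by (metis image_Un)
  qed
  have pC: "paths (C ` {1..<k})" and vC: "verts (C ` {1..<k}) = verts W \<union> verts B \<union> Q 1"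
    using R(1,2) unfolding WA CW by auto
  have p1C: "set (p1 g) \<subseteq> set (C g)" "set (r g) \<subseteq> set (C g)" for g by (auto simp: C_def)
  have Cd: "set (C g) \<inter> set (C g') = {}" if g: "g \<in> {1..<k}" "g' \<in> {1..<k}" "g \<noteq> g'" for g g'
  proof -
    have "C g \<noteq> C g'"
    proof
      assume eq: "C g = C g'"
      have h: "hd (p1 g) \<in> set (p1 g)" "hd (p1 g') \<in> set (p1 g')" using wp(1) g by (auto simp: is_path_def)
      moreover have "hd (C g) = hd (p1 g)" "hd (C g') = hd (p1 g')" using wp(1) g by (auto simp: C_def is_path_def)
      ultimately show False using wd[of g g'] g eq by auto
    qed
    then show ?thesis using pC g unfolding paths_def by blast
  qed
  have dC: "set (p1 g) \<inter> set (r g) = {}" if "g \<in> {1..<k}" for g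
  proof -
    have "is_path (C g)" using pC that by (simp add: paths_def)
    then show ?thesis by (auto simp: C_def is_path_def)
  qed
  have rW: "set (r g) \<inter> verts W = {}" if g: "g \<in> {1..<k}" for g
  proof -
    have "set (r g) \<inter> set (p1 g') = {}" if g': "g' \<in> {1..<k}" for g'
    proof (cases "g = g'")
      case True
      then show ?thesis using dC g by blast
    next
      case False
      then show ?thesis using Cd[OF g g'] p1C by blast
    qed
    then show ?thesis unfolding W_def by blast
  qed
  have r0: "r 0 = []" using G(3) by (simp add: r_def)
  have un: "(\<Union>g<k. set (r g)) = verts B \<union> Q 1"
  proof -
    have "{..<k} = insert 0 {1..<k}" using k2 by auto
    then have e: "(\<Union>g<k. set (r g)) = (\<Union>g\<in>{1..<k}. set (r g))" using r0 by simp
    have c: "verts (C ` {1..<k}) = verts W \<union> (\<Union>g\<in>{1..<k}. set (r g))" unfolding W_def C_def by auto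
    have 1: "(\<Union>g\<in>{1..<k}. set (r g)) \<inter> verts W = {}" using rW by blast
    have 2: "Q 1 \<inter> verts W = {}" using vQ by blast
    have "U = X \<union> Z" if "T \<union> U = T \<union> X \<union> Z" "U \<inter> T = {}" "Z \<inter> T = {}" "X \<inter> T = {}" for U T X Z :: "'a set"
      using that by blast
    from this[OF vC[unfolded c] 1 2 BW] show ?thesis unfolding e .
  qed
  have rS: "set (r g) \<inter> S0 = {}" if "g < k" for g
  proof -
    have "set (r g) \<subseteq> verts B \<union> Q 1" using un that by blast
    moreover have "verts B \<inter> S0 = {}" using P'S b1S unfolding vB by blast
    moreover have "Q 1 \<inter> S0 = {}" using hub_region[OF p1] reg by blast
    ultimately show ?thesis by blast
  qed
  have "verts B \<union> Q 1 = verts P \<union> (\<Union>i\<in>{1..<p}. region i)"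
  proof -
    have "{1..<p} = insert 1 {2..<p}" using p1 by auto
    then show ?thesis unfolding vB P'(2) using reg by auto
  qed
  moreover have "is_path (p1 g @ r g)" if "g < k" for g
  proof (cases "g = 0")
    case True
    then show ?thesis using wp(1)[OF that] r0 by simp
  next
    case False
    then show ?thesis using pC that by (auto simp: paths_def C_def)
  qed
  moreover have "set (r g) \<inter> set (r g') = {}" if "g < k" "g' < k" "g \<noteq> g'" for g g'
  proof -
    have "set (r g) \<inter> set (r g') = {}" if "g \<noteq> 0" "g' \<noteq> 0"
    proof -
      have "g \<in> {1..<k}" "g' \<in> {1..<k}" using that \<open>g < k\<close> \<open>g' < k\<close> by auto
      from Cd[OF this \<open>g \<noteq> g'\<close>] show ?thesis using p1C[of g] p1C[of g'] by blast
    qed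
    then show ?thesis using r0 by (cases "g = 0"; cases "g' = 0") auto
  qed
  ultimately show ?thesis using r0 rS un by (intro exI[of _ r]) simp
qed

text \<open>The open positions are the end and the start of the hub and the ends and starts of the
  \<open>k\<close> extended wires. The last linker joins ends to starts by an arbitrary bijection,
  which together with the hub chain is a permutation of the strands; \<open>switch_cycle\<close>
  turns it into one cycle.\<close>

theorem hamilton_cycle:
  assumes kP: "\<mu> < 2 ^ (p - 2) * (k - 4)"
  shows "\<exists>zs. zs \<noteq> [] \<and> distinct zs \<and> set zs = V \<and> successively E (zs @ [hd zs])"
proof -
  from attach_pool[OF kP] obtain R where R: "R 0 = []" "\<forall>g<k. is_path (p1 g @ R g) \<and> set (R g) \<inter> S0 = {}"
    "\<forall>g<k. \<forall>g'<k. g \<noteq> g' \<longrightarrow> set (R g) \<inter> set (R g') = {}"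
    "(\<Union>g<k. set (R g)) = verts P \<union> (\<Union>i\<in>{1..<p}. region i)" by (elim exE conjE) (rule that)
  let ?D = "{..<k} \<times> (UNIV :: bool set)"
  have k0: "0 < k" using k2 by simp
  have sw: "switch (p0 g) (p1 g) (q0 g) (q1 g)" if "g < k" for g using hub that by (simp add: hub_def)
  have S0: "S0 = (\<Union>g<k. set (p0 g) \<union> set (p1 g))" using hub by (simp add: hub_def)
  have hubd: "(set (p0 g) \<union> set (p1 g)) \<inter> (set (p0 g') \<union> set (p1 g')) = {}" if "g < k" "g' < k" "g \<noteq> g'" for g g'
    using hub that by (simp add: hub_def)
  define w where "w = (strand p0 p1 :: nat \<times> bool \<Rightarrow> 'a list)"
  have wS: "set (w x) \<subseteq> S0" and wne: "w x \<noteq> []" if "x \<in> ?D" for x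
    using sw[of "fst x"] that by (auto simp: w_def strand_def S0 switch_def is_path_def)
  have wd: "set (w x) \<inter> set (w y) = {}" if "x \<in> ?D" "y \<in> ?D" "x \<noteq> y" for x y
  proof (cases "fst x = fst y")
    case True
    then have "snd x \<noteq> snd y" using that(3) by (auto simp: prod_eq_iff)
    then show ?thesis using sw[of "fst y"] that(2) True by (cases "snd x") (auto simp: w_def strand_def switch_def)
  next
    case False
    then show ?thesis using hubd[of "fst x" "fst y"] that by (auto simp: w_def strand_def)
  qed
  define ends where "ends = insert (k - 1, False) ({..<k} \<times> {True})"
  define starts where "starts = insert (0, False) ({..<k} \<times> {True})"
  define M where "M = (\<lambda>x::nat \<times> bool. if snd x then R (fst x) else [])"
  define en where "en = (\<lambda>x. last (w x @ M x))"
  define st where "st = (\<lambda>x. hd (w x))"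
  have sub: "ends \<subseteq> ?D" "starts \<subseteq> ?D" using k0 by (auto simp: ends_def starts_def)
  have MS: "set (M x) \<inter> S0 = {}" if "x \<in> ?D" for x
  proof -
    have "fst x < k" using that by auto
    then show ?thesis using R(2) by (auto simp: M_def)
  qed
  have Md: "set (M x) \<inter> set (M y) = {}" if "x \<in> ?D" "y \<in> ?D" "x \<noteq> y" for x y
  proof (cases "snd x \<and> snd y")
    case True
    then have "fst x \<noteq> fst y" using that(3) by (auto simp: prod_eq_iff)
    moreover have "fst x < k" "fst y < k" using that by auto
    ultimately have "set (R (fst x)) \<inter> set (R (fst y)) = {}" using R(3) by blast
    then show ?thesis using True by (simp add: M_def)
  qed (auto simp: M_def)
  have wM: "set (w x @ M x) \<inter> set (w y @ M y) = {}" if "x \<in> ?D" "y \<in> ?D" "x \<noteq> y" for x y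
    using wd[OF that] Md[OF that] wS[OF that(1)] wS[OF that(2)] MS[OF that(1)] MS[OF that(2)] by auto
  have wMp: "is_path (w x @ M x)" if "x \<in> ?D" for x
  proof (cases "snd x")
    case True
    then show ?thesis using R(2) that by (auto simp: w_def strand_def M_def)
  next
    case False
    then show ?thesis using sw[of "fst x"] that by (auto simp: w_def strand_def M_def switch_def)
  qed
  have en_in: "en x \<in> set (w x @ M x)" if "x \<in> ?D" for x unfolding en_def using wne[OF that] by (intro last_in_set) simp
  have st_in: "st x \<in> set (w x)" if "x \<in> ?D" for x unfolding st_def using wne[OF that] by simp
  have en_inj: "inj_on en ends"
  proof (rule inj_onI)
    fix x y assume xy: "x \<in> ends" "y \<in> ends" "en x = en y"
    then have D: "x \<in> ?D" "y \<in> ?D" using sub(1) by blast+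
    show "x = y"
    proof (rule ccontr)
      assume "x \<noteq> y"
      from wM[OF D this] en_in[OF D(1)] en_in[OF D(2)] xy(3) show False by (metis disjoint_iff)
    qed
  qed
  have st_inj: "inj_on st starts"
  proof (rule inj_onI)
    fix x y assume xy: "x \<in> starts" "y \<in> starts" "st x = st y"
    then have D: "x \<in> ?D" "y \<in> ?D" using sub(2) by blast+
    show "x = y"
    proof (rule ccontr)
      assume "x \<noteq> y"
      from wd[OF D this] st_in[OF D(1)] st_in[OF D(2)] xy(3) show False by (metis disjoint_iff)
    qed
  qed
  have p0': "0 < p" using p2 by simp
  have reg0: "region 0 = Q 0" by (simp add: region_def)
  have Q0S: "S0 \<inter> Q 0 = {}" using hub_region[OF p0'] reg0 by simp
  have Q0R: "set (R g) \<inter> Q 0 = {}" if "g < k" for g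
  proof -
    have "region i \<inter> region 0 = {}" if "i \<in> {1..<p}" for i using region_disjoint[of i 0] that by auto
    then have "(verts P \<union> (\<Union>i\<in>{1..<p}. region i)) \<inter> Q 0 = {}" using P_region[OF p0'] unfolding reg0 by blast
    then show ?thesis using R(4) that by blast
  qed
  have Q0M: "set (M x) \<inter> Q 0 = {}" if "x \<in> ?D" for x
    using Q0R[of "fst x"] that by (auto simp: M_def)
  have RV: "set (R g) \<subseteq> V" if "g < k" for g
  proof -
    have "verts P \<union> (\<Union>i\<in>{1..<p}. region i) \<subseteq> V" using cover by auto
    then show ?thesis using R(4) that by blast
  qed
  have S0V: "S0 \<subseteq> V" using cover by blast
  have wMV: "set (w x @ M x) \<subseteq> V" "set (w x @ M x) \<inter> Q 0 = {}" if "x \<in> ?D" for x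
  proof -
    have k: "fst x < k" using that by auto
    have "set (M x) \<subseteq> V" using RV[OF k] by (cases "snd x") (simp_all add: M_def)
    then show "set (w x @ M x) \<subseteq> V" using wS[OF that] S0V unfolding set_append by blast
    show "set (w x @ M x) \<inter> Q 0 = {}" using wS[OF that] Q0S Q0M[OF that] unfolding set_append by blast
  qed
  have en1: "en x \<in> V \<and> en x \<notin> Q 0" if "x \<in> ends" for x
  proof -
    have D: "x \<in> ?D" using that sub(1) by (rule subsetD[rotated])
    show ?thesis using en_in[OF D] wMV[OF D] by (meson disjoint_iff subsetD)
  qed
  then have enV: "en ` ends \<subseteq> V" "en ` ends \<inter> Q 0 = {}" by auto
  have st1: "st x \<in> V \<and> st x \<notin> Q 0" if "x \<in> starts" for x
  proof -
    have D: "x \<in> ?D" using that sub(2) by (rule subsetD[rotated])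
    show ?thesis using st_in[OF D] wS[OF D] S0V Q0S by (meson disjoint_iff subsetD)
  qed
  then have stV: "st ` starts \<subseteq> V" "st ` starts \<inter> Q 0 = {}" by auto
  have fin: "finite ends" "finite starts" by (simp_all add: ends_def starts_def)
  have "card ends = card starts" by (simp add: ends_def starts_def)
  then have cards: "card (en ` ends) = card (st ` starts)" using card_image[OF en_inj] card_image[OF st_inj] by simp
  have "(0, True) \<in> ends" "(0, True) \<in> starts" using k0 by (auto simp: ends_def starts_def)
  moreover have "en (0, True) = a 0" "st (0, True) = b 0"
    using R(1) a0 b0 by (simp_all add: en_def st_def w_def strand_def M_def)
  ultimately have "a 0 \<in> en ` ends" "b 0 \<in> st ` starts" by (metis image_eqI)+
  from linker[OF p0', unfolded linker_def, rule_format, OF enV(1) stV(1) this cards enV(2) stV(2)]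
  obtain h I where h: "bij_betw h (en ` ends) (st ` starts)"
    and I: "\<forall>s\<in>en ` ends. distinct (I s) \<and> successively E (s # I s @ [h s])"
      "\<forall>s\<in>en ` ends. \<forall>s'\<in>en ` ends. s \<noteq> s' \<longrightarrow> set (I s) \<inter> set (I s') = {}"
      "(\<Union>s\<in>en ` ends. set (I s)) = Q 0" by (elim exE conjE) (rule that)
  \<comment> \<open>Inside the hub the successor is the next segment; at the open ends it is read
    off from the bijection \<open>h\<close>.\<close>
  define t where "t = (\<lambda>x. if x \<in> ends then inv_into starts st (h (en x))
    else if x \<in> ?D then (Suc (fst x), snd x) else x)"
  have t1: "bij_betw (\<lambda>x. inv_into starts st (h (en x))) ends starts"
  proof -
    have "bij_betw (inv_into starts st) (st ` starts) starts"
      by (rule bij_betw_inv_into[OF inj_on_imp_bij_betw[OF st_inj]])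
    from bij_betw_trans[OF bij_betw_trans[OF inj_on_imp_bij_betw[OF en_inj] h] this]
    show ?thesis by (simp add: comp_def)
  qed
  have tends: "bij_betw t ends starts"
    using t1 by (rule bij_betw_cong[THEN iffD1, rotated]) (simp add: t_def)
  have De: "?D - ends = {..<k - 1} \<times> {False}" using k0 by (auto simp: ends_def)
  have Ds: "?D - starts = {1..<k} \<times> {False}" using k0 by (auto simp: starts_def)
  have tchain: "t (g, False) = (Suc g, False)" if "Suc g < k" for g
    using that by (auto simp: t_def ends_def)
  have "bij_betw t ({..<k - 1} \<times> {False}) ({1..<k} \<times> {False})"
    by (rule bij_betwI[where g = "\<lambda>x. (fst x - 1, False)"]) (use tchain in auto)
  then have "bij_betw t (ends \<union> (?D - ends)) (starts \<union> (?D - starts))"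
    unfolding De Ds by (rule bij_betw_combine[OF tends]) (auto simp: starts_def)
  moreover have "ends \<union> (?D - ends) = ?D" "starts \<union> (?D - starts) = ?D" using sub by blast+
  ultimately have "bij_betw t ?D ?D" by simp
  then have tperm: "t permutes ?D" by (rule bij_imp_permutes) (use sub in \<open>auto simp: t_def\<close>)
  define L where "L = (\<lambda>x. M x @ (if x \<in> ends then I (en x) else []))"
  have IQ: "set (I (en x)) \<subseteq> Q 0" if "x \<in> ends" for x using I(3) that by blast
  have Ld: "set (L x) \<inter> set (L y) = {}" if "x \<in> ?D" "y \<in> ?D" "x \<noteq> y" for x y
  proof -
    have "set (I (en x)) \<inter> set (I (en y)) = {}" if "x \<in> ends" "y \<in> ends"
      using I(2) that en_inj \<open>x \<noteq> y\<close> by (auto simp: inj_on_def)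
    then show ?thesis
      using Md[OF that] IQ[of x] IQ[of y] Q0M[OF that(1)] Q0M[OF that(2)] unfolding L_def
      by (cases "x \<in> ends"; cases "y \<in> ends"; simp; blast)
  qed
  have LL: "distinct (L x) \<and> set (L x) \<inter> S0 = {} \<and>
      successively E (last (strand p0 p1 x) # L x @ [hd (strand p0 p1 (t x))])" if x: "x \<in> ?D" for x
  proof (intro conjI)
    have pwM: "is_path (w x @ M x)" by (rule wMp[OF x])
    then have pM: "distinct (M x)" "successively E (last (w x) # M x)"
      using wne[OF x] by (auto simp: is_path_def successively_append_iff successively_Cons)
    show "set (L x) \<inter> S0 = {}" using MS[OF x] IQ[of x] Q0S by (auto simp: L_def)
    show "distinct (L x)" using pM(1) I(1) IQ[of x] Q0M[OF x] by (auto simp: L_def)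
    show "successively E (last (strand p0 p1 x) # L x @ [hd (strand p0 p1 (t x))])"
    proof (cases "x \<in> ends")
      case True
      have "h (en x) \<in> st ` starts" using h True by (auto simp: bij_betw_def)
      then have "st (t x) = h (en x)" unfolding t_def using True by (simp add: f_inv_into_f)
      then have "successively E (en x # I (en x) @ [hd (w (t x))])" using I(1) True by (simp add: st_def)
      moreover have "en x = last (last (w x) # M x)" using wne[OF x] by (simp add: en_def)
      ultimately show ?thesis using pM(2) True unfolding L_def w_def[symmetric]
        by (cases "M x = []") (auto simp: successively_append_iff successively_Cons)
    next
      case False
      then obtain g where g: "x = (g, False)" "Suc g < k" using x De by (metis (no_types, lifting) DiffI SigmaE lessThan_iff less_diff_conv singletonD add.commute plus_1_eq_Suc)
      have "E (last (p0 g)) (hd (p0 (Suc g)))" using hub g(2) by (simp add: hub_def)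
      then show ?thesis using g tchain[OF g(2)] False by (simp add: L_def M_def strand_def)
    qed
  qed
  from switch_cycle[OF hub k0 tperm tchain LL Ld] obtain zs where zs: "zs \<noteq> []" "distinct zs"
    "set zs = S0 \<union> (\<Union>x\<in>?D. set (L x))" "successively E (zs @ [hd zs])" by blast
  have "(\<Union>x\<in>?D. set (L x)) = (\<Union>x\<in>?D. set (M x)) \<union> (\<Union>x\<in>ends. set (I (en x)))"
    using sub(1) by (auto simp: L_def split: if_splits)
  also have "(\<Union>x\<in>ends. set (I (en x))) = Q 0" using I(3) by simp
  also have "(\<Union>x\<in>?D. set (M x)) = (\<Union>g<k. set (R g))" by (auto simp: M_def)
  finally have "set zs = S0 \<union> (verts P \<union> (\<Union>i\<in>{1..<p}. region i) \<union> region 0)" using zs(3) R(4) reg0 by simp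
  moreover have "{..<p} = insert 0 {1..<p}" using p0' by auto
  ultimately have "set zs = V" using cover by auto
  then show ?thesis using zs by blast
qed

end

section \<open>Choice of parameters\<close>

locale mixing_graph =
  fixes n d :: nat and E :: "nat \<Rightarrow> nat \<Rightarrow> bool" and K :: real
  assumes E_in: "E i j \<Longrightarrow> i < n \<and> j < n" and E_symmetric: "E i j \<Longrightarrow> E j i" and E_loop: "\<not> E i i"
    and regular: "i < n \<Longrightarrow> card {j. E i j} = d"
    and d_pos: "0 < d" and K_pos: "0 < K"
    and mixing: "X \<subseteq> {..<n} \<Longrightarrow> Z \<subseteq> {..<n} \<Longrightarrow>
      \<bar>real (card {(x, z) \<in> X \<times> Z. E x z}) - real d * card X * card Z / n\<bar> \<le> d / K * sqrt (card X * card Z)"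
begin

sublocale fin_graph "{..<n}" E
  by unfold_locales (use E_in E_symmetric E_loop in auto)

lemma card_edges:
  assumes "finite X" "finite Z"
  shows "card {(x, z) \<in> X \<times> Z. E x z} = (\<Sum>x\<in>X. card {z \<in> Z. E x z})"
proof -
  have "{(x, z) \<in> X \<times> Z. E x z} = (SIGMA x:X. {z \<in> Z. E x z})" by auto
  then show ?thesis using assms by simp
qed

text \<open>Mixing between a vertex and its own neighbourhood, where all \<open>d\<close> edges are
  present, gives 1 - d/n <= sqrt d / K; so d > n/2 or sqrt d >= K/2.\<close>

lemma degree_lower:
  assumes n: "K\<^sup>2 \<le> n" and d: "0 < n"
  shows "K\<^sup>2 / 4 \<le> d"
proof -
  let ?Z = "{j. E 0 j}"
  have Z: "?Z \<subseteq> {..<n}" "card ?Z = d" using E_in regular[OF d] by auto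
  have "card {(x, z) \<in> {0} \<times> ?Z. E x z} = d"
    using card_edges[of "{0}" ?Z] Z finite_subset[OF Z(1)] by simp
  moreover have "{0} \<subseteq> {..<n}" using d by simp
  ultimately have "\<bar>real d - real d * real d / n\<bar> \<le> d / K * sqrt d"
    using mixing[of "{0}" ?Z] Z by simp
  then have "real d * (1 - d / n) \<le> d * (sqrt d / K)" by (simp add: algebra_simps)
  then have *: "1 - d / n \<le> sqrt d / K"
    using d_pos by (simp only: mult_le_cancel_left_pos of_nat_0_less_iff)
  show ?thesis
  proof (cases "2 * d \<le> n")
    case True
    then have "d / n \<le> (1 / 2 :: real)" using d by (simp add: field_simps)
    then have "1 / 2 \<le> sqrt d / K" using * by linarith
    then have "K / 2 \<le> sqrt d" using K_pos by (simp add: field_simps)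
    then have "(K / 2)\<^sup>2 \<le> (sqrt d)\<^sup>2" using K_pos by (intro power_mono) auto
    then show ?thesis by (simp add: power_divide)
  next
    case False
    then have "real n < 2 * real d" by linarith
    then have "K\<^sup>2 < 2 * real d" using n by linarith
    then show ?thesis by simp
  qed
qed

text \<open>Without edges the deviation is the whole expected count, which forces K sqrt(|X||Z|) <=
  n.\<close>

lemma edge_between:
  assumes X: "X \<subseteq> {..<n}" and Z: "Z \<subseteq> {..<n}" and c: "n < K * card X" "n < K * card Z"
  shows "\<exists>x\<in>X. \<exists>z\<in>Z. E x z"
proof (rule ccontr)
  assume no: "\<not> ?thesis"
  then have "{(x, z) \<in> X \<times> Z. E x z} = {}" by blast
  then have e: "card {(x, z) \<in> X \<times> Z. E x z} = 0" by (simp only: card.empty)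
  have p: "0 < card X" "0 < card Z" using c K_pos by (auto intro!: Nat.gr0I)
  then have n0: "0 < n" using X by (metis card.empty lessThan_0 less_numeral_extra(3) neq0_conv subset_empty)
  define s where "s = sqrt (card X * card Z)"
  have s: "0 < s" "s * s = real (card X) * card Z" using p by (auto simp: s_def)
  have "real d * (s * s) / n \<le> d / K * s"
    using mixing[OF X Z] e s(2) unfolding s_def[symmetric] by (simp add: mult.assoc)
  then have "d * s * (s / n) \<le> d * s * (1 / K)" by (simp add: mult_ac)
  then have "s / n \<le> 1 / K" 
    using mult_le_cancel_left_pos[of "d * s" "s / n" "1 / K"] s(1) d_pos by simp
  then have "K * s \<le> n" using K_pos n0 by (simp add: field_simps)
  then have "(K * s)\<^sup>2 \<le> (real n)\<^sup>2" using K_pos s(1) by (intro power_mono) auto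
  then have "(K * card X) * (K * card Z) \<le> real n * n" using s(2) by (simp add: power2_eq_square mult_ac)
  moreover have "real n * n < (K * card X) * (K * card Z)" using c by (intro mult_strict_mono) auto
  ultimately show False by simp
qed

text \<open>All edges from \<open>U\<close> to \<open>W\<close> end in
  \<open>nb U \<inter> W\<close>. If this set is smaller than \<open>10 * card U\<close>, mixing
  admits fewer than \<open>t * card U\<close> edges into it; the 4 is an upper bound for the square
  root of 10.\<close>

lemma class_expansion:
  fixes t :: real and m :: nat
  assumes W: "W \<subseteq> {..<n}" "\<And>v. v < n \<Longrightarrow> t \<le> card {w \<in> W. E v w}"
    and t: "d * (10 * m / n + 4 / K) < t" and U: "U \<subseteq> {..<n}" "card U \<le> m" and n: "0 < n"
  shows "10 * card U \<le> card (nb U \<inter> W)"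
proof (rule ccontr)
  assume no: "\<not> ?thesis"
  define T where "T = nb U \<inter> W"
  have fin: "finite U" "finite T" "finite W" using U(1) W(1) by (auto simp: T_def intro: finite_subset)
  have T: "T \<subseteq> {..<n}" using W(1) by (auto simp: T_def)
  have u: "0 < card U" using no by simp
  have cT: "real (card T) \<le> 10 * card U" using no by (simp add: T_def)
  have "t * card U = (\<Sum>u\<in>U. t)" by simp
  also have "\<dots> \<le> (\<Sum>u\<in>U. real (card {w \<in> T. E u w}))"
  proof (rule sum_mono)
    fix u assume u: "u \<in> U"
    then have "{w \<in> T. E u w} = {w \<in> W. E u w}" by (auto simp: T_def nb_def)
    then show "t \<le> real (card {w \<in> T. E u w})" using W(2)[of u] u U(1) by auto
  qed
  also have "\<dots> = card {(x, z) \<in> U \<times> T. E x z}" using card_edges[OF fin(1,2)] by simp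
  also have "\<dots> \<le> real d * card U * card T / n + d / K * sqrt (card U * card T)"
    using mixing[OF U(1) T] by linarith
  also have "\<dots> \<le> real d * card U * (10 * m) / n + d / K * (4 * card U)"
  proof (rule add_mono)
    have "real (card T) \<le> 10 * m" using cT U(2) by linarith
    then show "real d * card U * card T / n \<le> real d * card U * (10 * m) / n"
      by (intro divide_right_mono mult_left_mono) auto
    have "real (card U) * real (card T) \<le> real (card U) * (10 * real (card U))" using cT by (intro mult_left_mono) auto
    also have "\<dots> \<le> (4 * real (card U))\<^sup>2" by (simp add: power2_eq_square)
    finally have "sqrt (card U * card T) \<le> 4 * card U" by (intro real_le_lsqrt) auto
    then show "d / K * sqrt (card U * card T) \<le> d / K * (4 * card U)" using K_pos by (intro mult_left_mono) auto
  qed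
  also have "\<dots> = (d * (10 * m / n + 4 / K)) * card U" by (simp add: algebra_simps)
  also have "\<dots> < t * card U" using t u by (intro mult_strict_right_mono) auto
  finally show False by simp
qed

text \<open>The edges from all vertices into \<open>W\<close> are counted in two ways: below by the
  degrees into \<open>W\<close>, above by mixing.\<close>

lemma class_size:
  fixes t :: real
  assumes W: "W \<subseteq> {..<n}" "\<And>v. v < n \<Longrightarrow> t * d \<le> card {w \<in> W. E v w}" and n: "0 < n"
  shows "n * (t - 1 / K) \<le> card W"
proof -
  have fin: "finite W" using W(1) by (auto intro: finite_subset)
  have cW: "card W \<le> n" using card_mono[OF _ W(1)] by simp
  have "t * d * n = (\<Sum>v<n. t * d)" by simp
  also have "\<dots> \<le> (\<Sum>v<n. real (card {w \<in> W. E v w}))" using W(2) by (intro sum_mono) auto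
  also have "\<dots> = card {(x, z) \<in> {..<n} \<times> W. E x z}" using card_edges[OF _ fin, of "{..<n}"] by simp
  also have "\<dots> \<le> real d * card W + d / K * sqrt (real n * card W)"
    using mixing[OF order_refl W(1)] n by simp
  also have "\<dots> \<le> real d * card W + d / K * n"
  proof -
    have "real n * card W \<le> n * n" using cW by (simp add: mult_left_mono flip: of_nat_mult)
    then have "sqrt (real n * card W) \<le> sqrt (n * n)" by (intro real_sqrt_le_mono)
    then have "sqrt (real n * card W) \<le> n" by simp
    then show ?thesis using K_pos by (intro add_left_mono mult_left_mono) auto
  qed
  finally have "real d * (n * (t - 1 / K)) \<le> real d * real (card W)" by (simp add: algebra_simps)
  then show ?thesis using d_pos by (simp only: mult_le_cancel_left_pos of_nat_0_less_iff)
qed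

end

text \<open>With \<open>K = (ln n) powr (1 / 3)\<close> we have \<open>K = x ^ 4\<close>; all parameters are chosen as powers of \<open>x\<close>.\<close>

theorem hamilton_cycle_of_mixing:
  fixes x :: real
  assumes mg: "mixing_graph n d E (x ^ 4)" and n: "real n = exp (x ^ 12)"
    and x: "500 \<le> x" "x ^ 25 \<le> 2 powr (x - 3)" "12 * x ^ 40 \<le> n"
    and col: "\<And>y. x ^ 8 / 4 \<le> y \<Longrightarrow> 16 * y powr (1 / 8) * y\<^sup>2 * exp (- (y powr (7 / 8)) / 16) \<le> 1"
  shows "\<exists>zs. zs \<noteq> [] \<and> distinct zs \<and> set zs = {..<n} \<and> successively E (zs @ [hd zs])"
proof -
  interpret mixing_graph n d E "x ^ 4" by (rule mg)
  have x0: "0 < x" "1 \<le> x" using x(1) by auto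
  have n0: "0 < n" using n by (metis exp_gt_zero of_nat_0_less_iff)
  define p where "p = nat \<lfloor>x\<rfloor>"
  have "real p = of_int \<lfloor>x\<rfloor>" using x0 by (simp add: p_def)
  then have p: "real p \<le> x" "x - 1 < p" by linarith+
  have p2: "2 \<le> p" using p(2) x(1) by linarith
  \<comment> \<open>Two classes for each linker and one, the last, for the room; \<open>p\<close> is
    about \<open>x\<close>, enough for 2^(p-2) to reach \<open>x ^ 25\<close>.\<close>
  define M where "M = 2 * p + 1"
  have M: "0 < M" "real M \<le> 3 * x" using p(1) x0 by (auto simp: M_def)
  have pw: "x ^ i \<le> x ^ j" if "i \<le> j" for i j using x0 that by (intro power_increasing) auto
  have nx: "12 * x ^ i \<le> n" if "i \<le> 40" for i using pw[OF that] x(3) by linarith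
  have d4: "x ^ 8 / 4 \<le> d"
  proof -
    have "(x ^ 4)\<^sup>2 \<le> n" using nx[of 8] x0 by (simp flip: power_mult)
    from degree_lower[OF this n0] show ?thesis by (simp flip: power_mult)
  qed
  \<comment> \<open>The condition is reduced to one in \<open>d\<close> alone, because
    \<open>d\<close> may be far larger than any power of \<open>x\<close>: from d >= x^8/4 follows M
    <= 3x <= 4 d^(1/8).\<close>
  have small: "4 * (M * exp (- d / (4 * M))) * (real d)\<^sup>2 \<le> 1"
  proof -
    have r8: "(c ^ 8) powr (1 / 8) = c" if "0 < c" for c :: real
    proof -
      have "(c ^ 8) powr (1 / 8) = (c powr 8) powr (1 / 8)" using that by simp
      also have "\<dots> = c powr (8 * (1 / 8))" by (rule powr_powr)
      finally show ?thesis using that by simp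
    qed
    define y where "y = real d"
    have y: "0 < y" using d_pos by (simp add: y_def)
    have "x ^ 8 \<le> 4 * y" using d4 by (simp add: y_def)
    then have "(x ^ 8) powr (1 / 8) \<le> (4 * y) powr (1 / 8)" using x0 by (intro powr_mono2) auto
    also have "\<dots> = 4 powr (1 / 8) * y powr (1 / 8)" using y by (simp add: powr_mult)
    also have "4 powr (1 / 8) \<le> (4 / 3 :: real)"
    proof -
      have "(4::real) \<le> (4 / 3) ^ 8" by (simp add: power_divide)
      then have "(4::real) powr (1 / 8) \<le> ((4 / 3) ^ 8) powr (1 / 8)" by (rule powr_mono2[rotated 2]) auto
      also have "\<dots> = 4 / 3" by (rule r8) simp
      finally show ?thesis .
    qed
    finally have "(x ^ 8) powr (1 / 8) \<le> 4 / 3 * y powr (1 / 8)" by (simp add: mult_right_mono)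
    moreover have "(x ^ 8) powr (1 / 8) = x" using x0(1) by (rule r8)
    ultimately have M4: "M \<le> 4 * y powr (1 / 8)" using M(2) by linarith
    have "y powr (7 / 8) * y powr (1 / 8) = y" using y by (simp flip: powr_add)
    then have "y powr (7 / 8) * (4 * M) \<le> 16 * y" 
      using mult_left_mono[OF M4, of "4 * y powr (7 / 8)"] by (simp add: mult_ac)
    then have "y powr (7 / 8) / 16 \<le> y / (4 * M)" using M(1) by (simp add: field_simps)
    then have e: "exp (- y / (4 * M)) \<le> exp (- (y powr (7 / 8)) / 16)" by simp
    have "4 * (M * exp (- y / (4 * M))) * y\<^sup>2 \<le> 4 * ((4 * y powr (1 / 8)) * exp (- (y powr (7 / 8)) / 16)) * y\<^sup>2"
      using M4 e y by (intro mult_right_mono mult_left_mono mult_mono) auto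
    also have "\<dots> = 16 * y powr (1 / 8) * y\<^sup>2 * exp (- (y powr (7 / 8)) / 16)" by (simp add: mult_ac)
    also have "\<dots> \<le> 1" using col d4 by (simp add: y_def)
    finally show ?thesis by (simp add: y_def)
  qed
  obtain f where f: "\<And>v. v < n \<Longrightarrow> f v < M"
    "\<And>v c. v < n \<Longrightarrow> c < M \<Longrightarrow> d / (4 * M) \<le> card {w \<in> {j. E v j}. f w = c}"
  proof (rule balanced_colouring[of "{..<n}" "\<lambda>v. {j. E v j}" d M])
    show "{j. E v j} \<subseteq> {..<n} \<and> card {j. E v j} = d" if "v \<in> {..<n}" for v
      using that regular E_in by auto
  qed (use M small E_symmetric in auto)
  define W where "W = (\<lambda>c. {w. w < n \<and> f w = c})"
  have Wn: "W c \<subseteq> {..<n}" for c by (auto simp: W_def)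
  have Wdeg: "d / (4 * M) \<le> card {w \<in> W c. E v w}" if "v < n" "c < M" for v c
  proof -
    have "{w \<in> {j. E v j}. f w = c} = {w \<in> W c. E v w}" using E_in by (auto simp: W_def)
    then show ?thesis using f(2)[OF that] by simp
  qed
  \<comment> \<open>Just above n/K with K = x^4, the size from which \<open>edge_between\<close>
    applies.\<close>
  define \<mu> where "\<mu> = nat \<lfloor>n / x ^ 4\<rfloor> + 1"
  have \<mu>: "n / x ^ 4 < \<mu>" "\<mu> \<le> 2 * (n / x ^ 4)" "1 \<le> \<mu>"
  proof -
    have 1: "1 \<le> n / x ^ 4" using nx[of 4] x0 by (simp add: pos_le_divide_eq)
    have f: "0 \<le> n / x ^ 4" using x0 by simp
    have "real (nat \<lfloor>n / x ^ 4\<rfloor>) = of_int \<lfloor>n / x ^ 4\<rfloor>" using f by simp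
    then show "n / x ^ 4 < \<mu>" "\<mu> \<le> 2 * (n / x ^ 4)" using 1 unfolding \<mu>_def of_nat_add by linarith+
    show "1 \<le> \<mu>" by (simp add: \<mu>_def)
  qed
  interpret joined_graph "{..<n}" E \<mu>
  proof
    show "1 \<le> \<mu>" by (rule \<mu>(3))
    fix A B assume AB: "A \<subseteq> {..<n}" "B \<subseteq> {..<n}" "\<mu> \<le> card A" "\<mu> \<le> card B"
    have "n < x ^ 4 * c" if "\<mu> \<le> c" for c :: nat
    proof -
      have "n / x ^ 4 < c" using \<mu>(1) that by linarith
      then show ?thesis using x0 by (simp add: pos_divide_less_eq mult.commute)
    qed
    then show "\<exists>a\<in>A. \<exists>b\<in>B. E a b" using AB by (intro edge_between) auto
  qed
  have Wexp: "10 * card U \<le> card (nb U \<inter> W c)" if "c < M" "U \<subseteq> {..<n}" "card U \<le> 2 * \<mu>" for c U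
  proof (rule class_expansion[OF Wn Wdeg[OF _ that(1)] _ that(2,3) n0])
    have "10 * real (2 * \<mu>) / n \<le> 40 / x ^ 4"
    proof -
      have "10 * real (2 * \<mu>) / n \<le> 10 * (2 * (2 * (n / x ^ 4))) / n"
        using \<mu>(2) by (intro divide_right_mono) auto
      then show ?thesis using n0 by simp
    qed
    then have "10 * real (2 * \<mu>) / n + 4 / x ^ 4 \<le> 44 / x ^ 4" by (simp add: add_divide_distrib[symmetric])
    also have "44 / x ^ 4 < 1 / (12 * x)"
    proof -
      have "500 * 500 * 500 \<le> x * x * x" using x(1) by (intro mult_mono) auto
      then have "528 < x ^ 3" by (simp add: power3_eq_cube)
      then have "528 * x < x ^ 3 * x" using x0 by (intro mult_strict_right_mono) auto
      then have "528 * x < x ^ 4" by (simp add: eval_nat_numeral)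
      then show ?thesis using x0 by (simp add: field_simps)
    qed
    also have "1 / (12 * x) \<le> 1 / (4 * M)" using M x0 by (intro divide_left_mono) auto
    finally have "10 * real (2 * \<mu>) / n + 4 / x ^ 4 < 1 / (4 * M)" .
    then have "d * (10 * real (2 * \<mu>) / n + 4 / x ^ 4) < d * (1 / (4 * M))"
      using d_pos by (intro mult_strict_left_mono) auto
    then show "d * (real (10 * (2 * \<mu>)) / n + 4 / x ^ 4) < d / (4 * M)" by simp
  qed
  have Wsize: "n / (24 * x) \<le> card (W c)" if "c < M" for c
  proof -
    have "n * (1 / (4 * M) - 1 / x ^ 4) \<le> card (W c)"
      by (rule class_size[OF Wn _ n0]) (use Wdeg[OF _ that] in auto)
    moreover have "1 / (24 * x) \<le> 1 / (4 * M) - 1 / x ^ 4"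
    proof -
      have "1 / (12 * x) \<le> 1 / (4 * M)" using M x0 by (intro divide_left_mono) auto
      moreover have "24 * x \<le> x ^ 4"
      proof -
        have "24 * x \<le> x * x" using x(1) by (intro mult_right_mono) auto
        also have "\<dots> \<le> x ^ 4" using pw[of 2 4] by (simp add: power2_eq_square)
        finally show ?thesis .
      qed
      then have "1 / x ^ 4 \<le> 1 / (24 * x)" using x0 by (intro divide_left_mono) auto
      moreover have "1 / (12 * x) = 2 * (1 / (24 * x))" by simp
      ultimately show ?thesis by linarith
    qed
    then have "n * (1 / (24 * x)) \<le> n * (1 / (4 * M) - 1 / x ^ 4)" by (intro mult_left_mono) auto
    ultimately show ?thesis by simp
  qed
  define Y where "Y = W (2 * p)"
  interpret room_graph "{..<n}" E \<mu> Y
  proof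
    show "Y \<subseteq> {..<n}" using Wn by (simp add: Y_def)
    show "10 * card U \<le> card (nb U \<inter> Y)" if "U \<subseteq> {..<n}" "card U \<le> 2 * \<mu>" for U
      unfolding Y_def by (rule Wexp) (use that in \<open>auto simp: M_def\<close>)
  qed
  \<comment> \<open>A switch costs at most \<open>2 * (4 * x ^ 12)\<^sup>2\<close> vertices of the
    room, so this many of them stay within 32 n/x^4.\<close>
  define k where "k = nat \<lfloor>n / x ^ 28\<rfloor>"
  have k: "k \<le> n / x ^ 28" "n / x ^ 28 - 1 < k" and k5: "10 * x ^ 12 \<le> n / x ^ 28"
  proof -
    have f: "0 \<le> n / x ^ 28" using x0 by simp
    then have "real k = of_int \<lfloor>n / x ^ 28\<rfloor>" by (simp add: k_def)
    then show "k \<le> n / x ^ 28" "n / x ^ 28 - 1 < k" by linarith+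
    have "x ^ 12 * x ^ 28 = x ^ 40" by (simp flip: power_add)
    moreover have "0 \<le> x ^ 40" using x0 by simp
    ultimately have "10 * x ^ 12 * x ^ 28 \<le> n" using nx[of 40] by (simp add: mult.assoc)
    then show "10 * x ^ 12 \<le> n / x ^ 28" using x0 by (simp add: pos_le_divide_eq)
  qed
  \<comment> \<open>2^J has to reach \<open>\<mu>\<close>, for which n = exp(x^12) is enough. The
    factor 3 exceeds 1 / ln 2 with space to spare for the subtracted 2, and \<open>J + 2\<close> is
    the quantity in the cost of a switch.\<close>
  define J where "J = nat \<lceil>3 * x ^ 12\<rceil> - 2"
  have x12: "500 \<le> x ^ 12" using pw[of 1 12] x(1) by simp
  have J: "J + 2 \<le> 4 * x ^ 12" "3 * x ^ 12 - 2 \<le> J"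
  proof -
    have c: "0 \<le> \<lceil>3 * x ^ 12\<rceil>" "2 \<le> nat \<lceil>3 * x ^ 12\<rceil>" using x12 by linarith+
    then have "real J = of_int \<lceil>3 * x ^ 12\<rceil> - 2" unfolding J_def by (simp add: of_nat_diff)
    then show "J + 2 \<le> 4 * x ^ 12" "3 * x ^ 12 - 2 \<le> J" using x12 by linarith+
  qed
  have \<mu>J: "\<mu> \<le> 2 ^ J"
  proof -
    have "real \<mu> \<le> n"
    proof -
      have "2 \<le> x ^ 4" using pw[of 1 4] x(1) by simp
      then have "real n * 2 \<le> n * x ^ 4" by (rule mult_left_mono) simp
      then have "2 * (n / x ^ 4) \<le> n" using x0 by (simp add: field_simps)
      then show ?thesis using \<mu>(2) by linarith
    qed
    also have "\<dots> \<le> exp (J * ln 2)"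
    proof -
      have "exp (1 / 2 :: real) ^ 2 = exp 1" by (simp flip: exp_of_nat_mult)
      also have "\<dots> \<le> 2 ^ 2" using exp_le by simp
      finally have "exp (1 / 2 :: real) \<le> 2" by (rule power2_le_imp_le) simp
      then have "1 / 2 \<le> ln (2 :: real)" by (rule ln_ge_iff[THEN iffD2, rotated]) simp
      then have "(3 * x ^ 12 - 2) * (1 / 2) \<le> J * ln 2" using J(2) x12 by (intro mult_mono) auto
      moreover have "x ^ 12 \<le> (3 * x ^ 12 - 2) * (1 / 2)" using x12 by (simp add: field_simps)
      ultimately have "x ^ 12 \<le> J * ln 2" by (rule order_trans[rotated])
      then show ?thesis using n by simp
    qed
    also have "\<dots> = 2 ^ J" by (simp add: exp_of_nat_mult)
    finally show ?thesis by (simp flip: of_nat_le_iff)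
  qed
  have two_p: "x ^ 25 \<le> 2 ^ (p - 2)"
  proof -
    have "2 powr (x - 3) \<le> 2 powr real (p - 2)" using p(2) p2 by (intro powr_mono) (auto simp: of_nat_diff)
    then show ?thesis using x(2) by (simp add: powr_realpow)
  qed
  \<comment> \<open>Cheap connections use depth \<open>p\<close>, which needs q 2^p >= \<mu>. Then
    the roughly 2q long connections of order x^12 take only about n/x^12 vertices for each class, up
    to a constant.\<close>
  define q where "q = \<mu> div 2 ^ p + 1"
  have \<mu>q: "\<mu> \<le> q * 2 ^ p"
  proof -
    have "\<mu> = \<mu> div 2 ^ p * 2 ^ p + \<mu> mod 2 ^ p" by (rule div_mult_mod_eq[symmetric])
    moreover have "\<mu> mod 2 ^ p \<le> 2 ^ p" by (simp add: less_imp_le)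
    ultimately show ?thesis unfolding q_def add_mult_distrib by linarith
  qed
  have q: "q \<le> n / x ^ 24 + 1"
  proof -
    have "real (\<mu> div 2 ^ p) \<le> \<mu> / 2 ^ p" using of_nat_div_le_of_nat[of \<mu> "2 ^ p"] by simp
    also have "\<dots> \<le> \<mu> / x ^ 25"
    proof -
      have "(2::real) ^ (p - 2) \<le> 2 ^ p" by (intro power_increasing) auto
      then have "x ^ 25 \<le> 2 ^ p" using two_p by linarith
      then show ?thesis using x0 by (intro divide_left_mono) auto
    qed
    also have "\<dots> \<le> 2 * (n / x ^ 4) / x ^ 25" using \<mu>(2) x0 by (intro divide_right_mono) auto
    also have "\<dots> = 2 * n / (x ^ 4 * x ^ 25)" by simp
    also have "x ^ 4 * x ^ 25 = x ^ 24 * x ^ 5" by (simp flip: power_add)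
    also have "2 * n / (x ^ 24 * x ^ 5) = n / x ^ 24 * (2 / x ^ 5)" by simp
    also have "\<dots> \<le> n / x ^ 24 * 1"
    proof -
      have "2 \<le> x ^ 5" using pw[of 1 5] x(1) by simp
      then show ?thesis using x0 by (intro mult_left_mono) auto
    qed
    finally show ?thesis by (simp add: q_def)
  qed
  define u where "u = n / x ^ 4"
  have u0: "0 \<le> u" using x0 by (simp add: u_def)
  \<comment> \<open>The cheap connections dominate: about x classes, \<mu> paths each and about x
    vertices per connection are of order n/x^2. This fits into the class size n/(24x) for
    \<open>x \<ge> 500\<close>, since 17 * 24 < 500.\<close>
  have room: "k * (2 * (J + 2) ^ 2) + 2 * p * (\<mu> * (2 * (p + 1)) + (2 * q + 1) * (2 * (J + 1))) + 20 * \<mu> \<le> card Y"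
  proof -
    have t1: "real k * (2 * (real J + 2)\<^sup>2) \<le> 32 * u"
    proof -
      have "(real J + 2)\<^sup>2 \<le> (4 * x ^ 12)\<^sup>2" using J(1) by (intro power_mono) auto
      then have "real k * (2 * (real J + 2)\<^sup>2) \<le> n / x ^ 28 * (2 * (4 * x ^ 12)\<^sup>2)"
        using k(1) x0 by (intro mult_mono[of "real k"]) auto
      also have "\<dots> = 32 * u"
      proof -
        have 1: "(4 * x ^ 12)\<^sup>2 = 16 * x ^ 24" by (simp add: power_mult_distrib flip: power_mult)
        have 2: "x ^ 28 = x ^ 24 * x ^ 4" by (simp flip: power_add)
        have "m / (a * b) * (2 * (16 * a)) = 32 * (m / b)" if "a \<noteq> 0" for m a b :: real using that by simp
        then show ?thesis unfolding u_def 1 2 using x0 by (metis power_not_zero less_irrefl)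
      qed
      finally show ?thesis .
    qed
    have t2: "2 * real p * (\<mu> * (2 * (real p + 1))) \<le> 16 * (u * x\<^sup>2)"
    proof -
      have "2 * (real p + 1) \<le> 4 * x" using p(1) x0 by simp
      then have "\<mu> * (2 * (real p + 1)) \<le> (2 * u) * (4 * x)"
        using \<mu>(2) u0 unfolding u_def by (intro mult_mono[of "real \<mu>"]) auto
      then have "2 * real p * (\<mu> * (2 * (real p + 1))) \<le> (2 * x) * ((2 * u) * (4 * x))"
        using p(1) x0 by (intro mult_mono[of "2 * real p"]) auto
      then show ?thesis by (simp add: power2_eq_square mult_ac)
    qed
    have t3: "2 * real p * ((2 * real q + 1) * (2 * (real J + 1))) \<le> 80 * u"
    proof -
      have "2 * real q + 1 \<le> 2 * (n / x ^ 24) + 3" "2 * (real J + 1) \<le> 8 * x ^ 12" using q J(1) by simp_all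
      then have "(2 * real q + 1) * (2 * (real J + 1)) \<le> (2 * (n / x ^ 24) + 3) * (8 * x ^ 12)"
        using x0 by (intro mult_mono[of "2 * real q + 1"]) auto
      also have "\<dots> \<le> (5 * (n / x ^ 24)) * (8 * x ^ 12)"
      proof -
        have "12 * x ^ 24 \<le> n" "0 \<le> x ^ 24" using nx[of 24] x0 by simp_all
        then have "x ^ 24 \<le> n" by linarith
        then have "1 \<le> n / x ^ 24" using x0 by (simp add: pos_le_divide_eq)
        then have "2 * (n / x ^ 24) + 3 \<le> 5 * (n / x ^ 24)" by linarith
        then show ?thesis by (rule mult_right_mono) (use x0 in simp)
      qed
      finally have "2 * real p * ((2 * real q + 1) * (2 * (real J + 1))) \<le> (2 * x) * ((5 * (n / x ^ 24)) * (8 * x ^ 12))"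
        using p(1) x0 by (intro mult_mono[of "2 * real p"]) auto
      also have "\<dots> = 80 * (n / x ^ 11)"
      proof -
        have 1: "x ^ 24 = x ^ 11 * (x * x ^ 12)" by (simp flip: power_add power_Suc)
        have "(2 * b) * ((5 * (m / (a * (b * c)))) * (8 * c)) = 80 * (m / a)" if "b \<noteq> 0" "c \<noteq> 0"
          for m a b c :: real using that by simp
        then show ?thesis unfolding 1 using x0 by (metis power_not_zero less_irrefl)
      qed
      also have "n / x ^ 11 \<le> u" unfolding u_def using pw[of 4 11] x0 by (intro divide_left_mono) auto
      finally show ?thesis by simp
    qed
    have t4: "20 * real \<mu> \<le> 40 * u" using \<mu>(2) by (simp add: u_def)
    have "152 \<le> x\<^sup>2" using x(1) mult_mono[of 500 x 500 x] by (simp add: power2_eq_square)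
    then have "152 * u \<le> x\<^sup>2 * u" using u0 by (rule mult_right_mono)
    then have t5: "152 * u \<le> u * x\<^sup>2" by (simp add: mult.commute)
    have "real (k * (2 * (J + 2) ^ 2) + 2 * p * (\<mu> * (2 * (p + 1)) + (2 * q + 1) * (2 * (J + 1))) + 20 * \<mu>)
      = real k * (2 * (real J + 2)\<^sup>2) + (2 * real p * (\<mu> * (2 * (real p + 1)))
        + 2 * real p * ((2 * real q + 1) * (2 * (real J + 1)))) + 20 * real \<mu>"
      by (simp add: algebra_simps)
    also have "\<dots> \<le> 17 * (u * x\<^sup>2)" using t1 t2 t3 t4 t5 by linarith
    also have "u * x\<^sup>2 = n / x\<^sup>2"
    proof -
      have 1: "x ^ 4 = x\<^sup>2 * x\<^sup>2" by (simp flip: power_add)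
      have "m / (a * a) * a = m / a" if "a \<noteq> 0" for m a :: real using that by simp
      then show ?thesis unfolding u_def 1 using x0 by (metis power_not_zero less_irrefl)
    qed
    also have "17 * (n / x\<^sup>2) \<le> n / (24 * x)"
    proof -
      have "17 * (24 * x) \<le> x\<^sup>2" using x(1) by (simp add: power2_eq_square)
      then have "n * (17 * (24 * x)) \<le> n * x\<^sup>2" by (intro mult_left_mono) auto
      then show ?thesis using x0 by (simp add: field_simps)
    qed
    also have "\<dots> \<le> card Y" unfolding Y_def by (rule Wsize) (simp add: M_def)
    finally show ?thesis by (simp only: of_nat_le_iff)
  qed
  have k10: "10 \<le> n / x ^ 28" using k5 x12 by linarith
  have k2: "2 \<le> k" using k(2) k10 by linarith
  \<comment> \<open>x^25 times half of n/x^28 is n/(2x^3), larger than n/x^4 by the factor x/2,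
    while \<open>\<mu>\<close> is at most twice n/x^4.\<close>
  have final: "\<mu> < 2 ^ (p - 2) * (k - 4)"
  proof -
    have "4 \<le> k" using k(2) k10 by linarith
    then have "real (k - 4) = real k - 4" by (simp add: of_nat_diff)
    then have "n / x ^ 28 / 2 \<le> real (k - 4)" using k(2) k10 by argo
    then have "x ^ 25 * (n / x ^ 28 / 2) \<le> 2 ^ (p - 2) * real (k - 4)"
      using two_p x0 by (intro mult_mono) auto
    moreover have "x ^ 25 * (n / x ^ 28 / 2) = u * (x / 2)"
    proof -
      have 1: "x ^ 28 = x ^ 25 * x ^ 3" and 2: "x ^ 4 = x ^ 3 * x" by (simp_all flip: power_add power_Suc2)
      have "a * (m / (a * b) / 2) = m / (b * c) * (c / 2)" if "a \<noteq> 0" "c \<noteq> 0" for m a b c :: real using that by simp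
      then show ?thesis unfolding u_def 1 2 using x0 by (metis power_not_zero less_irrefl)
    qed
    moreover have "u * 2 < u * (x / 2)" using x(1) x0 n0 by (intro mult_strict_left_mono) (auto simp: u_def)
    ultimately have "real \<mu> < 2 ^ (p - 2) * real (k - 4)" using \<mu>(2) unfolding u_def by linarith
    then have "real \<mu> < real (2 ^ (p - 2) * (k - 4))"
      by (simp only: of_nat_mult of_nat_power of_nat_numeral)
    then show ?thesis by (simp only: of_nat_less_iff)
  qed
  have WY: "\<forall>i<2 * p. W i \<subseteq> {..<n} - Y \<and> W i \<noteq> {}"
  proof (intro allI impI conjI)
    fix i assume i: "i < 2 * p"
    then show "W i \<subseteq> {..<n} - Y" by (auto simp: W_def Y_def)
    have "0 < n / (24 * x)" using n0 x0 by simp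
    also have "n / (24 * x) \<le> card (W i)" by (rule Wsize) (use i in \<open>simp add: M_def\<close>)
    finally show "W i \<noteq> {}" by auto
  qed
  have cover: "(\<Union>i<2 * p. W i) = {..<n} - Y"
  proof -
    have "f w < 2 * p \<or> f w = 2 * p" if "w < n" for w using f(1)[OF that] by (auto simp: M_def)
    then show ?thesis by (auto simp: W_def Y_def)
  qed
  have Wdisj: "\<forall>i<2 * p. \<forall>i'<2 * p. i \<noteq> i' \<longrightarrow> W i \<inter> W i' = {}" by (auto simp: W_def)
  have Wex: "\<forall>i<2 * p. \<forall>U. U \<subseteq> {..<n} \<longrightarrow> card U \<le> 2 * \<mu> \<longrightarrow> 10 * card U \<le> card (nb U \<inter> W i)"
    by (intro allI impI Wexp) (simp_all add: M_def)
  obtain p0 p1 q0 q1 S0 Q a b P where "absorbing_partition {..<n} E \<mu> k p p0 p1 q0 q1 S0 Q a b P"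
    by (rule absorbing_partition_exists[OF WY Wdisj cover Wex \<mu>J \<mu>q p2 k2 room])
  then interpret absorbing_partition "{..<n}" E \<mu> k p p0 p1 q0 q1 S0 Q a b P .
  show ?thesis by (rule hamilton_cycle[OF final])
qed

section \<open>Return to the given definitions, and the constant\<close>

lemma hamiltonianI:
  assumes n: "3 \<le> n" and zs: "distinct zs" "set zs = {..<n}" "successively E (zs @ [hd zs])"
  shows "hamiltonian n E"
proof -
  have len: "length zs = n" using distinct_card[OF zs(1)] zs(2) by simp
  have "E (zs ! i) (zs ! ((i + 1) mod n))" if i: "i < n" for i
  proof -
    have "zs \<noteq> []" using len n by auto
    then have h: "hd zs = zs ! 0" by (rule hd_conv_nth)
    have "E ((zs @ [hd zs]) ! i) ((zs @ [hd zs]) ! Suc i)"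
      using zs(3) i len unfolding successively_conv_nth by simp
    then show ?thesis using i len h by (cases "Suc i = n") (auto simp: nth_append)
  qed
  then show ?thesis using n zs(1,2) unfolding hamiltonian_def by (auto simp: lessThan_atLeast0)
qed

text \<open>Mixing from vertex 0 to itself: there is no loop where d/n is expected. Consequently a
  large \<open>C\<close> leaves only large \<open>n\<close> to be treated.\<close>

lemma ndl_graph_ratio_le:
  assumes ndl: "ndl_graph n d lam E" and n: "0 < n" and lam: "0 < lam"
  shows "d / lam \<le> n"
proof -
  have "\<not> E 0 0" using ndl by (auto simp: ndl_graph_def simple_graph_def)
  then have "{(x, z) \<in> {0::nat} \<times> {0}. E x z} = {}" by auto
  then have e: "card {(x, z) \<in> {0::nat} \<times> {0}. E x z} = 0" by (simp only: card.empty)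
  have "d / n \<le> lam" using expander_mixing[OF ndl order_refl, of "{0}" "{0}", unfolded e] n lam by simp
  then show ?thesis using n lam by (simp add: field_simps)
qed

theorem theorem1p2:
  shows "\<exists>C::real. C > 0 \<and>
    (\<forall>n d (lam::real) E. n \<ge> 2 \<longrightarrow> ndl_graph n d lam E \<longrightarrow>
       real d / lam \<ge> C * ln (real n) powr (1/3) \<longrightarrow> hamiltonian n E)"
proof -
  have "eventually (\<lambda>y::real. 16 * y powr (1 / 8) * y\<^sup>2 * exp (- (y powr (7 / 8)) / 16) \<le> 1) at_top"
    by real_asymp
  then obtain y0 where y0: "\<And>y::real. y0 \<le> y \<Longrightarrow> 16 * y powr (1 / 8) * y\<^sup>2 * exp (- (y powr (7 / 8)) / 16) \<le> 1"
    by (auto simp: eventually_at_top_linorder)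
  have "eventually (\<lambda>x::real. 500 \<le> x \<and> x ^ 25 \<le> 2 powr (x - 3) \<and> 12 * x ^ 40 \<le> exp (x ^ 12) \<and> y0 \<le> x ^ 8 / 4) at_top"
    by (intro eventually_conj) real_asymp+
  moreover have "filterlim (\<lambda>n::nat. ln (real n) powr (1 / 12)) at_top at_top" by real_asymp
  ultimately have "eventually (\<lambda>n::nat. let x = ln (real n) powr (1 / 12) in
      500 \<le> x \<and> x ^ 25 \<le> 2 powr (x - 3) \<and> 12 * x ^ 40 \<le> exp (x ^ 12) \<and> y0 \<le> x ^ 8 / 4) at_top"
    unfolding Let_def by (rule eventually_compose_filterlim)
  then obtain n0 where n0: "\<And>n::nat. n0 \<le> n \<Longrightarrow> let x = ln (real n) powr (1 / 12) in
      500 \<le> x \<and> x ^ 25 \<le> 2 powr (x - 3) \<and> 12 * x ^ 40 \<le> exp (x ^ 12) \<and> y0 \<le> x ^ 8 / 4"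
    by (auto simp: eventually_at_top_linorder)
  define l where "l = ln (2::real) powr (1 / 3)"
  have l: "0 < l" by (simp add: l_def)
  \<comment> \<open>As \<open>d / lam\<close> is at most \<open>n\<close> and
    \<open>ln n \<ge> ln 2\<close>, this choice forces \<open>n \<ge> n0 + 1\<close>, so all
    asymptotic inequalities are available; \<open>C \<ge> 1\<close> gives d/lam >= x^4.\<close>
  define C where "C = max 1 ((real n0 + 1) / l)"
  have C: "1 \<le> C" "real n0 + 1 \<le> C * l" using l by (auto simp: C_def max_def field_simps)
  show ?thesis
  proof (intro exI[of _ C] conjI allI impI)
    show "0 < C" using C by simp
    fix n d and lam :: real and E
    assume n: "2 \<le> n" and ndl: "ndl_graph n d lam E" and ratio: "real d / lam \<ge> C * ln (real n) powr (1 / 3)"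
    have ln2: "ln 2 \<le> ln (real n)" using n by simp
    have "0 < ln (2::real)" by simp
    then have lnn: "0 < ln (real n)" using ln2 by linarith
    have lle: "l \<le> ln (real n) powr (1 / 3)" unfolding l_def using ln2 by (intro powr_mono2) auto
    \<comment> \<open>Division by 0 yields 0, so \<open>lam = 0\<close> does not meet the hypothesis
      on the ratio; since n >= 2 makes the logarithm positive, both \<open>lam\<close> and
      \<open>d\<close> are positive.\<close>
    have pos: "0 < real d / lam"
    proof -
      have "0 < C * ln (real n) powr (1 / 3)" using C(1) lnn by simp
      then show ?thesis using ratio by linarith
    qed
    have lam: "0 < lam" and d: "0 < d" using pos by (auto simp: zero_less_divide_iff)
    have n_pos: "0 < n" using n by simp
    have "C * l \<le> C * ln (real n) powr (1 / 3)" using lle C(1) by (intro mult_left_mono) auto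
    then have "real n0 + 1 \<le> real n" using C(2) ratio ndl_graph_ratio_le[OF ndl n_pos lam] by linarith
    then have nn0: "n0 \<le> n" by linarith
    define x where "x = ln (real n) powr (1 / 12)"
    have x: "500 \<le> x" "x ^ 25 \<le> 2 powr (x - 3)" "12 * x ^ 40 \<le> exp (x ^ 12)" "y0 \<le> x ^ 8 / 4"
      using n0[OF nn0] unfolding Let_def x_def[symmetric] by auto
    have x0: "0 < x" using x(1) by simp
    have xp: "x ^ k = ln (real n) powr (k / 12)" for k
      using x0 lnn by (simp add: x_def powr_powr flip: powr_realpow)
    have "x ^ 12 = ln (real n)" using xp[of 12] lnn by simp
    then have nexp: "real n = exp (x ^ 12)" using n_pos by simp
    have x4: "x ^ 4 = ln (real n) powr (1 / 3)" using xp[of 4] by simp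
    have "1 * x ^ 4 \<le> C * x ^ 4" using C(1) x0 by (intro mult_right_mono) auto
    then have "x ^ 4 \<le> d / lam" using ratio x4 by simp
    then have lamK: "lam \<le> d / x ^ 4" using lam x0 by (simp add: field_simps)
    have sg: "simple_graph n E" and rg: "regular_graph n E d" using ndl by (auto simp: ndl_graph_def)
    have "mixing_graph n d E (x ^ 4)"
    proof
      show "i < n \<and> j < n" "E j i" if "E i j" for i j using sg that by (auto simp: simple_graph_def)
      show "\<not> E i i" for i using sg by (simp add: simple_graph_def)
      show "card {j. E i j} = d" if "i < n" for i
      proof -
        have "{j. E i j} = {j. j < n \<and> E i j}" using sg by (auto simp: simple_graph_def)
        then show ?thesis using rg that by (simp add: regular_graph_def)
      qed
      show "0 < d" "0 < x ^ 4" using d x0 by auto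
      show "\<bar>real (card {(x, z) \<in> X \<times> Z. E x z}) - real d * card X * card Z / n\<bar> \<le> d / x ^ 4 * sqrt (card X * card Z)"
        if "X \<subseteq> {..<n}" "Z \<subseteq> {..<n}" for X Z
        by (rule expander_mixing[OF ndl lamK _ that]) (use x0 in simp)
    qed
    then obtain zs where zs: "distinct zs" "set zs = {..<n}" "successively E (zs @ [hd zs])"
      using hamilton_cycle_of_mixing[OF _ nexp x(1,2)] x(3,4) y0 nexp by fastforce
    have "500 \<le> x ^ 12" using x(1) power_increasing[of 1 12 x] by simp
    then have "500 \<le> real n" using nexp exp_ge_add_one_self[of "x ^ 12"] by linarith
    then show "hamiltonian n E" using zs by (intro hamiltonianI) auto
  qed
qed

end
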